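(* Let $N\geq 2$ and $1\leq k\leq N$, and let $\mathcal{H}(\mathbb{R}^N)$ be the Fréchet space of harmonic functions on $\mathbb{R}^N$. (i) Let $\varphi\colon\mathbb{R}_+\to\mathbb{R}_+$ be any function with $\varphi(r)\to\infty$ as $r\to\infty$. Then there exists a function $h\in\mathcal{H}(\mathbb{R}^N)$ which is irregular for the operator $\partial/\partial x_k\colon\mathcal{H}(\mathbb{R}^N)\to\mathcal{H}(\mathbb{R}^N)$ and satisfies $$M_2(h,r)\leq\varphi(r)\frac{e^r}{r^{(N-1)/2}}$$ for all $r>0$ sufficiently large. (ii) Let $\alpha\in\mathbb{N}^N$ be a multi-index. There does not exist a function $h\in\mathcal{H}(\mathbb{R}^N)$ which is irregular for the operator $D^\alpha\colon\mathcal{H}(\mathbb{R}^N)\to\mathcal{H}(\mathbb{R}^N)$ and for which there is a constant $C>0$ with $$M_2(h,r)\leq C\,\frac{e^r}{r^{(N-1)/2}}\quad\text{for all } r>0.$$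
   Context: $\mathcal{H}(\mathbb{R}^N)$ is the space of real-valued harmonic functions on $\mathbb{R}^N$ with the topology of local uniform convergence, given by the increasing sequence of seminorms $\|h\|_n=\sup_{\|x\|=n}|h(x)|$, $n\in\mathbb{N}$ ($n \ge 1$); it is a Fréchet space. For a multi-index $\alpha=(\alpha_1,\dots,\alpha_N)$ of nonnegative integers (this is what $\alpha\in\mathbb{N}^N$ means here), $|\alpha|=\alpha_1+\cdots+\alpha_N$ and $D^\alpha=\frac{\partial^{|\alpha|}}{\partial x_1^{\alpha_1}\cdots\partial x_N^{\alpha_N}}$. For $r>0$, $S(r)$ is the Euclidean sphere of radius $r$ centred at the origin of $\mathbb{R}^N$, $\sigma_r$ is the normalised $(N-1)$-dimensional surface measure on $S(r)$ (so $\sigma_r(S(r))=1$), and $M_2(h,r)=\left(\int_{S(r)}|h|^2\,d\sigma_r\right)^{1/2}$. Let $X$ be a Fréchet space whose topology is given by an increasing sequence of seminorms $(\|\cdot\|_k)_{k\in\mathbb{N}}$ and $T\colon X\to X$ a continuous linear operator. A vector $x\in X$ is irregular for $T$ if there exist $m\in\mathbb{N}$ and increasing sequences $(j_k)$, $(n_k)$ of positive integers such that $\lim_{k\to\infty}T^{j_k}x=0$ and $\lim_{k\to\infty}\|T^{n_k}x\|_m=\infty$. *)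

theory Defs
  imports "HOL-Probability.Probability"
begin

subsection \<open>Harmonic functions\<close>

text \<open>Euclidean space of dimension N is \<open>real ^ 'n\<close> with \<open>CARD('n) = N\<close>. The class \<open>linorder\<close> only
  serves to list the coordinates as first, second, and so on, which fixes the order of
  differentiation in \<open>multi_deriv\<close>.\<close>

definition partial_deriv :: "'n::finite \<Rightarrow> (real ^ 'n \<Rightarrow> real) \<Rightarrow> real ^ 'n \<Rightarrow> real"
  where "partial_deriv i f x = deriv (\<lambda>t. f (x + t *\<^sub>R axis i 1)) 0"

definition has_partial_deriv :: "'n::finite \<Rightarrow> (real ^ 'n \<Rightarrow> real) \<Rightarrow> bool"
  where "has_partial_deriv i f \<longleftrightarrow>
    (\<forall>x. (\<lambda>t. f (x + t *\<^sub>R axis i 1)) field_differentiable (at 0))"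

fun cont_diff :: "nat \<Rightarrow> (real ^ 'n::finite \<Rightarrow> real) \<Rightarrow> bool"
  where
    "cont_diff 0 f \<longleftrightarrow> continuous_on UNIV f"
  | "cont_diff (Suc m) f \<longleftrightarrow>
      continuous_on UNIV f \<and> (\<forall>i. has_partial_deriv i f \<and> cont_diff m (partial_deriv i f))"

definition harmonic_space :: "(real ^ 'n::finite \<Rightarrow> real) set"
  where "harmonic_space =
    {h. cont_diff 2 h \<and> (\<forall>x. (\<Sum>i\<in>UNIV. partial_deriv i (partial_deriv i h) x) = 0)}"

definition sup_seminorm :: "nat \<Rightarrow> (real ^ 'n::finite \<Rightarrow> real) \<Rightarrow> real"
  where "sup_seminorm n h = (SUP x\<in>sphere 0 (real n). \<bar>h x\<bar>)"

definition multi_deriv ::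
    "nat ^ ('n::{finite,linorder}) \<Rightarrow> (real ^ ('n::{finite,linorder}) \<Rightarrow> real) \<Rightarrow>
      real ^ ('n::{finite,linorder}) \<Rightarrow> real"
  where "multi_deriv \<alpha> f =
    foldr (\<lambda>i. partial_deriv i ^^ (\<alpha> $ i)) (sorted_list_of_set (UNIV :: 'n set)) f"


subsection \<open>The quadratic mean over spheres\<close>

text \<open>Normalised surface measure on the sphere of radius \<open>r\<close>, in the standard construction from
  Lebesgue measure by polar coordinates: the measure of a part of the sphere is the proportion of
  the unit ball that is occupied by the cone over it. It is extended to all Borel sets by 0 off
  the sphere.\<close>

definition sphere_measure :: "real \<Rightarrow> (real ^ 'n::finite) measure"
  where "sphere_measure r =
    distr (uniform_measure lborel (ball 0 1)) borel (\<lambda>x. (r / norm x) *\<^sub>R x)"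

definition M2 :: "(real ^ 'n::finite \<Rightarrow> real) \<Rightarrow> real \<Rightarrow> real"
  where "M2 h r = sqrt (LINT x:sphere 0 r|sphere_measure r. \<bar>h x\<bar>\<^sup>2)"

lemma sets_sphere_measure [simp, measurable_cong]: "sets (sphere_measure r) = sets borel"
  by (simp add: sphere_measure_def)

lemma space_sphere_measure [simp]: "space (sphere_measure r) = UNIV"
  by (simp add: sphere_measure_def)

lemma emeasure_unit_ball:
  "emeasure lborel (ball (0 :: real ^ 'n::finite) 1) \<noteq> 0"
  "emeasure lborel (ball (0 :: real ^ 'n::finite) 1) \<noteq> \<infinity>"
  using emeasure_lborel_ball_finite[of "0 :: real ^ 'n" 1]
    unit_ball_vol_pos[of "real CARD('n)"]
  by (auto simp: emeasure_ball simp del: unit_ball_vol_pos)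

lemma emeasure_sphere_measure:
  fixes A :: "(real ^ 'n::finite) set"
  assumes "A \<in> sets borel"
  shows "emeasure (sphere_measure r) A =
    emeasure lborel {x \<in> ball 0 1. (r / norm x) *\<^sub>R x \<in> A} / emeasure lborel (ball (0 :: real ^ 'n) 1)"
proof -
  have m: "(\<lambda>x :: real ^ 'n. (r / norm x) *\<^sub>R x) \<in> borel_measurable borel"
    by measurable
  then have "(\<lambda>x :: real ^ 'n. (r / norm x) *\<^sub>R x) -` A \<in> sets borel"
    using measurable_sets[OF m assms] by simp
  moreover have "ball 0 1 \<inter> (\<lambda>x. (r / norm x) *\<^sub>R x) -` A = {x \<in> ball 0 1. (r / norm x) *\<^sub>R x \<in> A}"
    by auto
  ultimately show ?thesis
    using m assms by (simp add: sphere_measure_def emeasure_distr)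
qed

lemma prob_space_sphere_measure: "prob_space (sphere_measure r :: (real ^ 'n::finite) measure)"
  unfolding sphere_measure_def
  by (intro prob_space.prob_space_distr prob_space_uniform_measure emeasure_unit_ball) simp

lemma emeasure_sphere_measure_sphere:
  assumes "r > 0"
  shows "emeasure (sphere_measure r) (sphere (0 :: real ^ 'n::finite) r) = 1"
proof -
  have eq: "{x \<in> ball (0 :: real ^ 'n) 1. (r / norm x) *\<^sub>R x \<in> sphere 0 r} = ball 0 1 - {0}"
    using assms by (auto simp: divide_simps split: if_splits)
  have "emeasure lborel (ball (0 :: real ^ 'n) 1 - {0}) = emeasure lborel (ball (0 :: real ^ 'n) 1)"
    by (subst emeasure_Diff) auto
  moreover have "emeasure lborel (ball (0 :: real ^ 'n) 1) / emeasure lborel (ball (0 :: real ^ 'n) 1) = 1"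
    using emeasure_unit_ball[where 'n = 'n]
    by (intro ennreal_divide_self) (auto simp: top.not_eq_extremum)
  ultimately show ?thesis
    by (subst emeasure_sphere_measure) (simp_all only: eq borel_closed closed_sphere)
qed


subsection \<open>Irregular vectors\<close>

text \<open>\<open>X\<close> is a space whose topology is given by the seminorms \<open>p 1, p 2, \<dots>\<close>, so convergence to 0 is
  convergence to 0 in each of these seminorms.\<close>

definition irregular_vector ::
    "'v set \<Rightarrow> (nat \<Rightarrow> 'v \<Rightarrow> real) \<Rightarrow> ('v \<Rightarrow> 'v) \<Rightarrow> 'v \<Rightarrow> bool"
  where "irregular_vector X p T x \<longleftrightarrow> x \<in> X \<and>
    (\<exists>m\<ge>1. \<exists>j n :: nat \<Rightarrow> nat.
      strict_mono j \<and> strict_mono n \<and> (\<forall>k. j k > 0) \<and> (\<forall>k. n k > 0) \<and>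
      (\<forall>i\<ge>1. (\<lambda>k. p i ((T ^^ j k) x)) \<longlonglongrightarrow> 0) \<and>
      filterlim (\<lambda>k. p m ((T ^^ n k) x)) at_top sequentially)"

end

theory Submission
  imports Defs "HOL-Real_Asymp.Real_Asymp"
begin

text \<open>
  On the unit ball \<open>B\<close> with its normalised volume, the adjoint of \<open>\<partial>/\<partial>x\<^sub>k\<close> on harmonic functions is,
  against homogeneous harmonic \<open>G\<close> of degree \<open>d\<close>, multiplication by \<open>x\<^sub>k\<close> followed by the harmonic
  projection, up to the factor \<open>2 d + 2 + N\<close>. The commutation rule of this raising operator with
  \<open>\<partial>/\<partial>x\<^sub>k\<close> gives its exact norm, so that every partial derivative of order \<open>J\<close> of a harmonic \<open>h\<close>
  satisfies \<open>R\<^sup>2\<^sup>J \<bar>D h a\<bar>\<^sup>2 \<le> q\<^sub>J\<close> times the mean of \<open>h\<^sup>2\<close> over the ball of radius \<open>R\<close> about \<open>a\<close>,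
  where \<open>q\<^sub>J\<close> has the exact order \<open>J powr (2 J + N) * exp (- 2 J)\<close>.

  For (ii), the growth condition says that \<open>h\<^sup>2\<close> has integral \<open>O(exp (2 R))\<close> over the ball of radius \<open>R\<close>,
  a bound that is stable under moving the centre. Taking \<open>R = J\<close> bounds all partial derivatives
  of all orders on every compact set, so no orbit is unbounded.

  For (i), the estimate is sharp for the zonal harmonics \<open>E\<^sub>j\<close> with \<open>\<partial>E\<^sub>j\<^sub>+\<^sub>1/\<partial>x\<^sub>k = E\<^sub>j\<close> and \<open>E\<^sub>0 = 1\<close>:
  \<open>M2 E\<^sub>j r\<close> is at most a constant times \<open>exp r / r powr ((N - 1) / 2)\<close>, uniformly in \<open>j \<ge> 1\<close>.
  A series of the terms \<open>l E\<^sub>j\<close>, \<open>j = n\<^sub>l\<close>, with \<open>n\<^sub>l\<close> growing fast enough is irregular and grows as slowly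
  as required.
\<close>

subsection \<open>Partial derivatives\<close>

text \<open>Both parts meet at one critical rate, so the estimate of a derivative of order
  \<open>J\<close> may lose a constant factor but no power of \<open>J\<close>. All \<open>J\<close>
  derivatives are therefore moved onto the constant 1 by exact adjoints on a single ball, where they
  become harmonic functions of degree \<open>J\<close> with sharply controlled norms. Means over the
  solid ball suit this: a ball about \<open>a\<close> lies in a larger ball about 0, and integration
  by parts is applied to functions with a factor \<open>bump x = 1 - |x|^2\<close>, which vanish on
  the sphere, so that no surface integral arises. The weight is removed again by
  \<open>unit_avg_bump\<close>, which compares weighted and plain means of a product with a
  homogeneous harmonic factor. In (i) the coefficients grow, but at radius \<open>r\<close> only the
  terms whose threshold radius lies below \<open>r\<close> count with their full bound, and the
  thresholds are placed so that \<phi> r dominates the sum of these; all other terms are still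
  negligible at that radius.\<close>

definition has_pd :: "'n::finite \<Rightarrow> (real ^ 'n \<Rightarrow> real) \<Rightarrow> (real ^ 'n \<Rightarrow> real) \<Rightarrow> bool"
  where "has_pd i f f' \<longleftrightarrow> (\<forall>x. ((\<lambda>t. f (x + t *\<^sub>R axis i 1)) has_field_derivative f' x) (at 0))"

lemma has_pd_imp: assumes "has_pd i f f'" shows "partial_deriv i f = f'" "has_partial_deriv i f"
  using assms unfolding has_pd_def partial_deriv_def has_partial_deriv_def
  by (auto intro!: ext DERIV_imp_deriv simp: field_differentiable_def)

lemma has_pd_iff: "has_pd i f f' \<longleftrightarrow> has_partial_deriv i f \<and> partial_deriv i f = f'"
  using has_pd_imp[of i f f']
  by (auto simp: has_pd_def has_partial_deriv_def partial_deriv_def DERIV_deriv_iff_field_differentiable)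

lemma has_pd_line:
  assumes "has_pd i f f'"
  shows "((\<lambda>t. f (x + t *\<^sub>R axis i 1)) has_field_derivative f' (x + s *\<^sub>R axis i 1)) (at s)"
proof -
  have "((\<lambda>t. f ((x + s *\<^sub>R axis i 1) + t *\<^sub>R axis i 1)) has_field_derivative f' (x + s *\<^sub>R axis i 1)) (at 0)"
    using assms unfolding has_pd_def by blast
  moreover have "(\<lambda>t. f ((x + s *\<^sub>R axis i 1) + t *\<^sub>R axis i 1)) = (\<lambda>t. f (x + (s + t) *\<^sub>R axis i 1))"
    by (simp add: algebra_simps)
  ultimately show ?thesis
    using DERIV_at_within_shift[of "\<lambda>t. f (x + t *\<^sub>R axis i 1)" "f' (x + s *\<^sub>R axis i 1)" s 0 UNIV]
    by (simp)
qed

named_theorems has_pd_intros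

lemma has_pd_const [has_pd_intros]: "has_pd i (\<lambda>x. c) (\<lambda>x. 0)"
  by (simp add: has_pd_def)

lemma has_pd_nth [has_pd_intros]: "has_pd i (\<lambda>x. x $ j) (\<lambda>x. if j = i then 1 else 0)"
  unfolding has_pd_def by (auto simp: axis_def intro!: derivative_eq_intros)

lemma has_pd_add [has_pd_intros]:
  "has_pd i f f' \<Longrightarrow> has_pd i g g' \<Longrightarrow> has_pd i (\<lambda>x. f x + g x) (\<lambda>x. f' x + g' x)"
  unfolding has_pd_def by (auto intro!: derivative_intros)

lemma has_pd_diff [has_pd_intros]:
  "has_pd i f f' \<Longrightarrow> has_pd i g g' \<Longrightarrow> has_pd i (\<lambda>x. f x - g x) (\<lambda>x. f' x - g' x)"
  unfolding has_pd_def by (auto intro!: derivative_intros)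

lemma has_pd_sum [has_pd_intros]:
  "(\<And>j. j \<in> S \<Longrightarrow> has_pd i (f j) (f' j)) \<Longrightarrow> has_pd i (\<lambda>x. \<Sum>j\<in>S. f j x) (\<lambda>x. \<Sum>j\<in>S. f' j x)"
  unfolding has_pd_def by (auto intro!: DERIV_sum)

lemma has_pd_mult [has_pd_intros]:
  assumes "has_pd i f f'" "has_pd i g g'"
  shows "has_pd i (\<lambda>x. f x * g x) (\<lambda>x. f' x * g x + f x * g' x)"
proof -
  have "((\<lambda>t. f (x + t *\<^sub>R axis i 1) * g (x + t *\<^sub>R axis i 1)) has_field_derivative f' x * g x + g' x * f x) (at 0)" for x
    using DERIV_mult[OF assms(1)[unfolded has_pd_def, rule_format, of x] assms(2)[unfolded has_pd_def, rule_format, of x]]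
    by simp
  then show ?thesis unfolding has_pd_def by (simp add: mult.commute)
qed

lemma has_pd_cong: "has_pd i f f' \<Longrightarrow> (\<And>x. f' x = g' x) \<Longrightarrow> has_pd i f g'"
  by (metis ext)

lemma has_pd_norm_sq [has_pd_intros]: "has_pd i (\<lambda>x. (norm x)\<^sup>2) (\<lambda>x. 2 * x $ i)"
proof -
  have e: "(norm x)\<^sup>2 = (\<Sum>j\<in>UNIV. x $ j * x $ j)" for x :: "real ^ 'n"
    by (simp add: power2_norm_eq_inner inner_vec_def)
  show ?thesis unfolding e
    by (rule has_pd_cong, (rule has_pd_intros)+)
       (simp add: sum.distrib if_distrib sum.delta cong: if_cong)
qed

lemma has_pd_affine [has_pd_intros]:
  fixes a :: "real ^ 'n::finite"
  assumes "has_pd i f f'"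
  shows "has_pd i (\<lambda>x. f (a + c *\<^sub>R x)) (\<lambda>x. c * f' (a + c *\<^sub>R x))"
  unfolding has_pd_def
proof
  fix x :: "real ^ 'n"
  have "((\<lambda>t. f ((a + c *\<^sub>R x) + t *\<^sub>R axis i 1)) has_field_derivative f' (a + c *\<^sub>R x)) (at (c * 0))"
    using assms by (simp add: has_pd_def)
  from DERIV_chain2[OF this DERIV_cmult_Id[of c 0]]
  show "((\<lambda>t. f (a + c *\<^sub>R (x + t *\<^sub>R axis i 1))) has_field_derivative c * f' (a + c *\<^sub>R x)) (at 0)"
    by (simp add: algebra_simps)
qed

lemma cont_diff_continuous: "cont_diff m f \<Longrightarrow> continuous_on UNIV f"
  by (cases m) auto

lemma cont_diff_Suc_has_pd:
  "cont_diff (Suc m) f \<Longrightarrow> has_pd i f (partial_deriv i f)"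
  "cont_diff (Suc m) f \<Longrightarrow> cont_diff m (partial_deriv i f)"
  by (auto simp: has_pd_iff)

lemma cont_diff_SucI:
  assumes "continuous_on UNIV f" "\<And>i. has_pd i f (f' i)" "\<And>i. cont_diff m (f' i)"
  shows "cont_diff (Suc m) f"
  using assms by (auto simp: has_pd_iff)

lemma cont_diff_lower: "cont_diff (Suc m) f \<Longrightarrow> cont_diff m f"
proof (induction m arbitrary: f)
  case (Suc m) then show ?case by (metis cont_diff.simps(2))
qed simp

lemma cont_diff_const [intro]: "cont_diff m (\<lambda>x. c)"
proof (induction m arbitrary: c)
  case (Suc m)
  show ?case by (rule cont_diff_SucI[OF _ has_pd_const]) (use Suc in auto)
qed auto

lemma cont_diff_nth [intro]: "cont_diff m (\<lambda>x. x $ j)"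
proof (cases m)
  case (Suc m)
  show ?thesis unfolding Suc
    by (rule cont_diff_SucI[OF _ has_pd_nth]) (auto intro!: continuous_intros)
qed (auto intro!: continuous_intros)

lemma cont_diff_add [intro]: "cont_diff m f \<Longrightarrow> cont_diff m g \<Longrightarrow> cont_diff m (\<lambda>x. f x + g x)"
proof (induction m arbitrary: f g)
  case (Suc m)
  show ?case
    by (rule cont_diff_SucI[OF _ has_pd_add[OF cont_diff_Suc_has_pd(1)[OF Suc.prems(1)] cont_diff_Suc_has_pd(1)[OF Suc.prems(2)]]])
       (use Suc in \<open>auto intro!: continuous_intros\<close>)
qed (auto intro!: continuous_intros)

lemma cont_diff_mult [intro]: "cont_diff m f \<Longrightarrow> cont_diff m g \<Longrightarrow> cont_diff m (\<lambda>x. f x * g x)"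
proof (induction m arbitrary: f g)
  case (Suc m)
  show ?case
    by (rule cont_diff_SucI[OF _ has_pd_mult[OF cont_diff_Suc_has_pd(1)[OF Suc.prems(1)] cont_diff_Suc_has_pd(1)[OF Suc.prems(2)]]])
       (use Suc.prems in \<open>auto intro!: continuous_intros cont_diff_add Suc.IH dest: cont_diff_continuous
          intro: cont_diff_lower[OF Suc.prems(1)] cont_diff_lower[OF Suc.prems(2)] simp del: cont_diff.simps
          simp: cont_diff_Suc_has_pd(2)[OF Suc.prems(1)] cont_diff_Suc_has_pd(2)[OF Suc.prems(2)]\<close>)
qed (auto intro!: continuous_intros)

lemma cont_diff_cmult: "cont_diff m f \<Longrightarrow> cont_diff m (\<lambda>x. c * f x)"
  by (intro cont_diff_mult cont_diff_const)

lemma cont_diff_diff [intro]: "cont_diff m f \<Longrightarrow> cont_diff m g \<Longrightarrow> cont_diff m (\<lambda>x. f x - g x)"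
  using cont_diff_add[of m f "\<lambda>x. (-1) * g x"] cont_diff_cmult[of m g "-1"] by simp

lemma cont_diff_sum [intro]: "(\<And>j. j \<in> S \<Longrightarrow> cont_diff m (f j)) \<Longrightarrow> cont_diff m (\<lambda>x. \<Sum>j\<in>S. f j x)"
  by (induction S rule: infinite_finite_induct) auto

lemma cont_diff_norm_sq [intro]: "cont_diff m (\<lambda>x. (norm x)\<^sup>2)"
proof -
  have e: "(norm x)\<^sup>2 = (\<Sum>j\<in>UNIV. x $ j * x $ j)" for x :: "real ^ 'n"
    by (simp add: power2_norm_eq_inner inner_vec_def)
  show ?thesis unfolding e by (intro cont_diff_sum cont_diff_mult cont_diff_nth)
qed

lemma cont_diff_affine:
  fixes a :: "real ^ 'n::finite"
  assumes "cont_diff m f"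
  shows "cont_diff m (\<lambda>x. f (a + c *\<^sub>R x))"
proof -
  have c: "continuous_on UNIV (\<lambda>x. f (a + c *\<^sub>R x))" if "continuous_on UNIV f" for f :: "real ^ 'n \<Rightarrow> real"
    by (rule continuous_on_compose2[OF that]) (auto intro!: continuous_intros)
  show ?thesis using assms
proof (induction m arbitrary: f)
  case (Suc m)
  show ?case
    by (rule cont_diff_SucI[OF _ has_pd_affine[OF cont_diff_Suc_has_pd(1)[OF Suc.prems]]])
       (use Suc.prems in \<open>auto intro!: c cont_diff_cmult Suc.IH\<close>)
qed (simp add: c)
qed

text \<open>The increment is made one coordinate at a time: \<open>P S h\<close> moves only the
  coordinates in \<open>S\<close>, and each added coordinate costs a one-variable mean value
  estimate, controlled by continuity of that partial derivative at \<open>x\<close>.\<close>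

lemma C1_has_derivative:
  fixes f :: "real ^ 'n::finite \<Rightarrow> real"
  assumes pd: "\<And>i. has_pd i f (f' i)" and c: "\<And>i. continuous_on UNIV (f' i)"
  shows "(f has_derivative (\<lambda>h. \<Sum>i\<in>UNIV. h $ i * f' i x)) (at x)"
proof -
  define P where "P S h = (\<Sum>i\<in>S. (h $ i) *\<^sub>R axis i (1::real))" for S and h :: "real ^ 'n"
  have P_norm: "norm (P S h) \<le> real (card S) * norm h" for S h
  proof -
    have "norm (P S h) \<le> (\<Sum>i\<in>S. norm ((h $ i) *\<^sub>R axis i (1::real)))" unfolding P_def by (rule norm_sum)
    also have "\<dots> \<le> (\<Sum>i\<in>S. norm h)"
      by (intro sum_mono) (simp add: component_le_norm_cart)
    finally show ?thesis by simp
  qed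
  have key: "\<exists>d>0. \<forall>h. norm h < d \<longrightarrow> \<bar>f (x + P S h) - f x - (\<Sum>i\<in>S. h $ i * f' i x)\<bar> \<le> e * norm h"
    if "finite S" "e > 0" for S and e :: real using that
  proof (induction S arbitrary: e rule: finite_induct)
    case empty then show ?case by (auto simp: P_def intro!: exI[of _ 1])
  next
    case (insert j S)
    obtain d1 where d1: "d1 > 0" "\<And>h. norm h < d1 \<Longrightarrow> \<bar>f (x + P S h) - f x - (\<Sum>i\<in>S. h $ i * f' i x)\<bar> \<le> e/2 * norm h"
      using insert.IH[of "e/2"] insert.prems by auto
    have "isCont (f' j) x" using c[of j] by (simp add: continuous_on_eq_continuous_at)
    then obtain d2 where d2: "d2 > 0" "\<And>y. dist y x < d2 \<Longrightarrow> dist (f' j y) (f' j x) < e/2"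
      using insert.prems unfolding continuous_at_eps_delta by (metis half_gt_zero)
    \<comment> \<open>On the path in direction \<open>j\<close> the distance from \<open>x\<close>
      is at most \<open>(card S + 1) * norm h\<close>, by \<open>P_norm\<close>.\<close>
    define d where "d = min d1 (d2 / (real (card S) + 1))"
    have "d > 0" using d1 d2 by (simp add: d_def)
    moreover have "\<bar>f (x + P (insert j S) h) - f x - (\<Sum>i\<in>insert j S. h $ i * f' i x)\<bar> \<le> e * norm h" if h: "norm h < d" for h
    proof -
      define g where "g t = f ((x + P S h) + t *\<^sub>R axis j 1)" for t
      have gd: "(g has_field_derivative f' j ((x + P S h) + t *\<^sub>R axis j 1)) (at t)" for t
        unfolding g_def by (rule has_pd_line[OF pd])
      have hj: "\<bar>h $ j\<bar> \<le> norm h" by (rule component_le_norm_cart)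
      have "\<bar>g (h $ j) - g 0 - h $ j * f' j x\<bar> \<le> e/2 * \<bar>h $ j\<bar>"
      proof -
        \<comment> \<open>Subtracting the linear function \<open>f' j x * t\<close> leaves a
          function whose derivative is at most \<open>e/2\<close> in size.\<close>
        have "norm ((g (h $ j) - f' j x * (h $ j)) - (g 0 - f' j x * 0)) \<le> e/2 * norm (h $ j - 0)"
        proof (rule field_differentiable_bound[of "closed_segment 0 (h $ j)" _ "\<lambda>t. f' j ((x + P S h) + t *\<^sub>R axis j 1) - f' j x"])
          fix t assume t: "t \<in> closed_segment 0 (h $ j)"
          show "((\<lambda>t. g t - f' j x * t) has_field_derivative f' j ((x + P S h) + t *\<^sub>R axis j 1) - f' j x) (at t within closed_segment 0 (h $ j))"
            by (rule DERIV_subset[of _ _ _ UNIV]) (auto intro!: derivative_eq_intros gd)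
          have "\<bar>t\<bar> \<le> norm h" using t hj by (auto simp: closed_segment_eq_real_ivl split: if_splits)
          then have "norm (P S h + t *\<^sub>R axis j 1) \<le> (real (card S) + 1) * norm h"
            using norm_triangle_ineq[of "P S h" "t *\<^sub>R axis j 1"] P_norm[of S h]
            by (simp add: algebra_simps)
          also have "\<dots> < d2" using h by (simp add: d_def field_simps)
          finally have "dist ((x + P S h) + t *\<^sub>R axis j 1) x < d2" by (simp add: dist_norm add.assoc)
          from d2(2)[OF this] show "norm (f' j ((x + P S h) + t *\<^sub>R axis j 1) - f' j x) \<le> e / 2"
            by (simp add: dist_norm)
        qed auto
        then show ?thesis by (simp add: mult.commute algebra_simps)
      qed
      also have "\<dots> \<le> e/2 * norm h" using hj insert.prems by simp
      finally have 1: "\<bar>g (h $ j) - g 0 - h $ j * f' j x\<bar> \<le> e/2 * norm h" .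
      have "g (h $ j) = f (x + P (insert j S) h)" "g 0 = f (x + P S h)"
        using insert.hyps by (auto simp: g_def P_def add_ac)
      with 1 d1(2)[of h] h show ?thesis using insert.hyps
        by (simp add: d_def sum.insert algebra_simps) (smt (verit) field_sum_of_halves distrib_left mult.commute)
    qed
    ultimately show ?case by blast
  qed
  have PU: "P UNIV h = h" for h
    by (simp add: P_def vec_eq_iff axis_def if_distrib cong: if_cong)
  have lin: "bounded_linear (\<lambda>h. \<Sum>i\<in>UNIV. h $ i * f' i x)"
    by (intro bounded_linear_sum bounded_linear_mult_const bounded_linear_vec_nth)
  show ?thesis
    unfolding has_derivative_at_alt
  proof (intro conjI lin allI impI)
    fix e :: real assume "e > 0"
    from key[OF finite_class.finite_UNIV this] obtain d where "d > 0"
      and d: "\<forall>h. norm h < d \<longrightarrow> \<bar>f (x + h) - f x - (\<Sum>i\<in>UNIV. h $ i * f' i x)\<bar> \<le> e * norm h"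
      unfolding PU by blast
    show "\<exists>d>0. \<forall>y. norm (y - x) < d \<longrightarrow>
        norm (f y - f x - (\<Sum>i\<in>UNIV. (y - x) $ i * f' i x)) \<le> e * norm (y - x)"
    proof (intro exI[of _ d] conjI \<open>d > 0\<close> allI impI)
      fix y assume "norm (y - x) < d"
      then show "norm (f y - f x - (\<Sum>i\<in>UNIV. (y - x) $ i * f' i x)) \<le> e * norm (y - x)"
        using d[rule_format, of "y - x"] by simp
    qed
  qed
qed

subsection \<open>Means over the unit ball\<close>

text \<open>\<open>sphere_measure\<close> is a push-forward of this same probability measure, so
  means over balls and \<open>M2\<close> share one normalisation.\<close>

definition unit_avg :: "(real ^ 'n::finite \<Rightarrow> real) \<Rightarrow> real"
  where "unit_avg f = (LINT x|uniform_measure lborel (ball 0 1). f x)"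

lemma prob_space_unit: "prob_space (uniform_measure lborel (ball (0::real^'n::finite) 1))"
  by (intro prob_space_uniform_measure emeasure_unit_ball)

lemma AE_unit: "AE x in uniform_measure lborel (ball (0::real^'n::finite) 1). x \<in> ball 0 1"
  by (rule AE_uniform_measureI) auto

lemma unit_avg_altdef:
  fixes f :: "real ^ 'n::finite \<Rightarrow> real"
  assumes [measurable]: "f \<in> borel_measurable borel"
  shows "unit_avg f = (LINT x|lborel. indicat_real (ball 0 1) x * f x) / measure lborel (ball (0::real^'n) 1)"
proof -
  let ?B = "ball (0::real^'n) 1"
  define b where "b = measure lborel ?B"
  have b: "emeasure lborel ?B = ennreal b" "b > 0"
    using emeasure_unit_ball[where 'n = 'n]
    by (auto simp: b_def measure_def enn2real_positive_iff top.not_eq_extremum zero_less_iff_neq_zero)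
  have e: "indicator ?B x / emeasure lborel ?B = ennreal (indicator ?B x / b)" for x
    using b divide_ennreal[of 1 b] by (auto simp: indicator_def)
  show ?thesis
    unfolding unit_avg_def uniform_measure_def e
    using b by (subst integral_density) (auto simp: b_def intro!: borel_measurable_divide borel_measurable_indicator borel_open)
qed

lemma bounded_unit_ball:
  fixes f :: "real ^ 'n::finite \<Rightarrow> real"
  assumes "continuous_on UNIV f"
  obtains B where "\<And>x. norm x \<le> 1 \<Longrightarrow> \<bar>f x\<bar> \<le> B"
proof -
  have "compact (f ` cball 0 1)"
    by (intro compact_continuous_image continuous_on_subset[OF assms]) auto
  then obtain B where "\<forall>y\<in>f ` cball 0 1. norm y \<le> B"
    using compact_imp_bounded bounded_iff by blast
  then show ?thesis by (intro that[of B]) auto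
qed

lemma integrable_unit:
  fixes f :: "real ^ 'n::finite \<Rightarrow> real"
  assumes "continuous_on UNIV f"
  shows "integrable (uniform_measure lborel (ball 0 1)) f"
proof -
  interpret prob_space "uniform_measure lborel (ball (0::real^'n) 1)" by (rule prob_space_unit)
  obtain B where B: "\<And>x. norm x \<le> 1 \<Longrightarrow> \<bar>f x\<bar> \<le> B" using bounded_unit_ball[OF assms] by blast
  show ?thesis
  proof (rule integrable_const_bound[where B = B])
    show "AE x in uniform_measure lborel (ball 0 1). norm (f x) \<le> B"
      using AE_unit by eventually_elim (auto intro!: B)
    show "f \<in> borel_measurable (uniform_measure lborel (ball 0 1))"
      using borel_measurable_continuous_onI[OF assms] by (simp cong: measurable_cong_sets)
  qed
qed

lemma unit_avg_add: "continuous_on UNIV f \<Longrightarrow> continuous_on UNIV g \<Longrightarrow>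
    unit_avg (\<lambda>x. f x + g x) = unit_avg f + unit_avg g"
  unfolding unit_avg_def by (intro Bochner_Integration.integral_add integrable_unit)

lemma unit_avg_diff: "continuous_on UNIV f \<Longrightarrow> continuous_on UNIV g \<Longrightarrow>
    unit_avg (\<lambda>x. f x - g x) = unit_avg f - unit_avg g"
  unfolding unit_avg_def by (intro Bochner_Integration.integral_diff integrable_unit)

lemma unit_avg_sum: "(\<And>i. i \<in> I \<Longrightarrow> continuous_on UNIV (f i)) \<Longrightarrow>
    unit_avg (\<lambda>x. \<Sum>i\<in>I. f i x) = (\<Sum>i\<in>I. unit_avg (f i))"
  unfolding unit_avg_def by (intro Bochner_Integration.integral_sum integrable_unit)

lemma unit_avg_cmult: "unit_avg (\<lambda>x. c * f x) = c * unit_avg f"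
  unfolding unit_avg_def by simp

lemma unit_avg_const [simp]: "unit_avg (\<lambda>x::real^'n::finite. c) = c"
proof -
  interpret prob_space "uniform_measure lborel (ball (0::real^'n) 1)" by (rule prob_space_unit)
  show ?thesis unfolding unit_avg_def by (subst lebesgue_integral_const) (use prob_space in simp)
qed

lemma unit_avg_mono:
  assumes "continuous_on UNIV f" "continuous_on UNIV g" "\<And>x. norm x \<le> 1 \<Longrightarrow> f x \<le> g x"
  shows "unit_avg f \<le> unit_avg g"
  unfolding unit_avg_def
  by (intro integral_mono_AE integrable_unit assms, use AE_unit in eventually_elim) (auto intro: assms)

lemma unit_avg_abs_le:
  fixes f :: "real ^ 'n::finite \<Rightarrow> real"
  assumes "continuous_on UNIV f" "\<And>x. norm x \<le> 1 \<Longrightarrow> \<bar>f x\<bar> \<le> B"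
  shows "\<bar>unit_avg f\<bar> \<le> B"
proof -
  have "unit_avg f \<le> unit_avg (\<lambda>x::real^'n. B)"
    by (intro unit_avg_mono assms continuous_on_const) (use assms(2) in \<open>auto simp: abs_le_iff\<close>)
  moreover have "unit_avg (\<lambda>x::real^'n. - B) \<le> unit_avg f"
    by (intro unit_avg_mono assms continuous_on_const) (use assms(2) in \<open>fastforce simp: abs_le_iff\<close>)
  ultimately show ?thesis by (auto simp: abs_le_iff)
qed

lemma unit_avg_nonneg: "(\<And>x. f x \<ge> 0) \<Longrightarrow> unit_avg f \<ge> 0"
  unfolding unit_avg_def by (intro integral_nonneg_AE) auto

text \<open>The quadratic form in \<open>s\<close> and \<open>t\<close> is the mean of a square,
  hence nonnegative. Two parameters avoid dividing by \<open>?c\<close>, so that only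
  \<open>?c = 0\<close> is exceptional.\<close>

lemma unit_avg_Cauchy_Schwarz:
  assumes f: "continuous_on UNIV f" and g: "continuous_on UNIV g"
  shows "(unit_avg (\<lambda>x. f x * g x))\<^sup>2 \<le> unit_avg (\<lambda>x. (f x)\<^sup>2) * unit_avg (\<lambda>x. (g x)\<^sup>2)"
proof -
  let ?a = "unit_avg (\<lambda>x. (f x)\<^sup>2)" and ?b = "unit_avg (\<lambda>x. f x * g x)" and ?c = "unit_avg (\<lambda>x. (g x)\<^sup>2)"
  have q: "0 \<le> s\<^sup>2 * ?a - 2 * s * t * ?b + t\<^sup>2 * ?c" for s t
  proof -
    have "0 \<le> unit_avg (\<lambda>x. (s * f x - t * g x)\<^sup>2)" by (rule unit_avg_nonneg) simp
    also have "(\<lambda>x. (s * f x - t * g x)\<^sup>2) = (\<lambda>x. s\<^sup>2 * (f x)\<^sup>2 - (2 * s * t) * (f x * g x) + t\<^sup>2 * (g x)\<^sup>2)"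
      by (auto simp: power2_eq_square algebra_simps)
    also have "unit_avg \<dots> = s\<^sup>2 * ?a - 2 * s * t * ?b + t\<^sup>2 * ?c"
      using f g by (simp add: unit_avg_add unit_avg_diff unit_avg_cmult continuous_intros)
    finally show ?thesis .
  qed
  have a: "?a \<ge> 0" and c: "?c \<ge> 0" by (auto intro!: unit_avg_nonneg)
  show ?thesis
  proof (cases "?c = 0")
    case True
    have "?b = 0"
    proof (rule ccontr)
      assume "?b \<noteq> 0"
      \<comment> \<open>With \<open>?c = 0\<close> the form is affine in \<open>t\<close>; this
        \<open>t\<close> gives it the value -1.\<close>
      with q[of 1 "(?a + 1) / (2 * ?b)"] True show False by (simp add: field_simps)
    qed
    then show ?thesis using True by simp
  next
    case False
    with c have "?c > 0" by simp
    moreover have "0 \<le> ?c * (?c * ?a - ?b\<^sup>2)"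
      using q[of ?c ?b] by (simp add: power2_eq_square algebra_simps)
    ultimately show ?thesis by (simp add: zero_le_mult_iff mult.commute)
  qed
qed

text \<open>Integrating a difference quotient of the extension of \<open>u\<close> by 0 gives 0 by translation
  invariance; that extension is Lipschitz because \<open>u\<close> vanishes on the sphere.\<close>

lemma unit_avg_partial_eq_0:
  fixes u :: "real ^ 'n::finite \<Rightarrow> real"
  assumes pd: "has_pd i u u'" and cu: "continuous_on UNIV u" and cu': "continuous_on UNIV u'"
    and van: "\<And>x. norm x = 1 \<Longrightarrow> u x = 0"
  shows "unit_avg u' = 0"
proof -
  define e where "e = (axis i 1 :: real ^ 'n)"
  have ne: "norm e = 1" by (simp add: e_def)
  define v where "v x = (if norm x < 1 then u x else 0)" for x
  obtain L where L: "\<And>x. norm x \<le> 1 \<Longrightarrow> \<bar>u' x\<bar> \<le> L" using bounded_unit_ball[OF cu'] by blast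
  have "L \<ge> 0" using L[of 0] by simp
  have inside: "\<bar>u (x + t *\<^sub>R e) - u x\<bar> \<le> L * \<bar>t\<bar>" if "norm x \<le> 1" "norm (x + t *\<^sub>R e) \<le> 1" for x t
  proof -
    have "norm (u (x + t *\<^sub>R e) - u (x + 0 *\<^sub>R e)) \<le> L * norm (t - 0)"
    proof (rule field_differentiable_bound[of "closed_segment 0 t" _ "\<lambda>s. u' (x + s *\<^sub>R e)"])
      fix s assume s: "s \<in> closed_segment 0 t"
      show "((\<lambda>s. u (x + s *\<^sub>R e)) has_field_derivative u' (x + s *\<^sub>R e)) (at s within closed_segment 0 t)"
        unfolding e_def by (rule DERIV_subset[OF has_pd_line[OF pd]]) simp
      obtain w where "0 \<le> w" "w \<le> 1" "s = w * t" using s by (auto simp: in_segment)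
      then have "x + s *\<^sub>R e = (1 - w) *\<^sub>R x + w *\<^sub>R (x + t *\<^sub>R e)" by (simp add: algebra_simps)
      moreover have "(1 - w) *\<^sub>R x + w *\<^sub>R (x + t *\<^sub>R e) \<in> cball 0 1"
        using convexD_alt[OF convex_cball[of 0 1], of x "x + t *\<^sub>R e" w] that \<open>0 \<le> w\<close> \<open>w \<le> 1\<close> by auto
      ultimately show "norm (u' (x + s *\<^sub>R e)) \<le> L" using L by simp
    qed auto
    then show ?thesis by simp
  qed
  \<comment> \<open>A segment that leaves the ball meets the sphere, where \<open>u\<close>
    vanishes, so \<open>u x\<close> is bounded by the length of the part before that point.\<close>
  have half: "\<bar>u x\<bar> \<le> L * \<bar>t\<bar>" if "norm x < 1" "norm (x + t *\<^sub>R e) \<ge> 1" for x t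
  proof -
    have "\<exists>w. 0 \<le> w \<and> w \<le> 1 \<and> norm (x + (w * t) *\<^sub>R e) = 1"
      using that by (intro IVT') (auto intro!: continuous_intros)
    then obtain w where w: "0 \<le> w" "w \<le> 1" "norm (x + (w * t) *\<^sub>R e) = 1" by blast
    have "\<bar>u x\<bar> \<le> L * \<bar>w * t\<bar>" using inside[of x "w * t"] van[OF w(3)] w(3) that by simp
    also have "\<dots> \<le> L * \<bar>t\<bar>" using w \<open>L \<ge> 0\<close> by (intro mult_left_mono) (auto simp: abs_mult mult_left_le_one_le)
    finally show ?thesis .
  qed
  have lip: "\<bar>v (x + t *\<^sub>R e) - v x\<bar> \<le> L * \<bar>t\<bar>" for x t
    using inside[of x t] half[of x t] half[of "x + t *\<^sub>R e" "-t"] \<open>L \<ge> 0\<close>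
    by (auto simp: v_def)
  have vm [measurable]: "v \<in> borel_measurable borel"
    unfolding v_def using borel_measurable_continuous_onI[OF cu] by measurable
  have um [measurable]: "u' \<in> borel_measurable borel"
    using borel_measurable_continuous_onI[OF cu'] .
  obtain M where M: "\<And>x. norm x \<le> 1 \<Longrightarrow> \<bar>u x\<bar> \<le> M" using bounded_unit_ball[OF cu] by blast
  have vi: "integrable lborel v"
  proof (rule Bochner_Integration.integrable_bound)
    show "integrable lborel (\<lambda>x::real^'n. M * indicat_real (ball 0 1) x)"
      by (intro integrable_mult_right integrable_real_indicator) (use emeasure_unit_ball(2)[where 'n = 'n] in \<open>auto simp: top.not_eq_extremum\<close>)
    show "AE x in lborel. norm (v x) \<le> norm (M * indicat_real (ball 0 1) x)"
      using order_trans[OF M abs_ge_self] by (intro AE_I2) (auto simp: v_def indicator_def)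
  qed simp
  have shift: "integrable lborel (\<lambda>x. v (x + a)) \<and> (LINT x|lborel. v (x + a)) = (LINT x|lborel. v x)" for a
  proof -
    have "integrable (distr lborel borel ((+) a)) v" by (simp add: lborel_distr_plus vi)
    then have "integrable lborel (\<lambda>x. v (a + x))" by (subst (asm) integrable_distr_eq) auto
    moreover have "(LINT x|distr lborel borel ((+) a). v x) = (LINT x|lborel. v (a + x))"
      by (rule integral_distr) auto
    ultimately show ?thesis by (simp add: lborel_distr_plus add.commute)
  qed
  define D where "D n x = real (Suc n) * (v (x + (1 / real (Suc n)) *\<^sub>R e) - v x)" for n x
  have D0: "(LINT x|lborel. D n x) = 0" for n
    unfolding D_def using shift[of "(1 / real (Suc n)) *\<^sub>R e"] vi by simp
  have lim: "(\<lambda>n. D n x) \<longlonglongrightarrow> indicat_real (ball 0 1) x * u' x" if "norm x \<noteq> 1" for x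
  proof (cases "norm x < 1")
    case True
    have t0: "(\<lambda>n. 1 / real (Suc n)) \<longlonglongrightarrow> 0" by real_asymp
    have "((\<lambda>t. u (x + t *\<^sub>R e)) has_field_derivative u' x) (at 0)"
      using pd by (simp add: has_pd_def e_def)
    then have "((\<lambda>t. (u (x + t *\<^sub>R e) - u x) / t) \<longlongrightarrow> u' x) (at 0)"
      by (simp add: has_field_derivative_iff)
    moreover have "filterlim (\<lambda>n. 1 / real (Suc n)) (at 0) sequentially"
      using t0 by (simp add: filterlim_at)
    ultimately have l: "(\<lambda>n. (u (x + (1 / real (Suc n)) *\<^sub>R e) - u x) / (1 / real (Suc n))) \<longlonglongrightarrow> u' x"
      by (rule filterlim_compose)
    have "(\<lambda>n. norm (x + (1 / real (Suc n)) *\<^sub>R e)) \<longlonglongrightarrow> norm (x + 0 *\<^sub>R e)"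
      by (intro tendsto_intros t0)
    then have "\<forall>\<^sub>F n in sequentially. norm (x + (1 / real (Suc n)) *\<^sub>R e) < 1"
      using True by (intro order_tendstoD) auto
    then have "\<forall>\<^sub>F n in sequentially. (u (x + (1 / real (Suc n)) *\<^sub>R e) - u x) / (1 / real (Suc n)) = D n x"
      by eventually_elim (use True in \<open>simp add: D_def v_def\<close>)
    from Lim_transform_eventually[OF l this] True show ?thesis by simp
  next
    case False
    with that have "norm x > 1" by simp
    have t0: "(\<lambda>n. 1 / real (Suc n)) \<longlonglongrightarrow> 0" by real_asymp
    have "(\<lambda>n. norm (x + (1 / real (Suc n)) *\<^sub>R e)) \<longlonglongrightarrow> norm (x + 0 *\<^sub>R e)"
      by (intro tendsto_intros t0)
    then have "\<forall>\<^sub>F n in sequentially. norm (x + (1 / real (Suc n)) *\<^sub>R e) > 1"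
      using \<open>norm x > 1\<close> by (intro order_tendstoD) auto
    then have "\<forall>\<^sub>F n in sequentially. 0 = D n x"
      by eventually_elim (use \<open>norm x > 1\<close> in \<open>simp add: D_def v_def\<close>)
    from Lim_transform_eventually[OF tendsto_const this] \<open>norm x > 1\<close> show ?thesis by simp
  qed
  \<comment> \<open>Radius 2 suffices because the translations have length at most 1.\<close>
  have bd: "norm (D n x) \<le> L * indicat_real (cball 0 2) x" for n x
  proof (cases "norm x \<le> 2")
    case True
    have "\<bar>D n x\<bar> = real (Suc n) * \<bar>v (x + (1 / real (Suc n)) *\<^sub>R e) - v x\<bar>" by (simp add: D_def abs_mult)
    also have "\<dots> \<le> real (Suc n) * (L * \<bar>1 / real (Suc n)\<bar>)" by (intro mult_left_mono lip) simp
    also have "\<dots> = L" by simp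
    finally show ?thesis using True by simp
  next
    case False
    have "norm x \<le> norm (x + (1 / real (Suc n)) *\<^sub>R e) + norm ((1 / real (Suc n)) *\<^sub>R e)"
      by (metis add_diff_cancel_right' norm_triangle_ineq4)
    moreover have "norm ((1 / real (Suc n)) *\<^sub>R e) \<le> 1" using ne by simp
    ultimately have "\<not> norm (x + (1 / real (Suc n)) *\<^sub>R e) < 1" using False by linarith
    then have "v (x + (1 / real (Suc n)) *\<^sub>R e) = 0" unfolding v_def by (rule if_not_P)
    then show ?thesis using False by (simp add: D_def v_def)
  qed
  have "(\<lambda>n. LINT x|lborel. D n x) \<longlonglongrightarrow> (LINT x|lborel. indicat_real (ball 0 1) x * u' x)"
  proof (rule integral_dominated_convergence[where w = "\<lambda>x. L * indicat_real (cball 0 2) x"])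
    show "integrable lborel (\<lambda>x::real^'n. L * indicat_real (cball 0 2) x)"
      by (intro integrable_mult_right integrable_real_indicator) (use emeasure_bounded_finite[OF bounded_cball, of "0::real^'n" 2] in auto)
    have sphere_null: "sphere (0::real^'n) 1 \<in> null_sets lborel"
      using negligible_sphere[of "0::real^'n" 1]
      by (simp add: negligible_iff_null_sets null_sets_completion_iff)
    have "AE x in lborel. x \<notin> sphere (0::real^'n) 1"
      by (rule AE_not_in[OF sphere_null])
    then show "AE x in lborel. (\<lambda>n. D n x) \<longlonglongrightarrow> indicat_real (ball 0 1) x * u' x"
      by eventually_elim (auto intro!: lim)
    show "AE x in lborel. norm (D n x) \<le> L * indicat_real (cball 0 2) x" for n
      using bd by simp
  qed (auto simp: D_def[abs_def] intro!: borel_measurable_times borel_measurable_indicator borel_open um)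
  then have "(LINT x|lborel. indicat_real (ball 0 1) x * u' x) = 0"
    using D0 by (simp add: LIMSEQ_const_iff)
  then show ?thesis by (simp add: unit_avg_altdef)
qed

section \<open>Means depending on a parameter\<close>

lemma tendsto_unit_avg_uniform:
  fixes f :: "'b \<Rightarrow> real ^ 'n::finite \<Rightarrow> real"
  assumes "\<And>t. continuous_on UNIV (f t)" "continuous_on UNIV g"
    and "uniform_limit (cball 0 1) f g F"
  shows "((\<lambda>t. unit_avg (f t)) \<longlongrightarrow> unit_avg g) F"
proof (rule tendstoI)
  fix e :: real assume "e > 0"
  from uniform_limitD[OF assms(3), of "e / 2"] \<open>e > 0\<close>
  have "\<forall>\<^sub>F t in F. \<forall>x\<in>cball 0 1. dist (f t x) (g x) < e / 2" by simp
  then show "\<forall>\<^sub>F t in F. dist (unit_avg (f t)) (unit_avg g) < e"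
  proof eventually_elim
    case (elim t)
    have "\<bar>unit_avg (\<lambda>x. f t x - g x)\<bar> \<le> e / 2"
      by (rule unit_avg_abs_le) (use elim in \<open>auto intro!: continuous_intros assms simp: dist_norm less_imp_le\<close>)
    then show ?case using \<open>e > 0\<close> by (simp add: unit_avg_diff assms dist_norm)
  qed
qed

lemma uniform_limit_parameter:
  fixes g :: "'a::euclidean_space \<Rightarrow> real ^ 'n::finite \<Rightarrow> real"
  assumes c: "continuous_on UNIV (\<lambda>(t, y). g t y)"
  shows "uniform_limit (cball 0 1) g (g t0) (at t0)"
proof (rule uniform_limitI)
  fix e :: real assume "e > 0"
  have "uniformly_continuous_on (cball t0 1 \<times> cball 0 1) (\<lambda>(t, y). g t y)"
    by (intro compact_uniformly_continuous compact_Times compact_cball continuous_on_subset[OF c]) auto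
  then obtain d where d: "d > 0" "\<And>p q. p \<in> cball t0 1 \<times> cball 0 1 \<Longrightarrow> q \<in> cball t0 1 \<times> cball 0 1 \<Longrightarrow> dist q p < d \<Longrightarrow>
      dist ((\<lambda>(t, y). g t y) q) ((\<lambda>(t, y). g t y) p) < e"
    using \<open>e > 0\<close> unfolding uniformly_continuous_on_def by metis
  have "\<forall>\<^sub>F t in at t0. dist t t0 < min 1 d"
    using \<open>d > 0\<close> unfolding eventually_at by (intro exI[of _ "min 1 d"]) auto
  then show "\<forall>\<^sub>F t in at t0. \<forall>x\<in>cball 0 1. dist (g t x) (g t0 x) < e"
  proof eventually_elim
    case (elim t)
    then have "t \<in> cball t0 1" by (simp add: dist_commute)
    then show ?case using d(2)[of "(t0, x)" "(t, x)" for x] elim by (auto simp: dist_Pair_Pair)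
  qed
qed

lemma continuous_section:
  assumes "continuous_on UNIV (\<lambda>(t, y). g t y)"
  shows "continuous_on UNIV (g t)"
  using continuous_on_compose2[OF assms, of UNIV "\<lambda>y. (t, y)"]
  by (simp add: continuous_on_Pair)

lemma continuous_on_unit_avg:
  fixes g :: "'a::euclidean_space \<Rightarrow> real ^ 'n::finite \<Rightarrow> real"
  assumes c: "continuous_on UNIV (\<lambda>(t, y). g t y)"
  shows "continuous_on UNIV (\<lambda>t. unit_avg (g t))"
  unfolding continuous_on_eq_continuous_at[OF open_UNIV] isCont_def
  by (intro ballI tendsto_unit_avg_uniform continuous_section[OF c] uniform_limit_parameter[OF c])

text \<open>By the mean value theorem a difference quotient is a value of \<open>g'\<close> at an
  intermediate parameter, and \<open>g'\<close> is uniformly close to \<open>g' t\<close> on the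
  closed ball; so the quotients converge uniformly and the mean may be taken first.\<close>

lemma unit_avg_has_field_derivative:
  fixes g :: "real \<Rightarrow> real ^ 'n::finite \<Rightarrow> real"
  assumes d: "\<And>t y. ((\<lambda>t. g t y) has_field_derivative g' t y) (at t)"
    and cg: "\<And>t. continuous_on UNIV (g t)"
    and c: "continuous_on UNIV (\<lambda>(t, y). g' t y)"
  shows "((\<lambda>t. unit_avg (g t)) has_field_derivative unit_avg (g' t)) (at t)"
proof -
  define Q where "Q s y = (g s y - g t y) / (s - t)" for s y
  \<comment> \<open>For \<open>s = t\<close> the quotient is 0 / 0, which is 0, so continuity in
    \<open>y\<close> holds for every \<open>s\<close>.\<close>
  have cQ: "continuous_on UNIV (Q s)" for s
  proof (cases "s = t")
    case False then show ?thesis unfolding Q_def by (intro continuous_intros cg) auto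
  qed (simp add: Q_def[abs_def])
  have "uniform_limit (cball 0 1) Q (g' t) (at t)"
  proof (rule uniform_limitI)
    fix e :: real assume "e > 0"
    have "uniform_limit (cball 0 1) g' (g' t) (at t)"
      by (rule uniform_limit_parameter[OF c])
    from uniform_limitD[OF this \<open>e > 0\<close>] obtain d where
      d: "d > 0" "\<And>s x. s \<noteq> t \<Longrightarrow> dist s t < d \<Longrightarrow> x \<in> cball 0 1 \<Longrightarrow> dist (g' s x) (g' t x) < e"
      unfolding eventually_at by (metis UNIV_I)
    have "dist (Q s x) (g' t x) < e" if s: "s \<noteq> t" "dist s t < d" and x: "x \<in> cball 0 1" for s x
    proof -
      have "\<exists>z. z \<noteq> t \<and> dist z t < d \<and> g s x - g t x = (s - t) * g' z x"
      proof (cases "s < t")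
        case True
        from MVT2[OF this, of "\<lambda>t. g t x" "\<lambda>t. g' t x"] d obtain z where
          "s < z" "z < t" "g t x - g s x = (t - s) * g' z x" using assms(1) by blast
        then show ?thesis using s by (intro exI[of _ z]) (auto simp: dist_real_def algebra_simps)
      next
        case False
        with s have "t < s" by simp
        from MVT2[OF this, of "\<lambda>t. g t x" "\<lambda>t. g' t x"] obtain z where
          "t < z" "z < s" "g s x - g t x = (s - t) * g' z x" using assms(1) by blast
        then show ?thesis using s by (intro exI[of _ z]) (auto simp: dist_real_def algebra_simps)
      qed
      then obtain z where z: "z \<noteq> t" "dist z t < d" "g s x - g t x = (s - t) * g' z x" by blast
      then have "Q s x = g' z x" using s by (simp add: Q_def)
      then show ?thesis using d(2)[OF z(1,2) x] by simp
    qed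
    then show "\<forall>\<^sub>F s in at t. \<forall>x\<in>cball 0 1. dist (Q s x) (g' t x) < e"
      using d(1) unfolding eventually_at by blast
  qed
  then have l: "((\<lambda>s. unit_avg (Q s)) \<longlongrightarrow> unit_avg (g' t)) (at t)"
    by (intro tendsto_unit_avg_uniform cQ continuous_section[OF c])
  have "unit_avg (Q s) = (unit_avg (g s) - unit_avg (g t)) / (s - t)" for s
    unfolding Q_def using unit_avg_cmult[of "1 / (s - t)" "\<lambda>y. g s y - g t y"]
    by (simp add: unit_avg_diff cg)
  then show ?thesis using l by (simp add: has_field_derivative_iff)
qed

subsection \<open>Mean values and regularity of harmonic functions\<close>

text \<open>A weight that vanishes on the unit sphere, has gradient \<open>- 2 * x\<close>, and lets
  \<open>|x|^2\<close> be rewritten as \<open>1 - bump x\<close>; these three facts drive the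
  integrations by parts.\<close>

definition bump :: "real ^ 'n::finite \<Rightarrow> real" where "bump x = 1 - (norm x)\<^sup>2"

lemma has_pd_bump [has_pd_intros]: "has_pd i bump (\<lambda>x. - 2 * x $ i)"
  unfolding bump_def[abs_def] by (rule has_pd_cong, (rule has_pd_intros)+) simp

lemma continuous_on_bump [continuous_intros]: "continuous_on S bump"
  unfolding bump_def[abs_def] by (intro continuous_intros)

lemma bump_sphere: "norm x = 1 \<Longrightarrow> bump x = 0"
  by (simp add: bump_def)

lemma norm_sq_sum: "(norm (x :: real ^ 'n::finite))\<^sup>2 = (\<Sum>i\<in>UNIV. (x $ i)\<^sup>2)"
  by (simp add: power2_norm_eq_inner inner_vec_def flip: power2_eq_square)

lemma harmonic_spaceD:
  assumes "h \<in> harmonic_space"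
  shows "cont_diff 2 h" "continuous_on UNIV h" "continuous_on UNIV (partial_deriv i h)"
    "continuous_on UNIV (partial_deriv j (partial_deriv i h))"
    "has_pd i h (partial_deriv i h)" "has_pd j (partial_deriv i h) (partial_deriv j (partial_deriv i h))"
    "(\<Sum>i\<in>UNIV. partial_deriv i (partial_deriv i h) x) = 0"
  using assms by (auto simp: harmonic_space_def numeral_2_eq_2 has_pd_iff)

lemma harmonic_spaceI:
  assumes "cont_diff 2 h" "\<And>i. has_pd i h (h1 i)" "\<And>i. has_pd i (h1 i) (h2 i)"
    "\<And>x. (\<Sum>i\<in>UNIV. h2 i x) = 0"
  shows "h \<in> harmonic_space"
  using assms by (auto simp: harmonic_space_def has_pd_iff)

lemma harmonic_const: "(\<lambda>x. c) \<in> harmonic_space"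
  by (rule harmonic_spaceI[OF _ has_pd_const has_pd_const]) auto

lemma harmonic_add:
  assumes "f \<in> harmonic_space" "g \<in> harmonic_space"
  shows "(\<lambda>x. f x + g x) \<in> harmonic_space"
  by (rule harmonic_spaceI[OF _ has_pd_add[OF assms(1)[THEN harmonic_spaceD(5)] assms(2)[THEN harmonic_spaceD(5)]]
        has_pd_add[OF assms(1)[THEN harmonic_spaceD(6)] assms(2)[THEN harmonic_spaceD(6)]]])
     (auto simp: sum.distrib harmonic_spaceD(7)[OF assms(1)] harmonic_spaceD(7)[OF assms(2)]
       intro!: cont_diff_add harmonic_spaceD(1)[OF assms(1)] harmonic_spaceD(1)[OF assms(2)])

lemma has_pd_cmult:
  "has_pd i f f' \<Longrightarrow> has_pd i (\<lambda>x. c * f x) (\<lambda>x. c * f' x)"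
  using has_pd_mult[OF has_pd_const[of i c], of f f'] by simp

lemma harmonic_cmult:
  assumes "f \<in> harmonic_space"
  shows "(\<lambda>x. c * f x) \<in> harmonic_space"
  by (rule harmonic_spaceI[OF _ has_pd_cmult[OF assms[THEN harmonic_spaceD(5)]] has_pd_cmult[OF assms[THEN harmonic_spaceD(6)]]])
     (auto simp: harmonic_spaceD(7)[OF assms] cont_diff_cmult assms harmonic_spaceD(1) simp flip: sum_distrib_left)

lemma harmonic_affine:
  assumes "f \<in> harmonic_space"
  shows "(\<lambda>x. f (a + c *\<^sub>R x)) \<in> harmonic_space"
  by (rule harmonic_spaceI[OF _ has_pd_affine[OF assms[THEN harmonic_spaceD(5)]]
        has_pd_cmult[OF has_pd_affine[OF assms[THEN harmonic_spaceD(6)]]]])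
     (auto simp: harmonic_spaceD(7)[OF assms] cont_diff_affine assms harmonic_spaceD(1) simp flip: sum_distrib_left)

lemma partial_deriv_affine:
  assumes "f \<in> harmonic_space"
  shows "partial_deriv i (\<lambda>x. f (a + c *\<^sub>R x)) = (\<lambda>x. c * partial_deriv i f (a + c *\<^sub>R x))"
  by (rule has_pd_imp(1)[OF has_pd_affine[OF harmonic_spaceD(5)[OF assms]]])

text \<open>Green's formula for the pair \<open>h\<close>, \<open>F bump\<^sup>2\<close>, whose boundary terms vanish.\<close>

lemma unit_avg_bump:
  fixes h F :: "real ^ 'n::finite \<Rightarrow> real"
  assumes h: "h \<in> harmonic_space" and F: "F \<in> harmonic_space"
    and euler: "\<And>x. (\<Sum>i\<in>UNIV. x $ i * partial_deriv i F x) = d * F x"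
  shows "(2 * d + real CARD('n) + 2) * unit_avg (\<lambda>x. h x * F x * bump x) = 2 * unit_avg (\<lambda>x. h x * F x)"
proof -
  note hD = harmonic_spaceD[OF h] and FD = harmonic_spaceD[OF F]
  define hi Fi where "hi i = partial_deriv i h" and "Fi i = partial_deriv i F" for i
  define hii Fii where "hii i = partial_deriv i (partial_deriv i h)"
    and "Fii i = partial_deriv i (partial_deriv i F)" for i
  note [has_pd_intros] = hD(5)[folded hi_def] FD(5)[folded Fi_def]
    hD(6)[of i i for i, folded hii_def, folded hi_def] FD(6)[of i i for i, folded Fii_def, folded Fi_def]
  note [continuous_intros] = hD(2) FD(2) hD(3)[folded hi_def] FD(3)[folded Fi_def]
    hD(4)[of i i for i, folded hii_def] FD(4)[of i i for i, folded Fii_def]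
  \<comment> \<open>This is \<open>h\<close> times the derivative of \<open>F * bump^2\<close> minus
    \<open>hi i\<close> times \<open>F * bump^2\<close>. Its divergence is \<open>h\<close> times
    the Laplacian of \<open>F * bump^2\<close>, in which \<open>euler\<close> evaluates the radial
    derivative of \<open>F\<close>.\<close>
  define u where "u i x = h x * (Fi i x * (bump x * bump x) - 4 * (x $ i * (bump x * F x)))
     - hi i x * (F x * (bump x * bump x))" for i x
  define u' where "u' i x = (Fii i x * h x - hii i x * F x) * (bump x)\<^sup>2 - 8 * bump x * h x * (x $ i * Fi i x)
     - 4 * h x * bump x * F x + 8 * (x $ i)\<^sup>2 * h x * F x" for i x
  have pd: "has_pd i (u i) (u' i)" for i
    unfolding u_def[abs_def]
    by (rule has_pd_cong, (rule has_pd_intros)+) (simp add: u'_def algebra_simps power2_eq_square)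
  have cu: "continuous_on UNIV (u i)" for i
    unfolding u_def[abs_def] by (intro continuous_intros)
  have cu': "continuous_on UNIV (u' i)" for i
    unfolding u'_def[abs_def] by (intro continuous_intros)
  have "unit_avg (u' i) = 0" for i
    by (rule unit_avg_partial_eq_0[OF pd cu cu']) (simp add: u_def bump_sphere)
  then have "0 = unit_avg (\<lambda>x. \<Sum>i\<in>UNIV. u' i x)"
    by (subst unit_avg_sum) (auto simp: cu')
  also have "(\<lambda>x. \<Sum>i\<in>UNIV. u' i x) =
     (\<lambda>x. 8 * (h x * F x) - (8 * d + 4 * real CARD('n) + 8) * (h x * F x * bump x))"
  proof
    fix x :: "real ^ 'n"
    have "(\<Sum>i\<in>UNIV. u' i x) = ((\<Sum>i\<in>UNIV. Fii i x) * h x - (\<Sum>i\<in>UNIV. hii i x) * F x) * (bump x)\<^sup>2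
      - 8 * bump x * h x * (\<Sum>i\<in>UNIV. x $ i * Fi i x) - 4 * real CARD('n) * h x * bump x * F x
      + 8 * (\<Sum>i\<in>UNIV. (x $ i)\<^sup>2) * h x * F x"
      unfolding u'_def by (simp add: sum.distrib sum_subtractf sum_distrib_left sum_distrib_right left_diff_distrib)
    also have "(\<Sum>i\<in>UNIV. Fii i x) = 0" unfolding Fii_def by (rule FD)
    also have "(\<Sum>i\<in>UNIV. hii i x) = 0" unfolding hii_def by (rule hD)
    also have "(\<Sum>i\<in>UNIV. x $ i * Fi i x) = d * F x" unfolding Fi_def by (rule euler)
    also have "(\<Sum>i\<in>UNIV. (x $ i)\<^sup>2) = 1 - bump x" by (simp add: bump_def norm_sq_sum)
    finally show "(\<Sum>i\<in>UNIV. u' i x) = 8 * (h x * F x) - (8 * d + 4 * real CARD('n) + 8) * (h x * F x * bump x)"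
      by (simp add: algebra_simps)
  qed
  also have "unit_avg \<dots> = 8 * unit_avg (\<lambda>x. h x * F x) - (8 * d + 4 * real CARD('n) + 8) * unit_avg (\<lambda>x. h x * F x * bump x)"
    by (subst unit_avg_diff) (auto simp: unit_avg_cmult intro!: continuous_intros)
  finally show ?thesis by (simp add: algebra_simps)
qed

text \<open>Divergence of \<open>bump^2\<close> times the gradient of \<open>f\<close>: harmonicity
  removes the second-order part, and the gradient of the weight leaves \<open>- 4 * bump x\<close>
  times the radial derivative. That radial derivative appears when the ball is dilated.\<close>

lemma unit_avg_bump_radial:
  fixes f :: "real ^ 'n::finite \<Rightarrow> real"
  assumes f: "f \<in> harmonic_space"
  shows "unit_avg (\<lambda>x. bump x * (\<Sum>i\<in>UNIV. x $ i * partial_deriv i f x)) = 0"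
proof -
  note fD = harmonic_spaceD[OF f]
  define fi fii where "fi i = partial_deriv i f" and "fii i = partial_deriv i (partial_deriv i f)" for i
  note [has_pd_intros] = fD(5)[folded fi_def] fD(6)[of i i for i, folded fii_def, folded fi_def]
  note [continuous_intros] = fD(2) fD(3)[folded fi_def] fD(4)[of i i for i, folded fii_def]
  define u where "u i x = (bump x * bump x) * fi i x" for i x
  define u' where "u' i x = (bump x)\<^sup>2 * fii i x - 4 * (bump x * (x $ i * fi i x))" for i x
  have pd: "has_pd i (u i) (u' i)" for i
    unfolding u_def[abs_def]
    by (rule has_pd_cong, (rule has_pd_intros)+) (simp add: u'_def algebra_simps power2_eq_square)
  have cu: "continuous_on UNIV (u i)" and cu': "continuous_on UNIV (u' i)" for i
    unfolding u_def[abs_def] u'_def[abs_def] by (intro continuous_intros)+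
  have "unit_avg (u' i) = 0" for i
    by (rule unit_avg_partial_eq_0[OF pd cu cu']) (simp add: u_def bump_sphere)
  then have "0 = unit_avg (\<lambda>x. \<Sum>i\<in>UNIV. u' i x)"
    by (subst unit_avg_sum) (auto simp: cu')
  also have "(\<lambda>x. \<Sum>i\<in>UNIV. u' i x) = (\<lambda>x. - 4 * (bump x * (\<Sum>i\<in>UNIV. x $ i * fi i x)))"
  proof
    fix x :: "real ^ 'n"
    have "(\<Sum>i\<in>UNIV. fii i x) = 0" unfolding fii_def by (rule fD)
    then show "(\<Sum>i\<in>UNIV. u' i x) = - 4 * (bump x * (\<Sum>i\<in>UNIV. x $ i * fi i x))"
      by (simp add: u'_def sum_subtractf flip: sum_distrib_left)
  qed
  finally have "4 * unit_avg (\<lambda>x. bump x * (\<Sum>i\<in>UNIV. x $ i * fi i x)) = 0"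
    by (simp only: unit_avg_cmult)
  then show ?thesis by (simp add: fi_def)
qed

section \<open>Mean value property\<close>

lemma harmonic_has_derivative:
  assumes "f \<in> harmonic_space"
  shows "(f has_derivative (\<lambda>h. \<Sum>i\<in>UNIV. h $ i * partial_deriv i f x)) (at x)"
  by (rule C1_has_derivative[OF harmonic_spaceD(5,3)[OF assms]])

lemma harmonic_line_deriv:
  assumes f: "f \<in> harmonic_space"
  shows "((\<lambda>s. f (a + s *\<^sub>R y)) has_field_derivative (\<Sum>i\<in>UNIV. y $ i * partial_deriv i f (a + s *\<^sub>R y))) (at s)"
proof -
  have "((\<lambda>s. a + s *\<^sub>R y) has_derivative (\<lambda>t. t *\<^sub>R y)) (at s)"
    by (auto intro!: derivative_eq_intros)
  from has_derivative_compose[OF this harmonic_has_derivative[OF f]]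
  show ?thesis
    unfolding has_field_derivative_def
    by (rule has_derivative_eq_rhs) (simp add: sum_distrib_left mult_ac fun_eq_iff)
qed

text \<open>The weighted mean of \<open>f (a + s *\<^sub>R y)\<close> does not depend on
  \<open>s\<close>, because its derivative in \<open>s\<close> is a weighted mean of a radial
  derivative. The claim compares \<open>s = 1\<close> with \<open>s = 0\<close>.\<close>

lemma mean_value_bump_aux:
  fixes f :: "real ^ 'n::finite \<Rightarrow> real"
  assumes f: "f \<in> harmonic_space"
  shows "unit_avg (\<lambda>y. bump y * f (a + y)) = f a * unit_avg (bump :: real ^ 'n \<Rightarrow> real)"
proof -
  define g where "g s y = bump y * f (a + s *\<^sub>R y)" for s y
  define g' where "g' s y = bump y * (\<Sum>i\<in>UNIV. y $ i * partial_deriv i f (a + s *\<^sub>R y))" for s y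
  have cf: "continuous_on S (\<lambda>p. f (u p))" "continuous_on S (\<lambda>p. partial_deriv i f (u p))"
    if "continuous_on S u" for S i and u :: "'b::topological_space \<Rightarrow> real ^ 'n"
    using continuous_on_compose2[OF harmonic_spaceD(2)[OF f] that]
      continuous_on_compose2[OF harmonic_spaceD(3)[OF f] that] by auto
  have cb: "continuous_on S (\<lambda>p. bump (u p))" if "continuous_on S u"
    for S and u :: "'b::topological_space \<Rightarrow> real ^ 'n"
    using continuous_on_compose2[OF continuous_on_bump[of UNIV] that] by auto
  have cg: "continuous_on UNIV (g s)" for s
    unfolding g_def[abs_def] by (intro continuous_intros cf)
  have cg': "continuous_on UNIV (\<lambda>(s, y). g' s y)"
    unfolding g'_def case_prod_beta by (intro continuous_intros cf cb)
  have dg: "((\<lambda>s. g s y) has_field_derivative g' s y) (at s)" for s y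
    unfolding g_def g'_def by (intro DERIV_cmult harmonic_line_deriv f)
  have D: "((\<lambda>s. unit_avg (g s)) has_field_derivative unit_avg (g' s)) (at s)" for s
    by (rule unit_avg_has_field_derivative[OF dg cg cg'])
  \<comment> \<open>\<open>unit_avg_bump_radial\<close> applies to the dilated function, whose
    partial derivatives carry a factor \<open>s\<close> to be cancelled, hence \<open>s > 0\<close>.
    The endpoint 0 is reached by continuity.\<close>
  have z: "unit_avg (g' s) = 0" if "s > 0" for s
  proof -
    have "unit_avg (\<lambda>y. bump y * (\<Sum>i\<in>UNIV. y $ i * (s * partial_deriv i f (a + s *\<^sub>R y)))) = 0"
      using unit_avg_bump_radial[OF harmonic_affine[OF f, of a s]] by (simp add: partial_deriv_affine f)
    also have "(\<lambda>y. bump y * (\<Sum>i\<in>UNIV. y $ i * (s * partial_deriv i f (a + s *\<^sub>R y)))) = (\<lambda>y. s * g' s y)"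
      by (simp add: g'_def sum_distrib_left mult_ac)
    finally show ?thesis using that by (simp add: unit_avg_cmult)
  qed
  have "unit_avg (g 1) = unit_avg (g 0)"
  proof (rule DERIV_isconst_end[of 0 1])
    show "continuous_on {0..1} (\<lambda>s. unit_avg (g s))"
      using D by (intro continuous_at_imp_continuous_on ballI) (auto intro: DERIV_isCont)
    show "((\<lambda>s. unit_avg (g s)) has_field_derivative 0) (at s)" if "0 < s" "s < 1" for s
      using D[of s] z[OF that(1)] by simp
  qed simp
  then show ?thesis
    using unit_avg_cmult[of "f a" bump] by (simp add: g_def[abs_def] mult.commute)
qed

lemma unit_avg_bump_one: "unit_avg (bump :: real ^ 'n::finite \<Rightarrow> real) = 2 / (real CARD('n) + 2)"
  using unit_avg_bump[OF harmonic_const[of 1] harmonic_const[of 1], of 0, where 'n = 'n]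
  by (simp add: has_pd_imp(1)[OF has_pd_const] field_simps)

lemma mean_value_bump:
  fixes f :: "real ^ 'n::finite \<Rightarrow> real"
  assumes f: "f \<in> harmonic_space"
  shows "f a = (real CARD('n) + 2) / 2 * unit_avg (\<lambda>y. bump y * f (a + y))"
  using mean_value_bump_aux[OF f, of a] unfolding unit_avg_bump_one by (simp add: field_simps)

text \<open>\<open>unit_avg_bump\<close> with \<open>F = 1\<close> and \<open>d = 0\<close> converts
  the weighted mean into the plain one.\<close>

lemma mean_value:
  fixes f :: "real ^ 'n::finite \<Rightarrow> real"
  assumes f: "f \<in> harmonic_space"
  shows "f a = unit_avg (\<lambda>y. f (a + y))"
  using unit_avg_bump[OF harmonic_affine[OF f, of a 1] harmonic_const[of 1], of 0] mean_value_bump[OF f, of a]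
  by (simp add: has_pd_imp(1)[OF has_pd_const] mult.commute)

section \<open>Derivatives of harmonic functions are harmonic\<close>

lemma has_pd_unit_avg:
  fixes f :: "real ^ 'n::finite \<Rightarrow> real"
  assumes q: "continuous_on UNIV q" and f: "continuous_on UNIV f" and pd: "has_pd i f f'" and f': "continuous_on UNIV f'"
  shows "has_pd i (\<lambda>x. unit_avg (\<lambda>y. q y * f (x + y))) (\<lambda>x. unit_avg (\<lambda>y. q y * f' (x + y)))"
  unfolding has_pd_def
proof
  fix x :: "real ^ 'n"
  define g where "g t y = q y * f ((x + y) + t *\<^sub>R axis i 1)" for t y
  define g' where "g' t y = q y * f' ((x + y) + t *\<^sub>R axis i 1)" for t y
  have "((\<lambda>t. unit_avg (g t)) has_field_derivative unit_avg (g' 0)) (at 0)"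
  proof (rule unit_avg_has_field_derivative)
    show "((\<lambda>t. g t y) has_field_derivative g' t y) (at t)" for t y
      unfolding g_def g'_def by (intro DERIV_cmult has_pd_line pd)
    show "continuous_on UNIV (g t)" for t
      unfolding g_def[abs_def] by (intro continuous_intros q continuous_on_compose2[OF f]) auto
    show "continuous_on UNIV (\<lambda>(t, y). g' t y)"
      unfolding g'_def case_prod_beta
      by (intro continuous_intros continuous_on_compose2[OF q] continuous_on_compose2[OF f']) auto
  qed
  then show "((\<lambda>t. unit_avg (\<lambda>y. q y * f (x + t *\<^sub>R axis i 1 + y))) has_field_derivative unit_avg (\<lambda>y. q y * f' (x + y))) (at 0)"
    by (simp add: g_def[abs_def] g'_def[abs_def] add_ac)
qed

lemma cont_diff_unit_avg:
  fixes f :: "real ^ 'n::finite \<Rightarrow> real"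
  assumes q: "continuous_on UNIV q"
  shows "cont_diff m f \<Longrightarrow> cont_diff m (\<lambda>x. unit_avg (\<lambda>y. q y * f (x + y)))"
proof (induction m arbitrary: f)
  have c: "continuous_on UNIV (\<lambda>x. unit_avg (\<lambda>y. q y * f (x + y)))" if "continuous_on UNIV f" for f
    by (rule continuous_on_unit_avg)
       (auto simp: case_prod_beta intro!: continuous_intros continuous_on_compose2[OF q] continuous_on_compose2[OF that])
  { case 0 then show ?case using c by simp }
  case (Suc m)
  show ?case
    by (rule cont_diff_SucI[OF c has_pd_unit_avg[OF q _ cont_diff_Suc_has_pd(1)[OF Suc.prems]]])
       (use Suc.prems in \<open>auto intro: cont_diff_continuous Suc.IH\<close>)
qed

text \<open>The weighted mean value formula is differentiated, and integration by parts then puts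
  the derivative on \<open>bump\<close>. The right-hand side uses only values of \<open>h\<close>,
  so it is as smooth as \<open>h\<close> itself and passes to uniform limits.\<close>

lemma harmonic_partial_deriv_eq:
  fixes h :: "real ^ 'n::finite \<Rightarrow> real"
  assumes h: "h \<in> harmonic_space"
  shows "partial_deriv i h x = (real CARD('n) + 2) * unit_avg (\<lambda>y. y $ i * h (x + y))"
proof -
  let ?c = "(real CARD('n) + 2) / 2"
  note hD = harmonic_spaceD[OF h]
  have "has_pd i (\<lambda>x. ?c * unit_avg (\<lambda>y. bump y * h (x + y))) (\<lambda>x. ?c * unit_avg (\<lambda>y. bump y * partial_deriv i h (x + y)))"
    by (intro has_pd_cmult has_pd_unit_avg hD continuous_on_bump)
  moreover have "(\<lambda>x. ?c * unit_avg (\<lambda>y. bump y * h (x + y))) = h"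
    using mean_value_bump[OF h] by auto
  ultimately have "has_pd i h (\<lambda>x. ?c * unit_avg (\<lambda>y. bump y * partial_deriv i h (x + y)))"
    by (simp only:)
  from fun_cong[OF has_pd_imp(1)[OF this], of x]
  have 1: "partial_deriv i h x = ?c * unit_avg (\<lambda>y. bump y * partial_deriv i h (x + y))" .
  have ch: "continuous_on UNIV (\<lambda>y. h (x + y))" "continuous_on UNIV (\<lambda>y. partial_deriv i h (x + y))"
    by (rule continuous_on_compose2[OF hD(2)] continuous_on_compose2[OF hD(3)], auto intro!: continuous_intros)+
  have "has_pd i (\<lambda>y. h (x + y)) (\<lambda>y. partial_deriv i h (x + y))"
    using has_pd_affine[OF hD(5), where a = x and c = 1] by simp
  then have "has_pd i (\<lambda>y. bump y * h (x + y)) (\<lambda>y. - 2 * y $ i * h (x + y) + bump y * partial_deriv i h (x + y))"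
    by (intro has_pd_intros)
  then have "0 = unit_avg (\<lambda>y. - 2 * y $ i * h (x + y) + bump y * partial_deriv i h (x + y))"
    by (intro unit_avg_partial_eq_0[symmetric, where u = "\<lambda>y. bump y * h (x + y)"])
       (auto simp: bump_sphere intro!: continuous_intros ch)
  also have "\<dots> = unit_avg (\<lambda>y. - 2 * (y $ i * h (x + y))) + unit_avg (\<lambda>y. bump y * partial_deriv i h (x + y))"
    by (subst unit_avg_add[symmetric]) (auto intro!: continuous_intros ch simp: mult.assoc)
  finally have "unit_avg (\<lambda>y. bump y * partial_deriv i h (x + y)) = 2 * unit_avg (\<lambda>y. y $ i * h (x + y))"
    by (simp only: unit_avg_cmult)
  with 1 show ?thesis by simp
qed

text \<open>The averaging operator \<open>K\<close> commutes with partial derivatives, so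
  \<open>K h\<close> is twice differentiable because \<open>h\<close> is, and its Laplacian is
  \<open>K\<close> of the Laplacian of \<open>h\<close>. No third derivative of \<open>h\<close>
  enters.\<close>

lemma harmonic_partial_deriv:
  fixes h :: "real ^ 'n::finite \<Rightarrow> real"
  assumes h: "h \<in> harmonic_space"
  shows "partial_deriv i h \<in> harmonic_space"
proof -
  note hD = harmonic_spaceD[OF h]
  define K where "K f x = (real CARD('n) + 2) * unit_avg (\<lambda>y. y $ i * f (x + y))" for f and x :: "real ^ 'n"
  have e: "partial_deriv i h = K h" unfolding K_def using harmonic_partial_deriv_eq[OF h] by auto
  have q: "continuous_on UNIV (\<lambda>y::real^'n. y $ i)" by (intro continuous_intros)
  show ?thesis
    unfolding e
  proof (rule harmonic_spaceI[where ?h1.0 = "\<lambda>j. K (partial_deriv j h)" and ?h2.0 = "\<lambda>j. K (partial_deriv j (partial_deriv j h))"])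
    show "cont_diff 2 (K h)" unfolding K_def by (intro cont_diff_cmult cont_diff_unit_avg q hD)
    show "has_pd j (K h) (K (partial_deriv j h))" for j
      unfolding K_def by (intro has_pd_cmult has_pd_unit_avg q hD)
    show "has_pd j (K (partial_deriv j h)) (K (partial_deriv j (partial_deriv j h)))" for j
      unfolding K_def by (intro has_pd_cmult has_pd_unit_avg q hD)
    fix x :: "real ^ 'n"
    have "(\<Sum>j\<in>UNIV. unit_avg (\<lambda>y. y $ i * partial_deriv j (partial_deriv j h) (x + y)))
        = unit_avg (\<lambda>y. \<Sum>j\<in>UNIV. y $ i * partial_deriv j (partial_deriv j h) (x + y))"
      by (rule unit_avg_sum[symmetric])
         (auto intro!: continuous_intros continuous_on_compose2[OF hD(4)])
    also have "(\<lambda>y. \<Sum>j\<in>UNIV. y $ i * partial_deriv j (partial_deriv j h) (x + y)) = (\<lambda>y. 0)"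
      by (simp add: hD(7) flip: sum_distrib_left)
    finally show "(\<Sum>j\<in>UNIV. K (partial_deriv j (partial_deriv j h)) x) = 0"
      by (simp add: K_def flip: sum_distrib_left)
  qed
qed

subsection \<open>The raising operators\<close>

definition hom_harmonic :: "nat \<Rightarrow> (real ^ 'n::finite \<Rightarrow> real) set"
  where "hom_harmonic d = {G \<in> harmonic_space. \<forall>t>0. \<forall>x. G (t *\<^sub>R x) = t ^ d * G x}"

text \<open>The harmonic projection of \<open>x\<^sub>k G\<close>. The denominator vanishes only for \<open>d = 0\<close>, \<open>N = 2\<close>, and then
  \<open>G\<close> is constant, so that the quotient is 0 as it should be.\<close>

definition raise :: "'n::finite \<Rightarrow> nat \<Rightarrow> (real ^ 'n \<Rightarrow> real) \<Rightarrow> real ^ 'n \<Rightarrow> real"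
  where "raise k d G x =
    x $ k * G x - (norm x)\<^sup>2 * partial_deriv k G x / (2 * real d + real CARD('n) - 2)"

lemma hom_harmonicD:
  assumes "G \<in> hom_harmonic d"
  shows "G \<in> harmonic_space" "t > 0 \<Longrightarrow> G (t *\<^sub>R x) = t ^ d * G x"
  using assms by (auto simp: hom_harmonic_def)

lemma hom_harmonic_one: "(\<lambda>x. 1) \<in> hom_harmonic 0"
  by (simp add: hom_harmonic_def harmonic_const)

text \<open>The dilation factor tends to 0. Degree 0 is singled out because the denominator of
  \<open>raise\<close> can vanish there; the derivative in its numerator then vanishes too.\<close>

lemma hom_harmonic_0_const:
  assumes G: "G \<in> hom_harmonic 0"
  shows "G x = G 0"
proof -
  have t0: "(\<lambda>n. 1 / real (Suc n)) \<longlonglongrightarrow> 0" by real_asymp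
  have "isCont G (0 *\<^sub>R x)"
    using harmonic_spaceD(2)[OF hom_harmonicD(1)[OF G]] by (simp add: continuous_on_eq_continuous_at)
  then have "(\<lambda>n. G ((1 / real (Suc n)) *\<^sub>R x)) \<longlonglongrightarrow> G (0 *\<^sub>R x)"
    by (rule isCont_tendsto_compose) (intro tendsto_intros t0)
  moreover have "G ((1 / real (Suc n)) *\<^sub>R x) = G x" for n
    using hom_harmonicD(2)[OF G, of "1 / real (Suc n)" x] by simp
  ultimately show ?thesis by (simp add: LIMSEQ_const_iff)
qed

lemma hom_harmonic_0_partial:
  assumes G: "G \<in> hom_harmonic 0"
  shows "partial_deriv k G x = 0"
proof -
  have "G = (\<lambda>x. G 0)" using hom_harmonic_0_const[OF G] by auto
  then show ?thesis using has_pd_imp(1)[OF has_pd_const, of k "G 0"] by metis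
qed

lemma hom_harmonic_partial:
  fixes G :: "real ^ 'n::finite \<Rightarrow> real"
  assumes G: "G \<in> hom_harmonic (Suc d)"
  shows "partial_deriv k G \<in> hom_harmonic d"
  unfolding hom_harmonic_def
proof (intro CollectI conjI allI impI)
  note H = hom_harmonicD(1)[OF G]
  show "partial_deriv k G \<in> harmonic_space" by (rule harmonic_partial_deriv[OF H])
  fix t :: real and x :: "real ^ 'n" assume t: "t > 0"
  have "(\<lambda>x. G (0 + t *\<^sub>R x)) = (\<lambda>x. t ^ Suc d * G x)" using hom_harmonicD(2)[OF G t] by auto
  then have "t * partial_deriv k G ((0 :: real ^ 'n) + t *\<^sub>R x) = t ^ Suc d * partial_deriv k G x"
    using partial_deriv_affine[OF H, where i = k and a = 0 and c = t] has_pd_imp(1)[OF has_pd_cmult[OF harmonic_spaceD(5)[OF H]]]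
    by metis
  then show "partial_deriv k G (t *\<^sub>R x) = t ^ d * partial_deriv k G x" using t by simp
qed

lemma euler_identity:
  assumes G: "G \<in> hom_harmonic d"
  shows "(\<Sum>i\<in>UNIV. x $ i * partial_deriv i G x) = real d * G x"
proof -
  have "((\<lambda>s. G (0 + s *\<^sub>R x)) has_field_derivative (\<Sum>i\<in>UNIV. x $ i * partial_deriv i G (0 + 1 *\<^sub>R x))) (at 1)"
    by (rule harmonic_line_deriv[OF hom_harmonicD(1)[OF G]])
  then have 1: "((\<lambda>s. s ^ d * G x) has_field_derivative (\<Sum>i\<in>UNIV. x $ i * partial_deriv i G (0 + 1 *\<^sub>R x))) (at 1)"
    by (rule has_field_derivative_transform_within_open[where S = "{0<..}"]) (auto simp: hom_harmonicD(2)[OF G])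
  have "((\<lambda>s. s ^ d * G x) has_field_derivative real d * G x) (at 1)"
    by (auto intro!: derivative_eq_intros)
  from DERIV_unique[OF 1 this] show ?thesis by simp
qed

text \<open>The factor is the real number \<open>real d - 1\<close>; for \<open>d = 0\<close> both
  sides are 0, so every degree is covered.\<close>

lemma euler_identity_partial:
  assumes G: "G \<in> hom_harmonic d"
  shows "(\<Sum>i\<in>UNIV. x $ i * partial_deriv i (partial_deriv k G) x) = (real d - 1) * partial_deriv k G x"
proof (cases d)
  case 0
  then have "partial_deriv k G = (\<lambda>x. 0)" using hom_harmonic_0_partial[of G k] G by blast
  then show ?thesis by (simp add: has_pd_imp(1)[OF has_pd_const])
next
  case (Suc e)
  then show ?thesis using euler_identity[OF hom_harmonic_partial[of G e k]] G by simp
qed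

lemma has_pd_raise:
  fixes G :: "real ^ 'n::finite \<Rightarrow> real"
  assumes G: "G \<in> harmonic_space"
  shows "has_pd i (raise k d G) (\<lambda>x. (if k = i then 1 else 0) * G x + x $ k * partial_deriv i G x -
    (2 * x $ i * partial_deriv k G x + (norm x)\<^sup>2 * partial_deriv i (partial_deriv k G) x)
      / (2 * real d + real CARD('n) - 2))"
proof -
  have "raise k d G = (\<lambda>x. x $ k * G x - (1 / (2 * real d + real CARD('n) - 2)) * ((norm x)\<^sup>2 * partial_deriv k G x))"
    by (auto simp: raise_def)
  then show ?thesis
    by (simp only:, intro has_pd_cong[OF has_pd_diff[OF has_pd_mult[OF has_pd_nth harmonic_spaceD(5)[OF G]]
        has_pd_cmult[OF has_pd_mult[OF has_pd_norm_sq harmonic_spaceD(6)[OF G]]]]]) simp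
qed

text \<open>The Laplacian of \<open>x $ k * G x\<close> is \<open>2 * partial_deriv k G x\<close>;
  that of \<open>(norm x)^2 * partial_deriv k G x\<close> is
  \<open>2 * s * partial_deriv k G x\<close>, by Euler's identity in degree \<open>d - 1\<close>.
  Dividing by \<open>s\<close> makes the two cancel.\<close>

lemma raise_hom_harmonic:
  fixes G :: "real ^ 'n::finite \<Rightarrow> real"
  assumes G: "G \<in> hom_harmonic d"
  shows "raise k d G \<in> hom_harmonic (Suc d)"
proof -
  note H = hom_harmonicD(1)[OF G]
  note HD = harmonic_spaceD[OF H] and KD = harmonic_spaceD[OF harmonic_partial_deriv[OF H, of k]]
  define s where "s = 2 * real d + real CARD('n) - 2"
  define R1 where "R1 i x = (if k = i then 1 else 0) * G x + x $ k * partial_deriv i G x -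
    (1 / s) * (2 * (x $ i * partial_deriv k G x) + (norm x)\<^sup>2 * partial_deriv i (partial_deriv k G) x)" for i x
  define R2 where "R2 i x = 2 * ((if k = i then 1 else 0) * partial_deriv i G x) + x $ k * partial_deriv i (partial_deriv i G) x -
    (1 / s) * (2 * partial_deriv k G x + 4 * (x $ i * partial_deriv i (partial_deriv k G) x)
      + (norm x)\<^sup>2 * partial_deriv i (partial_deriv i (partial_deriv k G)) x)" for i x
  have e: "raise k d G = (\<lambda>x. x $ k * G x - (1 / s) * ((norm x)\<^sup>2 * partial_deriv k G x))"
    by (auto simp: raise_def s_def)
  have "raise k d G \<in> harmonic_space"
  proof (rule harmonic_spaceI[where ?h1.0 = R1 and ?h2.0 = R2])
    show "cont_diff 2 (raise k d G)"
      unfolding e by (intro cont_diff_diff cont_diff_mult cont_diff_const cont_diff_nth cont_diff_norm_sq HD(1) KD(1))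
    show "has_pd i (raise k d G) (R1 i)" for i
      by (rule has_pd_cong[OF has_pd_raise[OF H]]) (simp add: R1_def s_def)
    show "has_pd i (R1 i) (R2 i)" for i
      unfolding R1_def[abs_def]
      by (rule has_pd_cong[OF has_pd_diff[OF has_pd_add[OF has_pd_cmult[OF HD(5)] has_pd_mult[OF has_pd_nth HD(6)]]
        has_pd_cmult[OF has_pd_add[OF has_pd_cmult[OF has_pd_mult[OF has_pd_nth KD(5)]] has_pd_mult[OF has_pd_norm_sq KD(6)]]]]])
         (simp add: R2_def algebra_simps)
    fix x
    have "(\<Sum>i\<in>UNIV. R2 i x) = 2 * partial_deriv k G x + x $ k * (\<Sum>i\<in>UNIV. partial_deriv i (partial_deriv i G) x)
      - (1 / s) * (2 * real CARD('n) * partial_deriv k G x + 4 * (\<Sum>i\<in>UNIV. x $ i * partial_deriv i (partial_deriv k G) x)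
      + (norm x)\<^sup>2 * (\<Sum>i\<in>UNIV. partial_deriv i (partial_deriv i (partial_deriv k G)) x))"
    proof -
      have "(\<Sum>i\<in>UNIV. (if k = i then 1 else 0) * partial_deriv i G x) = partial_deriv k G x"
        by (simp add: if_distrib[of "\<lambda>c. c * _"] cong: if_cong)
      then show ?thesis
        unfolding R2_def sum_subtractf sum.distrib sum_distrib_left[symmetric] by simp
    qed
    also have "\<dots> = 2 * partial_deriv k G x - (1 / s) * (2 * s * partial_deriv k G x)"
      unfolding HD(7) KD(7) euler_identity_partial[OF G] by (simp add: s_def algebra_simps)
    also have "\<dots> = 0"
    proof (cases "s = 0")
      case True
      then have "2 * d + CARD('n) = 2" unfolding s_def by linarith
      then have "d = 0" using zero_less_card_finite[where 'a = 'n] by linarith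
      then show ?thesis using hom_harmonic_0_partial[of G] G by simp
    qed simp
    finally show "(\<Sum>i\<in>UNIV. R2 i x) = 0" .
  qed
  moreover have "raise k d G (t *\<^sub>R x) = t ^ Suc d * raise k d G x" if t: "t > 0" for t x
  proof (cases d)
    case 0
    then show ?thesis using hom_harmonic_0_partial[of G k] G hom_harmonicD(2)[OF G t] by (simp add: raise_def)
  next
    case (Suc c)
    then show ?thesis
      using hom_harmonicD(2)[OF G t] hom_harmonicD(2)[OF hom_harmonic_partial[of G c k] t] G
      by (simp add: raise_def right_diff_distrib power_mult_distrib power2_eq_square)
  qed
  ultimately show ?thesis by (simp add: hom_harmonic_def)
qed

lemma partial_raise_0:
  assumes G: "G \<in> hom_harmonic 0"
  shows "partial_deriv k (raise k 0 G) = G"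
proof
  fix x
  have "partial_deriv k G = (\<lambda>x. 0)" using hom_harmonic_0_partial[OF G] by auto
  then show "partial_deriv k (raise k 0 G) x = G x"
    by (simp add: has_pd_imp(1)[OF has_pd_raise[OF hom_harmonicD(1)[OF G]]] has_pd_imp(1)[OF has_pd_const])
qed

text \<open>The denominators of \<open>raise\<close> in neighbouring degrees differ by 2, exactly
  what the derivative of \<open>(norm x)^2\<close> takes away from
  \<open>x $ k * partial_deriv k G x\<close>; so the terms regroup into \<open>raise\<close> one
  degree lower. This commutation rule is the source of the recursion of
  \<open>ladder_factor\<close>.\<close>

lemma partial_raise_Suc:
  fixes G :: "real ^ 'n::finite \<Rightarrow> real"
  assumes G: "G \<in> hom_harmonic (Suc d)"
  shows "partial_deriv k (raise k (Suc d) G) x =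
    G x + (2 * real d + real CARD('n) - 2) / (2 * real d + real CARD('n)) * raise k d (partial_deriv k G) x"
proof -
  let ?s = "2 * real d + real CARD('n)"
  have s: "?s > 0" by (simp add: add_nonneg_pos)
  have *: "partial_deriv k (raise k (Suc d) G) x = G x + x $ k * partial_deriv k G x -
    (2 * x $ k * partial_deriv k G x + (norm x)\<^sup>2 * partial_deriv k (partial_deriv k G) x) / ?s"
    by (simp add: has_pd_imp(1)[OF has_pd_raise[OF hom_harmonicD(1)[OF G]]])
  show ?thesis
  proof (cases "?s = 2")
    case True
    then have "2 * d + CARD('n) = 2" by linarith
    then have "d = 0" using zero_less_card_finite[where 'a = 'n] by linarith
    then have "partial_deriv k (partial_deriv k G) x = 0"
      using hom_harmonic_0_partial[OF hom_harmonic_partial] G by simp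
    then show ?thesis unfolding * using True by simp
  next
    case False
    define r where "r = ?s - 2"
    have r: "r \<noteq> 0" "?s = r + 2" "r + 2 \<noteq> 0" using False s by (auto simp: r_def)
    have alg: "X - (2 * X + Y) / (r + 2) = r / (r + 2) * (X - Y / r)" for X Y
    proof -
      have "X - (2 * X + Y) / (r + 2) = ((r + 2) * X - (2 * X + Y)) / (r + 2)"
        using r(3) by (simp add: diff_divide_distrib)
      also have "(r + 2) * X - (2 * X + Y) = r * (X - Y / r)"
        using r(1) by (simp add: algebra_simps)
      finally show ?thesis by simp
    qed
    show ?thesis
      unfolding * raise_def r(2)
      using alg[of "x $ k * partial_deriv k G x" "(norm x)\<^sup>2 * partial_deriv k (partial_deriv k G) x"]
      by (simp add: mult.assoc)
  qed
qed

text \<open>Three relations between means: the vanishing mean of the derivative of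
  \<open>h * G * bump\<close>, and \<open>unit_avg_bump\<close> for the pairs
  \<open>partial_deriv k h\<close>, \<open>G\<close> and \<open>h\<close>,
  \<open>partial_deriv k G\<close>. Writing \<open>(norm x)^2\<close> as \<open>1 - bump x\<close>
  turns the correction term of \<open>raise\<close> into \<open>K - I2\<close>, and both sides
  become multiples of \<open>I1\<close>.\<close>

lemma unit_avg_partial:
  fixes G :: "real ^ 'n::finite \<Rightarrow> real"
  assumes h: "h \<in> harmonic_space" and G: "G \<in> hom_harmonic d"
  shows "unit_avg (\<lambda>x. partial_deriv k h x * G x) =
    (2 * real d + 2 + real CARD('n)) * unit_avg (\<lambda>x. h x * raise k d G x)"
proof -
  note H = hom_harmonicD(1)[OF G]
  note hD = harmonic_spaceD[OF h] and GD = harmonic_spaceD[OF H]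
  note [continuous_intros] = hD(2,3) GD(2,3)
  let ?N = "real CARD('n)"
  define s where "s = 2 * real d + ?N - 2"
  define I1 where "I1 = unit_avg (\<lambda>x. partial_deriv k h x * G x * bump x)"
  define I2 where "I2 = unit_avg (\<lambda>x. h x * partial_deriv k G x * bump x)"
  define I3 where "I3 = unit_avg (\<lambda>x. h x * (x $ k * G x))"
  define J where "J = unit_avg (\<lambda>x. partial_deriv k h x * G x)"
  define K where "K = unit_avg (\<lambda>x. h x * partial_deriv k G x)"
  have a: "(2 * real d + ?N + 2) * I1 = 2 * J"
    unfolding I1_def J_def by (rule unit_avg_bump[OF harmonic_partial_deriv[OF h] H euler_identity[OF G]])
  \<comment> \<open>The homogeneous factor now has degree \<open>d - 1\<close>, so the constant
    drops by 2.\<close>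
  have b: "(2 * real d + ?N) * I2 = 2 * K"
    using unit_avg_bump[OF h harmonic_partial_deriv[OF H] euler_identity_partial[OF G]]
    by (simp add: I2_def K_def)
  have "has_pd k (\<lambda>x. h x * G x * bump x) (\<lambda>x. (partial_deriv k h x * G x + h x * partial_deriv k G x) * bump x
      + h x * G x * (- 2 * x $ k))"
    by (intro has_pd_intros hD GD)
  then have "0 = unit_avg (\<lambda>x. (partial_deriv k h x * G x + h x * partial_deriv k G x) * bump x + h x * G x * (- 2 * x $ k))"
    by (rule unit_avg_partial_eq_0[symmetric]) (auto simp: bump_sphere intro!: continuous_intros)
  also have "(\<lambda>x. (partial_deriv k h x * G x + h x * partial_deriv k G x) * bump x + h x * G x * (- 2 * x $ k))
     = (\<lambda>x. (partial_deriv k h x * G x * bump x + h x * partial_deriv k G x * bump x) - 2 * (h x * (x $ k * G x)))"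
    by (auto simp: algebra_simps)
  also have "unit_avg \<dots> = I1 + I2 - 2 * I3"
    unfolding I1_def I2_def I3_def
    by (subst unit_avg_diff) (auto simp: unit_avg_add unit_avg_cmult continuous_intros intro!: continuous_intros)
  finally have c: "I1 + I2 = 2 * I3" by simp
  define c where "c = 1 / s"
  have "unit_avg (\<lambda>x. h x * raise k d G x) =
      unit_avg (\<lambda>x. h x * (x $ k * G x) - c * (h x * partial_deriv k G x - h x * partial_deriv k G x * bump x))"
    by (simp add: raise_def s_def c_def bump_def algebra_simps)
  also have "\<dots> = I3 - c * (K - I2)"
    unfolding I3_def K_def I2_def
    by (subst unit_avg_diff) (auto simp: unit_avg_diff unit_avg_cmult continuous_intros intro!: continuous_intros)
  also have "\<dots> = I3 - (1 / s) * (K - I2)" by (simp add: c_def)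
  finally have e: "unit_avg (\<lambda>x. h x * raise k d G x) = I3 - (1 / s) * (K - I2)" .
  have "(1 / s) * (K - I2) = I2 / 2"
  proof (cases "s = 0")
    case True
    then have "2 * d + CARD('n) = 2" unfolding s_def by linarith
    then have "d = 0" using zero_less_card_finite[where 'a = 'n] by linarith
    then have "I2 = 0" unfolding I2_def using hom_harmonic_0_partial[of G] G by simp
    then show ?thesis using True by simp
  next
    case False
    have "K - I2 = s * I2 / 2" using b by (simp add: s_def algebra_simps)
    then show ?thesis using False by simp
  qed
  then have f: "unit_avg (\<lambda>x. h x * raise k d G x) = I1 / 2" using e c by simp
  have "J = (2 * real d + 2 + ?N) * (I1 / 2)" using a by (simp add: algebra_simps)
  then show ?thesis unfolding f J_def .
qed

text \<open>\<open>ladder_factor N d\<close> is the eigenvalue of \<open>\<partial>/\<partial>x\<^sub>k\<close> after the \<open>k\<close>-th raising operator on the zonal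
  harmonic of degree \<open>d\<close>, which is the largest one on degree \<open>d\<close>.\<close>

primrec ladder_factor :: "real \<Rightarrow> nat \<Rightarrow> real" where
  "ladder_factor N 0 = 1"
| "ladder_factor N (Suc d) = 1 + (2 * real d + N - 2) / (2 * real d + N) * ladder_factor N d"

text \<open>Each factor is the square of the adjoint constant \<open>2 d + 2 + N\<close> times the
  bound \<open>ladder_factor N d / (2 d + 2 + N)\<close> for the squared norm of
  \<open>raise\<close>. These are the numbers \<open>q\<close> of the overview.\<close>

primrec ladder_prod :: "real \<Rightarrow> nat \<Rightarrow> real" where
  "ladder_prod N 0 = 1"
| "ladder_prod N (Suc d) = ladder_prod N d * ((2 * real d + 2 + N) * ladder_factor N d)"

section \<open>Norm of the raising operators and the sharp derivative estimate\<close>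

lemma ladder_factor_ge_1: "N \<ge> 2 \<Longrightarrow> ladder_factor N d \<ge> 1"
  by (induction d) auto

lemma ladder_prod_pos: "N \<ge> 2 \<Longrightarrow> ladder_prod N d > 0"
proof (induction d)
  case (Suc d)
  then have "ladder_factor N d > 0" using ladder_factor_ge_1[of N d] by simp
  then show ?case using Suc by (auto intro!: mult_pos_pos)
qed simp

text \<open>By adjointness the left side pairs \<open>G\<close> with lowering after raising, and the
  commutation rule reduces this to \<open>Y\<close>, the pairing with raising after lowering.
  Adjointness also makes \<open>X\<close> a multiple of \<open>Y\<close>, so Cauchy-Schwarz and the
  induction hypothesis bound \<open>Y^2\<close> by a multiple of \<open>Y\<close> itself.\<close>

lemma raise_norm_le:
  fixes G :: "real ^ 'n::finite \<Rightarrow> real"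
  assumes N: "CARD('n) \<ge> 2"
  shows "G \<in> hom_harmonic d \<Longrightarrow> (2 * real d + 2 + real CARD('n)) * unit_avg (\<lambda>x. (raise k d G x)\<^sup>2)
     \<le> ladder_factor (real CARD('n)) d * unit_avg (\<lambda>x. (G x)\<^sup>2)"
proof (induction d arbitrary: G)
  case 0
  have "unit_avg (\<lambda>x. partial_deriv k (raise k 0 G) x * G x) = (2 * real 0 + 2 + real CARD('n)) * unit_avg (\<lambda>x. raise k 0 G x * raise k 0 G x)"
    by (rule unit_avg_partial[OF hom_harmonicD(1)[OF raise_hom_harmonic[OF 0]] 0])
  then show ?case by (simp add: partial_raise_0[OF 0] power2_eq_square)
next
  case (Suc d)
  let ?N = "real CARD('n)" and ?A = "raise k d (partial_deriv k G)"
  define c where "c = (2 * real d + ?N - 2) / (2 * real d + ?N)"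
  let ?b = "ladder_factor ?N d"
  have N2: "?N \<ge> 2" using N by simp
  note G = Suc.prems and G' = hom_harmonic_partial[OF Suc.prems, of k]
  note GD = harmonic_spaceD[OF hom_harmonicD(1)[OF G]] and AD = harmonic_spaceD[OF hom_harmonicD(1)[OF raise_hom_harmonic[OF G', of k]]]
  define X where "X = unit_avg (\<lambda>x. (partial_deriv k G x)\<^sup>2)"
  define Y where "Y = unit_avg (\<lambda>x. G x * ?A x)"
  define Z where "Z = unit_avg (\<lambda>x. (G x)\<^sup>2)"
  have X: "X = (2 * real d + 2 + ?N) * Y"
    using unit_avg_partial[OF hom_harmonicD(1)[OF G] G', of k] by (simp add: X_def Y_def power2_eq_square)
  have X0: "X \<ge> 0" and Z0: "Z \<ge> 0" unfolding X_def Z_def by (auto intro!: unit_avg_nonneg)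
  have b: "?b \<ge> 1" using ladder_factor_ge_1[OF N2] .
  have IH: "(2 * real d + 2 + ?N) * unit_avg (\<lambda>x. (?A x)\<^sup>2) \<le> ?b * X"
    using Suc.IH[OF G'] by (simp add: X_def)
  have CS: "Y\<^sup>2 \<le> Z * unit_avg (\<lambda>x. (?A x)\<^sup>2)"
    unfolding Y_def Z_def by (rule unit_avg_Cauchy_Schwarz[OF GD(2) AD(2)])
  have m: "2 * real d + 2 + ?N > 0" using N2 by simp
  \<comment> \<open>One factor \<open>Y\<close> cancels, so the eigenvalue bound of degree
    \<open>d\<close> is carried over without loss.\<close>
  have "Y \<le> ?b * Z"
  proof (cases "Y > 0")
    case True
    have "(2 * real d + 2 + ?N) * Y\<^sup>2 \<le> Z * ((2 * real d + 2 + ?N) * unit_avg (\<lambda>x. (?A x)\<^sup>2))"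
      using mult_left_mono[OF CS, of "2 * real d + 2 + ?N"] m by (simp add: mult_ac)
    also have "\<dots> \<le> Z * (?b * X)" by (intro mult_left_mono IH Z0)
    also have "\<dots> = (2 * real d + 2 + ?N) * Y * (?b * Z)" by (simp add: X)
    finally have "(2 * real d + 2 + ?N) * Y * Y \<le> (2 * real d + 2 + ?N) * Y * (?b * Z)" by (simp add: power2_eq_square mult_ac)
    then show ?thesis using True m by (simp add: mult_le_cancel_left_pos)
  next
    case False
    then show ?thesis using b Z0 by (smt (verit) mult_nonneg_nonneg)
  qed
  have "(2 * real (Suc d) + 2 + ?N) * unit_avg (\<lambda>x. (raise k (Suc d) G x)\<^sup>2)
      = unit_avg (\<lambda>x. partial_deriv k (raise k (Suc d) G) x * G x)"
    using unit_avg_partial[OF hom_harmonicD(1)[OF raise_hom_harmonic[OF G]] G, of k k] by (simp add: power2_eq_square)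
  also have "\<dots> = unit_avg (\<lambda>x. (G x)\<^sup>2 + c * (G x * ?A x))"
    unfolding partial_raise_Suc[OF G] c_def[symmetric] by (simp add: power2_eq_square algebra_simps)
  also have "\<dots> = Z + c * Y"
    unfolding Y_def Z_def by (subst unit_avg_add) (auto simp: unit_avg_cmult intro!: continuous_intros GD AD)
  also have "\<dots> \<le> Z + c * (?b * Z)"
    using N2 \<open>Y \<le> ?b * Z\<close> by (intro add_left_mono mult_left_mono) (auto simp: c_def)
  also have "\<dots> = ladder_factor ?N (Suc d) * Z" by (simp add: c_def algebra_simps)
  finally show ?case by (simp add: Z_def)
qed

lemma harmonic_foldr_partial:
  "h \<in> harmonic_space \<Longrightarrow> foldr partial_deriv L h \<in> harmonic_space"
  by (induction L) (auto intro: harmonic_partial_deriv)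

lemma foldr_partial_affine:
  assumes "h \<in> harmonic_space"
  shows "foldr partial_deriv L (\<lambda>x. h (a + c *\<^sub>R x)) = (\<lambda>x. c ^ length L * foldr partial_deriv L h (a + c *\<^sub>R x))"
proof (induction L)
  case (Cons i L)
  show ?case
    by (simp add: Cons has_pd_imp(1)[OF has_pd_cmult[OF has_pd_affine[OF harmonic_spaceD(5)[OF harmonic_foldr_partial[OF assms]]]]] mult_ac)
qed simp

text \<open>Each derivative in \<open>L\<close> moves to the other side as a raising operator on
  \<open>G\<close>, at the price of one factor of \<open>ladder_prod\<close>; for the empty list
  Cauchy-Schwarz remains. The directions may be mixed because \<open>raise_norm_le\<close> has the
  same constant for all \<open>k\<close>.\<close>

lemma unit_avg_foldr_partial_le:
  fixes h G :: "real ^ 'n::finite \<Rightarrow> real"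
  assumes N: "CARD('n) \<ge> 2" and h: "h \<in> harmonic_space"
  shows "G \<in> hom_harmonic d \<Longrightarrow> ladder_prod (real CARD('n)) d * (unit_avg (\<lambda>x. foldr partial_deriv L h x * G x))\<^sup>2
    \<le> ladder_prod (real CARD('n)) (d + length L) * (unit_avg (\<lambda>x. (h x)\<^sup>2) * unit_avg (\<lambda>x. (G x)\<^sup>2))"
proof (induction L arbitrary: d G)
  case Nil
  have "0 \<le> ladder_prod (real CARD('n)) d" using ladder_prod_pos[of "real CARD('n)" d] N by simp
  then show ?case
    using unit_avg_Cauchy_Schwarz[OF harmonic_spaceD(2)[OF h] harmonic_spaceD(2)[OF hom_harmonicD(1)[OF Nil]]]
    by (simp add: mult_left_mono)
next
  case (Cons i L)
  let ?N = "real CARD('n)"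
  let ?v = "foldr partial_deriv L h" and ?A = "raise i d G" and ?m = "2 * real d + 2 + ?N"
  have N2: "?N \<ge> 2" using N by simp
  have bp: "ladder_factor ?N d > 0" using ladder_factor_ge_1[OF N2, of d] by simp
  have qp: "ladder_prod ?N n > 0" for n by (rule ladder_prod_pos[OF N2])
  have m: "?m > 0" using N2 by simp
  have "unit_avg (\<lambda>x. partial_deriv i ?v x * G x) = ?m * unit_avg (\<lambda>x. ?v x * ?A x)"
    by (rule unit_avg_partial[OF harmonic_foldr_partial[OF h] Cons.prems])
  then have "ladder_factor ?N d * (ladder_prod ?N d * (unit_avg (\<lambda>x. foldr partial_deriv (i # L) h x * G x))\<^sup>2)
      = ?m * (ladder_prod ?N (Suc d) * (unit_avg (\<lambda>x. ?v x * ?A x))\<^sup>2)"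
    by (simp add: power_mult_distrib power2_eq_square mult_ac)
  also have "\<dots> \<le> ?m * (ladder_prod ?N (Suc d + length L) * (unit_avg (\<lambda>x. (h x)\<^sup>2) * unit_avg (\<lambda>x. (?A x)\<^sup>2)))"
    using m by (intro mult_left_mono Cons.IH raise_hom_harmonic Cons.prems) auto
  also have "\<dots> = (ladder_prod ?N (Suc d + length L) * unit_avg (\<lambda>x. (h x)\<^sup>2)) * (?m * unit_avg (\<lambda>x. (?A x)\<^sup>2))"
    by (simp add: mult_ac)
  also have "\<dots> \<le> (ladder_prod ?N (Suc d + length L) * unit_avg (\<lambda>x. (h x)\<^sup>2)) * (ladder_factor ?N d * unit_avg (\<lambda>x. (G x)\<^sup>2))"
    using qp[of "Suc d + length L"] by (intro mult_left_mono raise_norm_le[OF N Cons.prems] mult_nonneg_nonneg unit_avg_nonneg) auto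
  also have "\<dots> = ladder_factor ?N d * (ladder_prod ?N (d + length (i # L)) * (unit_avg (\<lambda>x. (h x)\<^sup>2) * unit_avg (\<lambda>x. (G x)\<^sup>2)))"
    by (simp add: mult_ac)
  finally show ?case using bp by (simp only: mult_le_cancel_left_pos)
qed

text \<open>Pairing with \<open>G = 1\<close> evaluates the derivative at the centre, by the mean
  value property of the differentiated function; translation and dilation give general
  \<open>a\<close> and \<open>R\<close>.\<close>

lemma foldr_partial_le:
  fixes h :: "real ^ 'n::finite \<Rightarrow> real"
  assumes N: "CARD('n) \<ge> 2" and h: "h \<in> harmonic_space"
  shows "(R ^ length L * foldr partial_deriv L h a)\<^sup>2
    \<le> ladder_prod (real CARD('n)) (length L) * unit_avg (\<lambda>y. (h (a + R *\<^sub>R y))\<^sup>2)"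
proof -
  let ?h = "\<lambda>y. h (a + R *\<^sub>R y)"
  have "unit_avg (\<lambda>x. foldr partial_deriv L ?h x * 1) = foldr partial_deriv L ?h 0"
    using mean_value[OF harmonic_foldr_partial[OF harmonic_affine[OF h]], of L a R 0] by simp
  also have "\<dots> = R ^ length L * foldr partial_deriv L h a"
    by (simp add: foldr_partial_affine[OF h])
  finally show ?thesis
    using unit_avg_foldr_partial_le[OF N harmonic_affine[OF h, of a R] hom_harmonic_one, of L] by simp
qed

subsection \<open>Locally uniform limits\<close>

lemma harmonic_limit_continuous:
  fixes f :: "nat \<Rightarrow> real ^ 'n::finite \<Rightarrow> real"
  assumes h: "\<And>n. f n \<in> harmonic_space" and l: "\<And>r. uniform_limit (cball 0 r) f g sequentially"
  shows "continuous_on UNIV g"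
proof -
  have "isCont g x" for x
  proof -
    have "continuous_on (cball 0 (norm x + 1)) g"
      by (rule uniform_limit_theorem[OF _ l]) (auto intro!: always_eventually continuous_on_subset[OF harmonic_spaceD(2)[OF h]])
    moreover have "x \<in> interior (cball 0 (norm x + 1))" by (simp add: interior_cball)
    ultimately show ?thesis using continuous_on_interior by blast
  qed
  then show ?thesis by (simp add: continuous_on_eq_continuous_at)
qed

text \<open>The formula of \<open>harmonic_partial_deriv_eq\<close> contains no derivative on its
  right-hand side, so applied to \<open>g\<close> it defines the candidate \<open>g'\<close> and
  shows that the derivatives converge uniformly; differentiability of \<open>g\<close> follows from
  that.\<close>

lemma harmonic_limit_partial:
  fixes f :: "nat \<Rightarrow> real ^ 'n::finite \<Rightarrow> real"
  assumes h: "\<And>n. f n \<in> harmonic_space" and l: "\<And>r. uniform_limit (cball 0 r) f g sequentially"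
  obtains g' where "has_pd i g g'" "\<And>r. uniform_limit (cball 0 r) (\<lambda>n. partial_deriv i (f n)) g' sequentially"
proof -
  let ?c = "real CARD('n) + 2"
  note hD = harmonic_spaceD[OF h]
  have cont_g: "continuous_on UNIV g" by (rule harmonic_limit_continuous[OF h l])
  define g' where "g' x = ?c * unit_avg (\<lambda>y. y $ i * g (x + y))" for x
  have cx: "continuous_on UNIV (\<lambda>y. y $ i * u (x + y))" if "continuous_on UNIV u" for u :: "real ^ 'n \<Rightarrow> real" and x
    by (intro continuous_intros continuous_on_compose2[OF that]) auto
  have ul: "uniform_limit (cball 0 r) (\<lambda>n. partial_deriv i (f n)) g' sequentially" for r
  proof (rule uniform_limitI)
    fix e :: real assume "e > 0"
    then have e: "e / (2 * ?c) > 0" by simp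
    \<comment> \<open>The formula at a point of \<open>cball 0 r\<close> samples the unit ball
      around it, hence the radius \<open>r + 1\<close>.\<close>
    from uniform_limitD[OF l[of "r + 1"] e]
    show "\<forall>\<^sub>F n in sequentially. \<forall>x\<in>cball 0 r. dist (partial_deriv i (f n) x) (g' x) < e"
    proof eventually_elim
      case (elim n)
      show ?case
      proof
        fix x :: "real ^ 'n" assume x: "x \<in> cball 0 r"
        have "\<bar>unit_avg (\<lambda>y. y $ i * f n (x + y) - y $ i * g (x + y))\<bar> \<le> e / (2 * ?c)"
        proof (rule unit_avg_abs_le)
          show "continuous_on UNIV (\<lambda>y. y $ i * f n (x + y) - y $ i * g (x + y))"
            by (intro continuous_on_diff cx hD(2) cont_g)
          fix y :: "real ^ 'n" assume y: "norm y \<le> 1"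
          have "x + y \<in> cball 0 (r + 1)" unfolding mem_cball_0 using x y norm_triangle_ineq[of x y] by simp
          then have "\<bar>f n (x + y) - g (x + y)\<bar> < e / (2 * ?c)"
            using elim unfolding dist_real_def by blast
          moreover have "\<bar>y $ i\<bar> \<le> 1" using component_le_norm_cart[of y i] y by linarith
          ultimately have "\<bar>y $ i\<bar> * \<bar>f n (x + y) - g (x + y)\<bar> \<le> 1 * (e / (2 * ?c))"
            by (intro mult_mono) auto
          then show "\<bar>y $ i * f n (x + y) - y $ i * g (x + y)\<bar> \<le> e / (2 * ?c)"
            by (simp add: abs_mult flip: right_diff_distrib)
        qed
        moreover have "partial_deriv i (f n) x - g' x = ?c * unit_avg (\<lambda>y. y $ i * f n (x + y) - y $ i * g (x + y))"
          unfolding g'_def harmonic_partial_deriv_eq[OF h]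
          by (subst unit_avg_diff) (auto intro!: cx hD(2) cont_g simp: right_diff_distrib)
        ultimately have "\<bar>partial_deriv i (f n) x - g' x\<bar> \<le> ?c * (e / (2 * ?c))"
          by (simp only: abs_mult) (intro mult_mono, auto)
        also have "\<dots> = e / 2"
        proof -
          have "c * (e / (2 * c)) = e / 2" if "c > 0" for c using that by simp
          from this[of ?c] show ?thesis by simp
        qed
        also have "\<dots> < e" using \<open>e > 0\<close> by simp
        finally show "dist (partial_deriv i (f n) x) (g' x) < e" by (simp add: dist_norm)
      qed
    qed
  qed
  have "has_pd i g g'"
    unfolding has_pd_def
  proof
    fix x :: "real ^ 'n"
    let ?p = "\<lambda>t. x + t *\<^sub>R axis i 1 :: real ^ 'n"
    define S where "S = {-1<..<1::real}"
    have S: "norm (?p t) \<le> norm x + 1" if "t \<in> S" for t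
      using that norm_triangle_ineq[of x "t *\<^sub>R axis i 1"] by (simp add: S_def abs_if split: if_splits)
    have "\<exists>G. \<forall>t\<in>S. (\<lambda>n. f n (?p t)) \<longlonglongrightarrow> G t \<and> (G has_derivative (\<lambda>h. g' (?p t) * h)) (at t within S)"
    proof (rule has_derivative_sequence)
      show "convex S" "0 \<in> S" by (auto simp: S_def)
      show "((\<lambda>t. f n (?p t)) has_derivative (\<lambda>h. partial_deriv i (f n) (?p t) * h)) (at t within S)" for n t
        using has_pd_line[OF hD(5), of n x i t] unfolding has_field_derivative_def
        by (rule has_derivative_at_withinI)
      show "(\<lambda>n. f n (?p 0)) \<longlonglongrightarrow> g (?p 0)"
        using tendsto_uniform_limitI[OF l[of "norm x"], of x] by simp
      fix e :: real assume "e > 0"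
      from uniform_limitD[OF ul[of "norm x + 1"] this]
      show "\<forall>\<^sub>F n in sequentially. \<forall>t\<in>S. \<forall>h. norm (partial_deriv i (f n) (?p t) * h - g' (?p t) * h) \<le> e * norm h"
      proof eventually_elim
        case (elim n)
        have "\<bar>partial_deriv i (f n) (?p t) - g' (?p t)\<bar> * \<bar>h\<bar> \<le> e * \<bar>h\<bar>" if "t \<in> S" for t h
        proof (rule mult_right_mono)
          have "?p t \<in> cball 0 (norm x + 1)" using S[OF that] unfolding mem_cball_0 .
          then show "\<bar>partial_deriv i (f n) (?p t) - g' (?p t)\<bar> \<le> e"
            using elim unfolding dist_real_def by (blast intro: less_imp_le)
        qed simp
        then show ?case by (simp add: abs_mult flip: left_diff_distrib)
      qed
    qed
    then obtain G where G: "\<And>t. t \<in> S \<Longrightarrow> (\<lambda>n. f n (?p t)) \<longlonglongrightarrow> G t"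
      "\<And>t. t \<in> S \<Longrightarrow> (G has_derivative (\<lambda>h. g' (?p t) * h)) (at t within S)" by blast
    have eq: "G t = g (?p t)" if "t \<in> S" for t
      using LIMSEQ_unique[OF G(1)[OF that] tendsto_uniform_limitI[OF l[of "norm x + 1"]]] S[OF that] by simp
    have S0: "open S" "0 \<in> S" by (auto simp: S_def)
    have "(G has_field_derivative g' x) (at 0)"
      using G(2)[OF S0(2)] unfolding has_field_derivative_def at_within_open[OF S0(2,1)] by simp
    from has_field_derivative_transform_within_open[OF this S0 eq]
    show "((\<lambda>t. g (?p t)) has_field_derivative g' x) (at 0)" .
  qed
  then show ?thesis using ul that by blast
qed

text \<open>The partial derivatives of the sequence are again harmonic and converge locally
  uniformly, so the same argument applies to them once more; the Laplace equation then passes to the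
  limit pointwise.\<close>

lemma harmonic_limit:
  fixes f :: "nat \<Rightarrow> real ^ 'n::finite \<Rightarrow> real"
  assumes h: "\<And>n. f n \<in> harmonic_space" and l: "\<And>r. uniform_limit (cball 0 r) f g sequentially"
  shows "g \<in> harmonic_space"
    and "\<And>r. uniform_limit (cball 0 r) (\<lambda>n. partial_deriv i (f n)) (partial_deriv i g) sequentially"
proof -
  have lim: "has_pd i g (partial_deriv i g) \<and>
      (\<forall>r. uniform_limit (cball 0 r) (\<lambda>n. partial_deriv i (f n)) (partial_deriv i g) sequentially)"
    if h: "\<And>n. f n \<in> harmonic_space" and l: "\<And>r. uniform_limit (cball 0 r) f g sequentially"
    for f and g :: "real ^ 'n \<Rightarrow> real" and i
  proof -
    obtain g' where "has_pd i g g'" "\<And>r. uniform_limit (cball 0 r) (\<lambda>n. partial_deriv i (f n)) g' sequentially"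
      using harmonic_limit_partial[OF h l] by blast
    moreover from has_pd_imp(1)[OF this(1)] have "partial_deriv i g = g'" .
    ultimately show ?thesis by simp
  qed
  note 1 = lim[OF h l] and c1 = harmonic_limit_continuous[OF h l]
  have h1: "partial_deriv i (f n) \<in> harmonic_space" for n i by (rule harmonic_partial_deriv[OF h])
  have l1: "uniform_limit (cball 0 r) (\<lambda>n. partial_deriv i (f n)) (partial_deriv i g) sequentially" for i r
    using 1 by blast
  note 2 = lim[OF h1 l1] and c2 = harmonic_limit_continuous[OF h1 l1]
  have h2: "partial_deriv j (partial_deriv i (f n)) \<in> harmonic_space" for n i j by (rule harmonic_partial_deriv[OF h1])
  have l2: "uniform_limit (cball 0 r) (\<lambda>n. partial_deriv j (partial_deriv i (f n))) (partial_deriv j (partial_deriv i g)) sequentially" for i j r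
    using 2 by blast
  note c3 = harmonic_limit_continuous[OF h2 l2]
  show "uniform_limit (cball 0 r) (\<lambda>n. partial_deriv i (f n)) (partial_deriv i g) sequentially" for r by (rule l1)
  show "g \<in> harmonic_space"
  proof (rule harmonic_spaceI)
    show "has_pd i g (partial_deriv i g)" for i using 1 by blast
    show "has_pd i (partial_deriv i g) (partial_deriv i (partial_deriv i g))" for i using 2 by blast
    show "cont_diff 2 g"
      unfolding numeral_2_eq_2
      by (rule cont_diff_SucI[OF c1 conjunct1[OF 1]], rule cont_diff_SucI[OF c2 conjunct1[OF 2]]) (simp add: c3)
    fix x :: "real ^ 'n"
    have "(\<lambda>n. \<Sum>i\<in>UNIV. partial_deriv i (partial_deriv i (f n)) x) \<longlonglongrightarrow> (\<Sum>i\<in>UNIV. partial_deriv i (partial_deriv i g) x)"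
      by (intro tendsto_sum tendsto_uniform_limitI[OF l2[where r = "norm x"]]) simp
    then show "(\<Sum>i\<in>UNIV. partial_deriv i (partial_deriv i g) x) = 0"
      by (simp add: harmonic_spaceD(7)[OF h] LIMSEQ_const_iff)
  qed
qed


subsection \<open>Asymptotics of the norm constants\<close>

text \<open>Solution of the recursion. Degree 0 is left out: for \<open>N = 2\<close> the fraction
  would be 0 / 0, which is 0 instead of 1.\<close>

lemma ladder_factor_eq:
  assumes "N \<ge> 2" "d \<ge> 1"
  shows "ladder_factor N d = (real d + 1) * (real d + N - 2) / (2 * real d + N - 2)"
  using \<open>d \<ge> 1\<close>
proof (induction d rule: nat_induct_at_least)
  case base
  show ?case using assms(1) by (simp add: field_simps)
next
  case (Suc d)
  have s: "2 * real d + N - 2 \<noteq> 0" "2 * real d + N \<noteq> 0" using assms(1) Suc.hyps by auto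
  have "ladder_factor N (Suc d) = 1 + (2 * real d + N - 2) / (2 * real d + N) * ladder_factor N d" by simp
  also have "\<dots> = 1 + (real d + 1) * (real d + N - 2) / (2 * real d + N)"
    unfolding Suc.IH using s by simp
  also have "\<dots> = ((2 * real d + N) + (real d + 1) * (real d + N - 2)) / (2 * real d + N)"
    using s by (simp add: add_divide_distrib)
  also have "(2 * real d + N) + (real d + 1) * (real d + N - 2) = (real (Suc d) + 1) * (real (Suc d) + N - 2)"
    by (simp add: algebra_simps)
  also have "2 * real d + N = 2 * real (Suc d) + N - 2" by simp
  finally show ?case .
qed

lemma ln_one_plus_c_over_n_bigo:
  fixes c :: real
  shows "(\<lambda>n. ln (1 + c / real n) - c / real n) \<in> O(\<lambda>n. 1 / real n ^ 2)"
proof -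
  consider "c = 0" | "c > 0" | "c < 0" by linarith
  then show ?thesis
  proof cases
    case 2 then show ?thesis by real_asymp
  next
    case 3 then show ?thesis by real_asymp
  qed simp
qed

text \<open>The terms of order \<open>1 / n\<close> cancel:
  \<open>(N + 2) / 2 + (N - 2) - (N - 2) / 2\<close> equals the \<open>N\<close> coming from the
  exponent, while \<open>(2 * n + 1) * ln (1 + 1 / n) - 2\<close> is already of order
  \<open>1 / n^2\<close>. This cancellation singles out the exponent \<open>2 n + N\<close>.\<close>

lemma ladder_prod_step_bigo:
  assumes N: "N \<ge> 2"
  shows "(\<lambda>n. ln (1 + (N + 2) / 2 / real n) + ln (1 + (N - 2) / real n) - ln (1 + (N - 2) / 2 / real n)
       - (2 * real n + 1 + N) * ln (1 + 1 / real n) + 2) \<in> O(\<lambda>n. 1 / real n ^ 2)" (is "?f \<in> _")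
proof -
  have b: "(\<lambda>n. (2 * real n + 1) * ln (1 + 1 / real n) - 2) \<in> O(\<lambda>n. 1 / real n ^ 2)"
    by real_asymp
  have "(\<lambda>n. (ln (1 + (N + 2) / 2 / real n) - (N + 2) / 2 / real n) + (ln (1 + (N - 2) / real n) - (N - 2) / real n)
      - (ln (1 + (N - 2) / 2 / real n) - (N - 2) / 2 / real n) - ((2 * real n + 1) * ln (1 + 1 / real n) - 2)
      - N * (ln (1 + 1 / real n) - 1 / real n)) \<in> O(\<lambda>n. 1 / real n ^ 2)" (is "?g \<in> _")
    by (intro sum_in_bigo b landau_o.big.cmult_in_iff[THEN iffD2] ln_one_plus_c_over_n_bigo) (use N in auto)
  also have "?g = ?f"
    by (auto simp: fun_eq_iff algebra_simps add_divide_distrib diff_divide_distrib)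
  finally show ?thesis .
qed

text \<open>\<open>z\<close> is the logarithm of the quotient of \<open>ladder_prod\<close> by its
  claimed order, taken at \<open>Suc n\<close> to keep away from \<open>ln 0\<close>. Its increments
  are summable, so it stays bounded, and exponentiating gives both constants.\<close>

lemma ladder_prod_asymp:
  assumes N: "N \<ge> 2"
  obtains c1 c2 where "c1 > 0" "\<And>n. n \<ge> 1 \<Longrightarrow> c1 * real n powr (2 * real n + N) * exp (- 2 * real n) \<le> ladder_prod N n"
    "\<And>n. n \<ge> 1 \<Longrightarrow> ladder_prod N n \<le> c2 * real n powr (2 * real n + N) * exp (- 2 * real n)"
proof -
  define z where "z n = ln (ladder_prod N (Suc n)) - (2 * real (Suc n) + N) * ln (real (Suc n)) + 2 * real (Suc n)" for n
  define f where "f n = ln (1 + (N + 2) / 2 / real n) + ln (1 + (N - 2) / real n) - ln (1 + (N - 2) / 2 / real n)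
       - (2 * real n + 1 + N) * ln (1 + 1 / real n) + 2" for n
  have step: "z (Suc n) - z n = f (Suc n)" for n
  proof -
    define m where "m = real (Suc n)"
    have m: "m > 0" by (simp add: m_def)
    have p: "ladder_factor N (Suc n) > 0" using ladder_factor_ge_1[OF N, of "Suc n"] by simp
    have b: "ladder_factor N (Suc n) = (m + 1) * (m + N - 2) / (2 * m + N - 2)"
      using ladder_factor_eq[OF N, of "Suc n"] by (simp add: m_def)
    have lnb: "ln (ladder_factor N (Suc n)) = ln (m + 1) + ln (m + N - 2) - ln (2 * m + N - 2)"
      unfolding b using m N by (simp add: ln_div ln_mult)
    have e: "1 + (N + 2) / 2 / m = (2 * m + 2 + N) / (2 * m)" "1 + (N - 2) / m = (m + N - 2) / m"
      "1 + (N - 2) / 2 / m = (2 * m + N - 2) / (2 * m)" "1 + 1 / m = (m + 1) / m"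
      using m by (auto simp: field_simps)
    have l: "ln (1 + (N + 2) / 2 / m) = ln (2 * m + 2 + N) - ln 2 - ln m"
      "ln (1 + (N - 2) / m) = ln (m + N - 2) - ln m"
      "ln (1 + (N - 2) / 2 / m) = ln (2 * m + N - 2) - ln 2 - ln m"
      "ln (1 + 1 / m) = ln (m + 1) - ln m"
      unfolding e using m N by (simp_all add: ln_div ln_mult)
    have "ln (ladder_prod N (Suc (Suc n))) = ln (ladder_prod N (Suc n)) + (ln (2 * m + 2 + N) + ln (ladder_factor N (Suc n)))"
      using ladder_prod_pos[OF N, of "Suc n"] p m N
      by (subst ladder_prod.simps(2)) (simp add: ln_mult m_def del: ladder_prod.simps ladder_factor.simps)
    then have "z (Suc n) - z n = ln (2 * m + 2 + N) + ln (ladder_factor N (Suc n)) - (2 * (m + 1) + N) * ln (m + 1)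
        + (2 * m + N) * ln m + 2"
      by (simp add: z_def m_def algebra_simps del: ladder_prod.simps ladder_factor.simps)
    also have "\<dots> = f (Suc n)"
      unfolding f_def m_def[symmetric] l lnb by (simp add: algebra_simps)
    finally show ?thesis .
  qed
  have fO: "f \<in> O(\<lambda>n. 1 / real n ^ 2)"
    using ladder_prod_step_bigo[OF N] by (simp add: f_def[abs_def])
  have sq: "summable (\<lambda>n. norm (1 / real n ^ 2))"
    using inverse_power_summable[of 2, where 'a = real] by (simp add: inverse_eq_divide)
  have "summable f" by (rule summable_comparison_test_bigo[OF sq fO])
  then have "summable (\<lambda>n. z (Suc n) - z n)" unfolding step by (simp only: summable_Suc_iff)
  then have "convergent (\<lambda>n. \<Sum>k<n. z (Suc k) - z k)" by (simp add: summable_iff_convergent)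
  then have "convergent (\<lambda>n. z n - z 0)" by (simp add: sum_lessThan_telescope)
  then have "Bseq (\<lambda>n. z n - z 0)" by (rule convergent_imp_Bseq)
  then obtain K where K: "\<And>n. \<bar>z n - z 0\<bar> \<le> K" by (auto simp: Bseq_def)
  have q: "ladder_prod N n = exp (z (n - 1)) * real n powr (2 * real n + N) * exp (- 2 * real n)" if n: "n \<ge> 1" for n
  proof -
    obtain m where m: "n = Suc m" using n by (cases n) auto
    have "ladder_prod N n = exp (ln (ladder_prod N n))" using ladder_prod_pos[OF N, of n] by simp
    also have "ln (ladder_prod N n) = z (n - 1) + (2 * real n + N) * ln (real n) + (- 2 * real n)"
      by (simp add: z_def m del: ladder_prod.simps)
    also have "exp \<dots> = exp (z (n - 1)) * real n powr (2 * real n + N) * exp (- 2 * real n)"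
      unfolding exp_add powr_def using n by simp
    finally show ?thesis .
  qed
  show ?thesis
  proof (rule that[of "exp (z 0 - K)" "exp (z 0 + K)"])
    fix n :: nat assume n: "n \<ge> 1"
    show "exp (z 0 - K) * real n powr (2 * real n + N) * exp (- 2 * real n) \<le> ladder_prod N n"
      unfolding q[OF n] using K[of "n - 1"] by (intro mult_right_mono) auto
    show "ladder_prod N n \<le> exp (z 0 + K) * real n powr (2 * real n + N) * exp (- 2 * real n)"
      unfolding q[OF n] using K[of "n - 1"] by (intro mult_right_mono) auto
  qed simp
qed

text \<open>Every factor is at least \<open>(n + 1)^2\<close>. This crude bound supplies factorial
  decay for the convergence of series and for bounded radii, where the sharp order is not at
  issue.\<close>

lemma ladder_prod_ge_fact:
  assumes N: "N \<ge> 2"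
  shows "ladder_prod N n \<ge> (fact n)\<^sup>2"
proof (induction n)
  case (Suc n)
  have "(real n + 1)\<^sup>2 \<le> (2 * real n + 2 + N) * ladder_factor N n"
  proof (cases "n = 0")
    case False
    then have n: "real n \<ge> 1" by simp
    define m where "m = 2 * real n + N - 2"
    have m: "m > 0" using n N by (simp add: m_def)
    have "(real n + 1) / 2 \<le> ladder_factor N n"
    proof -
      define A where "A = (real n + 1) * (real n + N - 2)"
      have "(real n + 1) * m \<le> 2 * A"
        unfolding A_def using n N by (simp add: m_def algebra_simps) (use mult_right_mono[of 2 N "real n + 1"] in \<open>simp add: algebra_simps\<close>)
      moreover have "ladder_factor N n = A / m" using ladder_factor_eq[OF N, of n] False by (simp add: A_def m_def)
      ultimately have "m * (real n + 1) \<le> m * (2 * ladder_factor N n)" using m by (simp add: mult_ac)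
      then show ?thesis using m by (simp add: mult_le_cancel_left_pos)
    qed
    have "(real n + 1)\<^sup>2 = (2 * real n + 2) * ((real n + 1) / 2)"
      by (simp add: power2_eq_square field_simps)
    also have "\<dots> \<le> (2 * real n + 2 + N) * ladder_factor N n"
      using N \<open>(real n + 1) / 2 \<le> ladder_factor N n\<close> by (intro mult_mono) auto
    finally show ?thesis .
  qed (use N in simp)
  then have "(fact n)\<^sup>2 * (real n + 1)\<^sup>2 \<le> ladder_prod N n * ((2 * real n + 2 + N) * ladder_factor N n)"
    using Suc.IH ladder_prod_pos[OF N, of n] by (intro mult_mono) auto
  then show ?case by (simp add: power_mult_distrib add.commute mult.commute)
qed simp

subsection \<open>Polar coordinates\<close>

lemma ball_sets_borel [measurable]: "ball (a :: 'a::metric_space) R \<in> sets borel"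
  by (intro borel_open open_ball)

lemma sphere_sets_borel [measurable]: "sphere (a :: 'a::euclidean_space) R \<in> sets borel"
  by (intro borel_closed closed_sphere)

lemma nn_integral_lborel_scale:
  fixes f :: "'a::euclidean_space \<Rightarrow> ennreal" and a :: 'a
  assumes [measurable]: "f \<in> borel_measurable borel" and c: "c > 0"
  shows "(\<integral>\<^sup>+x. f x \<partial>lborel) = ennreal (c ^ DIM('a)) * (\<integral>\<^sup>+y. f (a + c *\<^sub>R y) \<partial>lborel)"
  using c by (subst lborel_affine[of c a]) (auto simp: nn_integral_density nn_integral_distr nn_integral_cmult)

text \<open>With \<open>a = norm x\<close> and \<open>x = s y\<close>, the volume factor
  \<open>s^N\<close> turns this density into \<open>N (norm y)^N s^(N - 1)\<close>, which already
  contains the radial power of polar coordinates.\<close>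

lemma nn_integral_radial_kernel:
  fixes a :: real
  assumes a: "a > 0" and N: "N \<ge> 1"
  shows "(\<integral>\<^sup>+s. ennreal (if a < s then real N * a ^ N / s ^ (N + 1) else 0) \<partial>lborel) = 1"
proof -
  have "(\<integral>\<^sup>+s. ennreal (if a < s then real N * a ^ N / s ^ (N + 1) else 0) \<partial>lborel)
      = (\<integral>\<^sup>+s. ennreal (real N * a ^ N / s ^ (N + 1)) * indicator {a..} s \<partial>lborel)"
    using AE_lborel_singleton[of a] by (intro nn_integral_cong_AE) (auto simp: indicator_def)
  also have "\<dots> = ennreal (0 - (- (a ^ N / a ^ N)))"
  proof (rule nn_integral_FTC_atLeast[where F = "\<lambda>s. - (a ^ N / s ^ N)" and a = a])
    show "(\<lambda>s. real N * a ^ N / s ^ (N + 1)) \<in> borel_measurable borel" by measurable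
    show "((\<lambda>s. - (a ^ N / s ^ N)) has_real_derivative real N * a ^ N / s ^ (N + 1)) (at s)" if "a \<le> s" for s
    proof -
      have s: "s > 0" using a that by simp
      have "((\<lambda>s. - (a ^ N / s ^ N)) has_real_derivative a ^ N * (real N * s ^ (N - 1)) / (s ^ N * s ^ N)) (at s)"
        using s by (auto intro!: derivative_eq_intros)
      also have "a ^ N * (real N * s ^ (N - 1)) / (s ^ N * s ^ N) = real N * a ^ N / s ^ (N + 1)"
        using s N by (cases N) (auto simp: field_simps)
      finally show ?thesis .
    qed
    show "0 \<le> real N * a ^ N / s ^ (N + 1)" if "a \<le> s" for s using a that by simp
    have "((\<lambda>s. - (a ^ N / s ^ N)) \<longlongrightarrow> - 0) at_top"
      using N by (intro tendsto_minus tendsto_divide_0[OF tendsto_const] filterlim_at_top_imp_at_infinity filterlim_pow_at_top filterlim_ident) auto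
    then show "((\<lambda>s. - (a ^ N / s ^ N)) \<longlongrightarrow> 0) at_top" by simp
  qed
  also have "\<dots> = 1" using a by simp
  finally show ?thesis .
qed

text \<open>Polar coordinates by Fubini and scaling only: insert the kernel of
  \<open>nn_integral_radial_kernel\<close>, substitute \<open>x = s y\<close>, and then \<open>r = s \<bar>y\<bar>\<close>.\<close>

lemma nn_integral_polar:
  fixes f :: "real ^ 'n::finite \<Rightarrow> ennreal"
  assumes [measurable]: "f \<in> borel_measurable borel"
  shows "(\<integral>\<^sup>+x. f x * indicator (ball 0 R) x \<partial>lborel) =
    (\<integral>\<^sup>+r. ennreal (real CARD('n) * r ^ (CARD('n) - 1)) * indicator {0<..<R} r *
       (\<integral>\<^sup>+y. f ((r / norm y) *\<^sub>R y) * indicator (ball 0 1) y \<partial>lborel) \<partial>lborel)"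
proof -
  let ?N = "CARD('n)"
  have N: "?N \<ge> 1" by (simp add: Suc_leI)
  have [simp]: "DIM(real ^ 'n) = ?N" by simp
  define w where "w s x = ennreal (if norm x < s then real ?N * norm x ^ ?N / s ^ (?N + 1) else 0)"
    for s and x :: "real ^ 'n"
  have ind: "indicator (ball 0 R) x = (if norm x < R then 1 else 0 :: ennreal)" for x :: "real ^ 'n" and R
    by (auto simp: indicator_def)
  have wm [measurable]: "(\<lambda>(x, s). w s x) \<in> borel_measurable (lborel \<Otimes>\<^sub>M lborel)"
    unfolding w_def by measurable
  have wm2 [measurable]: "w s \<in> borel_measurable borel" for s
    unfolding w_def[abs_def] by measurable
  have AE0: "AE x in lborel. (x :: real ^ 'n) \<noteq> 0" by (rule AE_lborel_singleton)
  \<comment> \<open>The integrand after \<open>x = s y\<close>, volume factor included; the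
    condition \<open>norm x < s\<close> has become \<open>norm y < 1\<close>.\<close>
  define F where "F s y = (if norm y < 1 \<and> s > 0 \<and> s * norm y < R
      then ennreal (real ?N * norm y ^ ?N * s ^ (?N - 1)) * f (s *\<^sub>R y) else 0)" for s y
  have Fm [measurable]: "(\<lambda>(s, y). F s y) \<in> borel_measurable (lborel \<Otimes>\<^sub>M lborel)"
    unfolding F_def by measurable
  have "(\<integral>\<^sup>+x. f x * indicator (ball 0 R) x \<partial>lborel) = (\<integral>\<^sup>+x. (\<integral>\<^sup>+s. (f x * (if norm x < R then 1 else 0)) * w s x \<partial>lborel) \<partial>lborel)"
  proof (rule nn_integral_cong_AE, use AE0 in eventually_elim)
    case (elim x)
    have "(\<integral>\<^sup>+s. (f x * (if norm x < R then 1 else 0)) * w s x \<partial>lborel) = (f x * (if norm x < R then 1 else 0)) * (\<integral>\<^sup>+s. w s x \<partial>lborel)"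
      by (rule nn_integral_cmult) (simp add: w_def)
    also have "(\<integral>\<^sup>+s. w s x \<partial>lborel) = 1"
      unfolding w_def using elim N by (intro nn_integral_radial_kernel) auto
    finally show ?case by (simp add: ind)
  qed
  also have "\<dots> = (\<integral>\<^sup>+s. (\<integral>\<^sup>+x. (f x * (if norm x < R then 1 else 0)) * w s x \<partial>lborel) \<partial>lborel)"
    by (rule lborel_pair.Fubini') measurable
  also have "\<dots> = (\<integral>\<^sup>+s. (\<integral>\<^sup>+y. F s y \<partial>lborel) \<partial>lborel)"
  proof (rule nn_integral_cong)
    fix s :: real
    show "(\<integral>\<^sup>+x. (f x * (if norm x < R then 1 else 0)) * w s x \<partial>lborel) = (\<integral>\<^sup>+y. F s y \<partial>lborel)"
    proof (cases "s > 0")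
      case False
      have "w s x = 0" for x using False norm_ge_zero[of x] unfolding w_def by (smt (verit) ennreal_0)
      then show ?thesis using False by (simp add: F_def)
    next
      case True
      have "(\<integral>\<^sup>+x. (f x * (if norm x < R then 1 else 0)) * w s x \<partial>lborel)
          = ennreal (s ^ ?N) * (\<integral>\<^sup>+y. (f (0 + s *\<^sub>R y) * (if norm (0 + s *\<^sub>R y) < R then 1 else 0)) * w s (0 + s *\<^sub>R y) \<partial>lborel)"
        using True by (subst nn_integral_lborel_scale[of _ s 0]) auto
      also have "\<dots> = (\<integral>\<^sup>+y. ennreal (s ^ ?N) * ((f (0 + s *\<^sub>R y) * (if norm (0 + s *\<^sub>R y) < R then 1 else 0)) * w s (0 + s *\<^sub>R y)) \<partial>lborel)"
        by (rule nn_integral_cmult[symmetric]) measurable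
      also have "\<dots> = (\<integral>\<^sup>+y. F s y \<partial>lborel)"
      proof (rule nn_integral_cong)
        fix y :: "real ^ 'n"
        have "ennreal (s ^ ?N) * w s (s *\<^sub>R y) = ennreal (if norm y < 1 then real ?N * norm y ^ ?N * s ^ (?N - 1) else 0)"
        proof -
          have "s ^ ?N * (real ?N * (s * norm y) ^ ?N / s ^ (?N + 1)) = real ?N * norm y ^ ?N * s ^ (?N - 1)"
            using True N by (cases ?N) (auto simp: power_mult_distrib field_simps)
          moreover have "norm (s *\<^sub>R y) < s \<longleftrightarrow> norm y < 1" using True by simp
          ultimately show ?thesis using True by (simp add: w_def ennreal_mult'[symmetric])
        qed
        moreover have "w s (s *\<^sub>R y) = 0" if "\<not> norm y < 1"
          using that True by (simp add: w_def)
        ultimately show "ennreal (s ^ ?N) * ((f (0 + s *\<^sub>R y) * (if norm (0 + s *\<^sub>R y) < R then 1 else 0)) * w s (0 + s *\<^sub>R y)) = F s y"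
          using True by (cases "norm y < 1") (simp_all add: F_def mult_ac)
      qed
      finally show ?thesis .
    qed
  qed
  also have "\<dots> = (\<integral>\<^sup>+y. (\<integral>\<^sup>+s. F s y \<partial>lborel) \<partial>lborel)"
    by (rule lborel_pair.Fubini'[symmetric]) measurable
  also have "\<dots> = (\<integral>\<^sup>+y. (\<integral>\<^sup>+r. ennreal (real ?N * r ^ (?N - 1)) * indicator {0<..<R} r * (f ((r / norm y) *\<^sub>R y) * indicator (ball 0 1) y) \<partial>lborel) \<partial>lborel)"
  proof (rule nn_integral_cong_AE, use AE0 in eventually_elim)
    case (elim y)
    \<comment> \<open>The substitution \<open>s = r / a\<close> cancels all powers of
      \<open>a\<close>: the factor \<open>a^N\<close> against \<open>a^(N - 1)\<close> from the
      power of \<open>s\<close> and one \<open>a\<close> from the differential.\<close>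
    define a where "a = norm y"
    have a: "a > 0" using elim by (simp add: a_def)
    have "(\<integral>\<^sup>+s. F s y \<partial>lborel) = ennreal (1 / a) * (\<integral>\<^sup>+r. F (0 + (1 / a) * r) y \<partial>lborel)"
      using a nn_integral_real_affine[of "\<lambda>s. F s y" "1 / a" 0] by simp
    also have "\<dots> = (\<integral>\<^sup>+r. ennreal (1 / a) * F (0 + (1 / a) * r) y \<partial>lborel)"
      by (rule nn_integral_cmult[symmetric]) measurable
    also have "\<dots> = (\<integral>\<^sup>+r. ennreal (real ?N * r ^ (?N - 1)) * indicator {0<..<R} r * (f ((r / norm y) *\<^sub>R y) * indicator (ball 0 1) y) \<partial>lborel)"
    proof (rule nn_integral_cong)
      fix r :: real
      show "ennreal (1 / a) * F (0 + (1 / a) * r) y = ennreal (real ?N * r ^ (?N - 1)) * indicator {0<..<R} r * (f ((r / norm y) *\<^sub>R y) * indicator (ball 0 1) y)"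
      proof (cases "r > 0 \<and> r < R \<and> norm y < 1")
        case True
        have "(1 / a) * (real ?N * a ^ ?N * (r / a) ^ (?N - 1)) = real ?N * r ^ (?N - 1)"
          using a N by (cases ?N) (auto simp: power_divide)
        then have "ennreal (1 / a) * ennreal (real ?N * a ^ ?N * (r / a) ^ (?N - 1)) = ennreal (real ?N * r ^ (?N - 1))"
          using a True by (simp add: ennreal_mult'[symmetric])
        then show ?thesis using True a
          by (simp add: F_def a_def[symmetric] mult.assoc[symmetric] zero_less_divide_iff)
      next
        case False
        then show ?thesis using a by (auto simp: F_def a_def[symmetric] zero_less_divide_iff)
      qed
    qed
    finally show ?case .
  qed
  also have "\<dots> = (\<integral>\<^sup>+r. (\<integral>\<^sup>+y. ennreal (real ?N * r ^ (?N - 1)) * indicator {0<..<R} r * (f ((r / norm y) *\<^sub>R y) * indicator (ball 0 1) y) \<partial>lborel) \<partial>lborel)"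
    by (rule lborel_pair.Fubini') measurable
  also have "\<dots> = (\<integral>\<^sup>+r. ennreal (real ?N * r ^ (?N - 1)) * indicator {0<..<R} r *
       (\<integral>\<^sup>+y. f ((r / norm y) *\<^sub>R y) * indicator (ball 0 1) y \<partial>lborel) \<partial>lborel)"
    by (intro nn_integral_cong nn_integral_cmult) measurable
  finally show ?thesis .
qed

section \<open>Means over spheres and over balls\<close>

lemma M2_sq:
  fixes h :: "real ^ 'n::finite \<Rightarrow> real"
  assumes h: "continuous_on UNIV h" and r: "r > 0"
  shows "ennreal ((M2 h r)\<^sup>2) = (\<integral>\<^sup>+y. ennreal ((h ((r / norm y) *\<^sub>R y))\<^sup>2) * indicator (ball 0 1) y \<partial>lborel)
      / emeasure lborel (ball (0 :: real ^ 'n) 1)"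
    "M2 h r \<ge> 0"
proof -
  let ?U = "uniform_measure lborel (ball (0 :: real ^ 'n) 1)"
  let ?g = "\<lambda>y. (h ((r / norm y) *\<^sub>R y))\<^sup>2"
  have hm [measurable]: "h \<in> borel_measurable borel" by (rule borel_measurable_continuous_onI[OF h])
  interpret prob_space ?U by (rule prob_space_unit)
  have cm: "continuous_on UNIV (\<lambda>y. (h (r *\<^sub>R y))\<^sup>2)"
    by (intro continuous_intros continuous_on_compose2[OF h]) auto
  obtain B where B: "\<And>y. norm y \<le> 1 \<Longrightarrow> \<bar>(h (r *\<^sub>R y))\<^sup>2\<bar> \<le> B" using bounded_unit_ball[OF cm] by blast
  have "?g y \<le> B" for y
  proof -
    have "norm ((1 / norm y) *\<^sub>R y) \<le> 1" by simp
    from B[OF this] show ?thesis by simp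
  qed
  then have int: "integrable ?U ?g"
    by (intro integrable_const_bound[of _ B]) (auto cong: measurable_cong_sets)
  have AE0: "AE y in ?U. y \<noteq> 0"
    by (rule AE_uniform_measureI) (use AE_lborel_singleton[of "0 :: real ^ 'n"] in auto)
  have "(LINT x:sphere 0 r|sphere_measure r. \<bar>h x\<bar>\<^sup>2)
      = (LINT y|?U. indicat_real (sphere 0 r) ((r / norm y) *\<^sub>R y) *\<^sub>R \<bar>h ((r / norm y) *\<^sub>R y)\<bar>\<^sup>2)"
    unfolding sphere_measure_def set_lebesgue_integral_def
    by (rule integral_distr) measurable
  also have "\<dots> = (LINT y|?U. ?g y)"
  proof (rule integral_cong_AE)
    \<comment> \<open>Away from the origin the radial projection lands on the sphere, so the
      indicator is 1.\<close>
    show "AE y in ?U. indicat_real (sphere 0 r) ((r / norm y) *\<^sub>R y) *\<^sub>R \<bar>h ((r / norm y) *\<^sub>R y)\<bar>\<^sup>2 = ?g y"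
      using AE0 by eventually_elim (use r in \<open>simp add: indicator_def\<close>)
  qed measurable
  finally have e: "M2 h r = sqrt (LINT y|?U. ?g y)" by (simp add: M2_def)
  have nn: "(LINT y|?U. ?g y) \<ge> 0" by simp
  then show "M2 h r \<ge> 0" by (simp add: e)
  have "ennreal ((M2 h r)\<^sup>2) = (\<integral>\<^sup>+y. ennreal (?g y) \<partial>?U)"
    using nn by (simp add: e nn_integral_eq_integral[OF int])
  also have "\<dots> = (\<integral>\<^sup>+y. ennreal (?g y) * indicator (ball 0 1) y \<partial>lborel) / emeasure lborel (ball (0 :: real ^ 'n) 1)"
    by (rule nn_integral_uniform_measure) auto
  finally show "ennreal ((M2 h r)\<^sup>2) = (\<integral>\<^sup>+y. ennreal (?g y) * indicator (ball 0 1) y \<partial>lborel) / emeasure lborel (ball (0 :: real ^ 'n) 1)" .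
qed

lemma ball_integral_M2:
  fixes h :: "real ^ 'n::finite \<Rightarrow> real"
  assumes h: "continuous_on UNIV h"
  shows "(\<integral>\<^sup>+x. ennreal ((h x)\<^sup>2) * indicator (ball 0 R) x \<partial>lborel) =
    emeasure lborel (ball (0 :: real ^ 'n) 1) *
    (\<integral>\<^sup>+r. ennreal (real CARD('n) * r ^ (CARD('n) - 1) * (M2 h r)\<^sup>2) * indicator {0<..<R} r \<partial>lborel)"
proof -
  let ?B = "emeasure lborel (ball (0 :: real ^ 'n) 1)"
  have hm [measurable]: "h \<in> borel_measurable borel" by (rule borel_measurable_continuous_onI[OF h])
  define g where "g r = (\<integral>\<^sup>+y. ennreal ((h ((r / norm y) *\<^sub>R y))\<^sup>2) * indicator (ball 0 1) y \<partial>lborel)" for r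
  have gm [measurable]: "g \<in> borel_measurable borel" unfolding g_def by measurable
  have B: "?B \<noteq> 0" "?B \<noteq> top" using emeasure_unit_ball[where 'n = 'n] by auto
  have "(\<integral>\<^sup>+x. ennreal ((h x)\<^sup>2) * indicator (ball 0 R) x \<partial>lborel) =
    (\<integral>\<^sup>+r. ennreal (real CARD('n) * r ^ (CARD('n) - 1)) * indicator {0<..<R} r * g r \<partial>lborel)"
    unfolding g_def by (rule nn_integral_polar) measurable
  also have "\<dots> = (\<integral>\<^sup>+r. ?B * (ennreal (real CARD('n) * r ^ (CARD('n) - 1)) * indicator {0<..<R} r * (g r / ?B)) \<partial>lborel)"
  proof (rule nn_integral_cong)
    fix r
    have *: "?B * (g r / ?B) = g r"
      using B by (simp add: ennreal_times_divide ennreal_mult_divide_eq mult.commute[of ?B])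
    show "ennreal (real CARD('n) * r ^ (CARD('n) - 1)) * indicator {0<..<R} r * g r =
       ?B * (ennreal (real CARD('n) * r ^ (CARD('n) - 1)) * indicator {0<..<R} r * (g r / ?B))"
      unfolding mult.left_commute[of ?B "ennreal (real CARD('n) * r ^ (CARD('n) - 1)) * indicator {0<..<R} r"] * ..
  qed
  also have "\<dots> = ?B * (\<integral>\<^sup>+r. ennreal (real CARD('n) * r ^ (CARD('n) - 1)) * indicator {0<..<R} r * (g r / ?B) \<partial>lborel)"
    by (rule nn_integral_cmult) measurable
  also have "(\<integral>\<^sup>+r. ennreal (real CARD('n) * r ^ (CARD('n) - 1)) * indicator {0<..<R} r * (g r / ?B) \<partial>lborel)
      = (\<integral>\<^sup>+r. ennreal (real CARD('n) * r ^ (CARD('n) - 1) * (M2 h r)\<^sup>2) * indicator {0<..<R} r \<partial>lborel)"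
  proof (rule nn_integral_cong)
    fix r
    show "ennreal (real CARD('n) * r ^ (CARD('n) - 1)) * indicator {0<..<R} r * (g r / ?B) =
        ennreal (real CARD('n) * r ^ (CARD('n) - 1) * (M2 h r)\<^sup>2) * indicator {0<..<R} r"
    proof (cases "0 < r \<and> r < R")
      case True
      then have "g r / ?B = ennreal ((M2 h r)\<^sup>2)" using M2_sq(1)[OF h, of r] by (simp only: g_def)
      then show ?thesis using True by (simp only: ennreal_mult'' zero_le_power2) (simp add: mult_ac)
    qed (auto simp: indicator_def)
  qed
  finally show ?thesis .
qed

lemma unit_avg_nn:
  fixes f :: "real ^ 'n::finite \<Rightarrow> real"
  assumes f: "continuous_on UNIV f" and nn: "\<And>x. f x \<ge> 0"
  shows "ennreal (unit_avg f) = (\<integral>\<^sup>+y. ennreal (f y) * indicator (ball 0 1) y \<partial>lborel) / emeasure lborel (ball (0 :: real ^ 'n) 1)"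
proof -
  have [measurable]: "f \<in> borel_measurable borel" by (rule borel_measurable_continuous_onI[OF f])
  have "ennreal (unit_avg f) = (\<integral>\<^sup>+y. ennreal (f y) \<partial>uniform_measure lborel (ball 0 1))"
    unfolding unit_avg_def by (rule nn_integral_eq_integral[symmetric, OF integrable_unit[OF f]]) (simp add: nn)
  also have "\<dots> = (\<integral>\<^sup>+y. ennreal (f y) * indicator (ball 0 1) y \<partial>lborel) / emeasure lborel (ball (0 :: real ^ 'n) 1)"
    by (rule nn_integral_uniform_measure) auto
  finally show ?thesis .
qed

lemma unit_avg_ball:
  fixes f :: "real ^ 'n::finite \<Rightarrow> real"
  assumes f: "continuous_on UNIV f" and nn: "\<And>x. f x \<ge> 0" and R: "R > 0"
  shows "ennreal (R ^ CARD('n) * unit_avg (\<lambda>y. f (a + R *\<^sub>R y))) =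
    (\<integral>\<^sup>+x. ennreal (f x) * indicator (ball a R) x \<partial>lborel) / emeasure lborel (ball (0 :: real ^ 'n) 1)"
proof -
  have [measurable]: "f \<in> borel_measurable borel" by (rule borel_measurable_continuous_onI[OF f])
  have c: "continuous_on UNIV (\<lambda>y. f (a + R *\<^sub>R y))"
    by (intro continuous_intros continuous_on_compose2[OF f]) auto
  have i: "indicator (ball a R) (a + R *\<^sub>R y) = (indicator (ball 0 1) y :: ennreal)" for y
    using R by (auto simp: indicator_def dist_norm)
  have "(\<integral>\<^sup>+x. ennreal (f x) * indicator (ball a R) x \<partial>lborel)
      = ennreal (R ^ CARD('n)) * (\<integral>\<^sup>+y. ennreal (f (a + R *\<^sub>R y)) * indicator (ball 0 1) y \<partial>lborel)"
    using R by (subst nn_integral_lborel_scale[of _ R a]) (auto simp: i)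
  then show ?thesis
    using R by (subst ennreal_mult') (auto simp: unit_avg_nn[OF c nn] ennreal_times_divide)
qed

text \<open>Inclusion of balls and a nonnegative integrand; the powers of the radii undo the
  normalisation of the means. This is how the centre is moved.\<close>

lemma unit_avg_ball_mono:
  fixes f :: "real ^ 'n::finite \<Rightarrow> real"
  assumes f: "continuous_on UNIV f" and nn: "\<And>x. f x \<ge> 0" and R: "R > 0" "R + dist a b \<le> R'"
  shows "R ^ CARD('n) * unit_avg (\<lambda>y. f (a + R *\<^sub>R y)) \<le> R' ^ CARD('n) * unit_avg (\<lambda>y. f (b + R' *\<^sub>R y))"
proof -
  have R': "R' > 0" using R zero_le_dist[of a b] by linarith
  have "ball a R \<subseteq> ball b R'" using R(2) by (simp add: ball_subset_ball_iff add.commute)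
  then have "ennreal (R ^ CARD('n) * unit_avg (\<lambda>y. f (a + R *\<^sub>R y))) \<le> ennreal (R' ^ CARD('n) * unit_avg (\<lambda>y. f (b + R' *\<^sub>R y)))"
    unfolding unit_avg_ball[OF f nn R(1)] unit_avg_ball[OF f nn R']
    by (intro divide_right_mono_ennreal nn_integral_mono) (auto simp: indicator_def)
  then show ?thesis
    using R' by (subst (asm) ennreal_le_iff) (auto intro!: mult_nonneg_nonneg unit_avg_nonneg nn)
qed

text \<open>The powers of \<open>r\<close> in the growth condition and in the polar volume element cancel.\<close>

lemma unit_avg_growth:
  fixes h :: "real ^ 'n::finite \<Rightarrow> real"
  assumes h: "continuous_on UNIV h" and "C > 0"
    and M2: "\<And>r. r > 0 \<Longrightarrow> M2 h r \<le> C * (exp r / r powr ((real CARD('n) - 1) / 2))"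
    and R: "R > 0"
  shows "R ^ CARD('n) * unit_avg (\<lambda>y. (h (a + R *\<^sub>R y))\<^sup>2) \<le> real CARD('n) * C\<^sup>2 * exp (2 * (R + norm a))"
proof -
  let ?N = "CARD('n)" and ?B = "emeasure lborel (ball (0 :: real ^ 'n) 1)"
  define R' where "R' = R + norm a"
  define K where "K = real ?N * C\<^sup>2"
  have K: "K \<ge> 0" by (simp add: K_def)
  have R': "R' > 0" using R by (simp add: R'_def add_pos_nonneg)
  have hm [measurable]: "h \<in> borel_measurable borel" by (rule borel_measurable_continuous_onI[OF h])
  have pt: "real ?N * r ^ (?N - 1) * (M2 h r)\<^sup>2 \<le> K * exp (2 * r)" if r: "r > 0" for r
  proof -
    have "(M2 h r)\<^sup>2 \<le> (C * (exp r / r powr ((real ?N - 1) / 2)))\<^sup>2"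
      by (intro power_mono M2 r M2_sq(2) h)
    also have "\<dots> = C\<^sup>2 * (exp (2 * r) / r ^ (?N - 1))"
    proof -
      have "(r powr ((real ?N - 1) / 2))\<^sup>2 = r powr (real ?N - 1)"
        by (simp add: power2_eq_square flip: powr_add)
      also have "\<dots> = r ^ (?N - 1)"
        using r by (simp add: Suc_leI of_nat_diff flip: powr_realpow)
      finally show ?thesis by (simp add: power_mult_distrib power_divide exp_double)
    qed
    finally have "real ?N * r ^ (?N - 1) * (M2 h r)\<^sup>2 \<le> real ?N * r ^ (?N - 1) * (C\<^sup>2 * (exp (2 * r) / r ^ (?N - 1)))"
      using r by (intro mult_left_mono) auto
    also have "\<dots> = K * exp (2 * r)" using r by (simp add: K_def)
    finally show ?thesis .
  qed
  have fi: "(\<integral>\<^sup>+r. ennreal (K * exp (2 * r)) * indicator {0..R'} r \<partial>lborel) = ennreal (K * exp (2 * R') / 2 - K * exp (2 * 0) / 2)"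
    by (rule nn_integral_FTC_Icc[where F = "\<lambda>r. K * exp (2 * r) / 2"]) (use R' K in \<open>auto intro!: derivative_eq_intros\<close>)
  have "(\<integral>\<^sup>+x. ennreal ((h x)\<^sup>2) * indicator (ball 0 R') x \<partial>lborel)
      \<le> ?B * (\<integral>\<^sup>+r. ennreal (K * exp (2 * r)) * indicator {0..R'} r \<partial>lborel)"
    unfolding ball_integral_M2[OF h]
    by (intro mult_left_mono nn_integral_mono) (auto simp: indicator_def intro!: ennreal_leI pt[simplified])
  also have "\<dots> \<le> ?B * ennreal (K * exp (2 * R'))"
    unfolding fi using K by (intro mult_left_mono ennreal_leI) (auto simp: field_simps)
  finally have 1: "(\<integral>\<^sup>+x. ennreal ((h x)\<^sup>2) * indicator (ball 0 R') x \<partial>lborel) \<le> ?B * ennreal (K * exp (2 * R'))" .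
  have c: "continuous_on UNIV (\<lambda>y. (h y)\<^sup>2)" by (intro continuous_intros h)
  obtain b where b: "?B = ennreal b" "b > 0"
    using emeasure_unit_ball[where 'n = 'n] by (cases ?B) auto
  have "ennreal (R' ^ ?N * unit_avg (\<lambda>y. (h (0 + R' *\<^sub>R y))\<^sup>2)) \<le> ?B * ennreal (K * exp (2 * R')) / ?B"
    unfolding unit_avg_ball[OF c zero_le_power2 R'] by (intro divide_right_mono_ennreal 1)
  also have "\<dots> = ennreal (K * exp (2 * R'))"
    using b K by (simp add: ennreal_mult'[symmetric] divide_ennreal)
  finally have "R' ^ ?N * unit_avg (\<lambda>y. (h (0 + R' *\<^sub>R y))\<^sup>2) \<le> K * exp (2 * R')"
    using K by simp
  moreover have "R ^ ?N * unit_avg (\<lambda>y. (h (a + R *\<^sub>R y))\<^sup>2) \<le> R' ^ ?N * unit_avg (\<lambda>y. (h (0 + R' *\<^sub>R y))\<^sup>2)"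
    by (rule unit_avg_ball_mono[OF c zero_le_power2 R]) (simp add: R'_def)
  ultimately show ?thesis by (simp add: K_def R'_def)
qed

text \<open>Homogeneity makes the spherical mean square \<open>r^(2 j)\<close> times its value at 1;
  integrating against \<open>N r^(N - 1)\<close> over the unit interval gives the ball mean with the
  factor \<open>N / (2 j + N)\<close>.\<close>

lemma M2_hom_harmonic:
  fixes E :: "real ^ 'n::finite \<Rightarrow> real"
  assumes E: "E \<in> hom_harmonic j" and r: "r > 0"
  shows "(M2 E r)\<^sup>2 = r ^ (2 * j) * ((2 * real j + real CARD('n)) / real CARD('n)) * unit_avg (\<lambda>y. (E y)\<^sup>2)"
proof -
  let ?N = "CARD('n)" and ?B = "emeasure lborel (ball (0 :: real ^ 'n) 1)"
  have N: "?N \<ge> 1" by (simp add: Suc_leI)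
  have c: "continuous_on UNIV E" by (rule harmonic_spaceD(2)[OF hom_harmonicD(1)[OF E]])
  have cm [measurable]: "E \<in> borel_measurable borel" by (rule borel_measurable_continuous_onI[OF c])
  have c2: "continuous_on UNIV (\<lambda>y. (E y)\<^sup>2)" by (intro continuous_intros c)
  have hom: "(M2 E r)\<^sup>2 = r ^ (2 * j) * (M2 E 1)\<^sup>2" if r: "r > 0" for r
  proof -
    have "ennreal ((M2 E r)\<^sup>2) = ennreal (r ^ (2 * j)) * ennreal ((M2 E 1)\<^sup>2)"
    proof -
      have "(E ((r / norm y) *\<^sub>R y))\<^sup>2 = r ^ (2 * j) * (E ((1 / norm y) *\<^sub>R y))\<^sup>2" for y
        using hom_harmonicD(2)[OF E r, of "(1 / norm y) *\<^sub>R y"]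
        by (simp add: power_mult_distrib power_mult[symmetric] mult.commute)
      then have "(\<integral>\<^sup>+y. ennreal ((E ((r / norm y) *\<^sub>R y))\<^sup>2) * indicator (ball 0 1) y \<partial>lborel)
          = (\<integral>\<^sup>+y. ennreal (r ^ (2 * j)) * (ennreal ((E ((1 / norm y) *\<^sub>R y))\<^sup>2) * indicator (ball 0 1) y) \<partial>lborel)"
        using r by (simp add: ennreal_mult' mult.assoc)
      also have "\<dots> = ennreal (r ^ (2 * j)) * (\<integral>\<^sup>+y. ennreal ((E ((1 / norm y) *\<^sub>R y))\<^sup>2) * indicator (ball 0 1) y \<partial>lborel)"
        by (rule nn_integral_cmult) measurable
      finally show ?thesis unfolding M2_sq(1)[OF c r] M2_sq(1)[OF c zero_less_one] by (simp add: ennreal_times_divide)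
    qed
    also have "\<dots> = ennreal (r ^ (2 * j) * (M2 E 1)\<^sup>2)" using r by (simp add: ennreal_mult')
    finally show ?thesis using r by simp
  qed
  define m where "m = (M2 E 1)\<^sup>2"
  have m: "m \<ge> 0" by (simp add: m_def)
  define J where "J = 2 * j + ?N"
  have J: "J \<ge> 1" unfolding J_def using N by linarith
  obtain b where b: "?B = ennreal b" "b > 0"
    using emeasure_unit_ball[where 'n = 'n] by (cases ?B) auto
  have "ennreal (unit_avg (\<lambda>y. (E y)\<^sup>2)) = ?B * (\<integral>\<^sup>+r. ennreal (real ?N * r ^ (?N - 1) * (M2 E r)\<^sup>2) * indicator {0<..<1} r \<partial>lborel) / ?B"
    unfolding unit_avg_nn[OF c2 zero_le_power2] ball_integral_M2[OF c] ..
  also have "\<dots> = (\<integral>\<^sup>+r. ennreal (real ?N * r ^ (?N - 1) * (M2 E r)\<^sup>2) * indicator {0<..<1} r \<partial>lborel)"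
    using emeasure_unit_ball[where 'n = 'n] by (simp add: ennreal_mult_divide_eq mult.commute[of ?B])
  also have "\<dots> = (\<integral>\<^sup>+r. ennreal (real ?N * m * r ^ (J - 1)) * indicator {0..1} r \<partial>lborel)"
  proof (rule nn_integral_cong_AE, use AE_lborel_singleton[of 0] AE_lborel_singleton[of 1] in eventually_elim)
    case (elim r)
    have eq: "real ?N * r ^ (?N - 1) * (M2 E r)\<^sup>2 = real ?N * m * r ^ (J - 1)" if "r > 0"
    proof -
      have "J - 1 = 2 * j + (?N - 1)" using N unfolding J_def by linarith
      then have "r ^ (J - 1) = r ^ (2 * j) * r ^ (?N - 1)" by (simp only: power_add)
      then show ?thesis unfolding hom[OF that] m_def by (simp only: mult_ac)
    qed
    show ?case
    proof (cases "r > 0")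
      case True
      show ?thesis unfolding eq[OF True] using elim by (auto simp: indicator_def)
    qed (use elim in \<open>auto simp: indicator_def\<close>)
  qed
  also have "\<dots> = ennreal (real ?N * m * 1 ^ J / real J - real ?N * m * 0 ^ J / real J)"
    using J m by (intro nn_integral_FTC_Icc) (auto intro!: derivative_eq_intros)
  also have "\<dots> = ennreal (real ?N * m / real J)" using J by (simp add: power_0_left)
  finally have "unit_avg (\<lambda>y. (E y)\<^sup>2) = real ?N * m / real J"
    using m by (simp add: unit_avg_nonneg)
  then have "m = (real J / real ?N) * unit_avg (\<lambda>y. (E y)\<^sup>2)" using J N by simp
  then show ?thesis using hom[OF r] by (simp add: m_def J_def)
qed

subsection \<open>Boundedness of derivatives\<close>

text \<open>For a word of length \<open>J >= 1\<close>, the derivative estimate on the ball of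
  radius \<open>J\<close> compares \<open>ladder_prod\<close> times \<open>exp (2 J)\<close> with
  \<open>J^(2 J + N)\<close>, and the asymptotics bound this quotient. The result depends neither on
  the length of \<open>L\<close> nor on its directions.\<close>

lemma foldr_partial_bounded:
  fixes h :: "real ^ 'n::finite \<Rightarrow> real"
  assumes N: "CARD('n) \<ge> 2" and h: "h \<in> harmonic_space" and "C > 0"
    and M2: "\<And>r. r > 0 \<Longrightarrow> M2 h r \<le> C * (exp r / r powr ((real CARD('n) - 1) / 2))"
  shows "\<exists>K. \<forall>L x. norm x \<le> m \<longrightarrow> \<bar>foldr partial_deriv L h x\<bar> \<le> K"
proof -
  let ?N = "real CARD('n)"
  have N2: "?N \<ge> 2" using N by simp
  obtain c2 where c2: "\<And>n. n \<ge> 1 \<Longrightarrow> ladder_prod ?N n \<le> c2 * real n powr (2 * real n + ?N) * exp (- 2 * real n)"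
    using ladder_prod_asymp[OF N2] by metis
  \<comment> \<open>The value \<open>exp 2\<close> covers \<open>J = 0\<close>, where
    \<open>R = 1\<close> and the asymptotics do not apply.\<close>
  define c3 where "c3 = max c2 (exp 2)"
  have q: "ladder_prod ?N J * exp (2 * R) \<le> c3 * (R ^ (2 * J) * R ^ CARD('n))" if "R = max 1 (real J)" for J R
  proof (cases "J = 0")
    case True
    then show ?thesis using that by (simp add: c3_def)
  next
    case False
    then have R: "R = real J" "J \<ge> 1" using that by auto
    have "real J powr (2 * real J + ?N) = R ^ (2 * J) * R ^ CARD('n)"
      using R by (simp add: powr_add flip: powr_realpow)
    then have "ladder_prod ?N J * exp (2 * R) \<le> (c2 * (R ^ (2 * J) * R ^ CARD('n)) * exp (- 2 * real J)) * exp (2 * R)"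
      using c2[OF R(2)] by (intro mult_right_mono) auto
    also have "\<dots> = c2 * (R ^ (2 * J) * R ^ CARD('n))" using R by (simp add: mult.assoc flip: exp_add)
    also have "\<dots> \<le> c3 * (R ^ (2 * J) * R ^ CARD('n))" using R by (intro mult_right_mono) (auto simp: c3_def)
    finally show ?thesis .
  qed
  define K where "K = c3 * (?N * C\<^sup>2 * exp (2 * m))"
  have "\<bar>foldr partial_deriv L h x\<bar> \<le> sqrt K" if x: "norm x \<le> m" for L x
  proof -
    define J where "J = length L"
    define R where "R = max 1 (real J)"
    have R: "R > 0" by (simp add: R_def)
    define A where "A = unit_avg (\<lambda>y. (h (x + R *\<^sub>R y))\<^sup>2)"
    have "R ^ CARD('n) * A \<le> ?N * C\<^sup>2 * exp (2 * (R + norm x))"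
      unfolding A_def by (rule unit_avg_growth[OF harmonic_spaceD(2)[OF h] \<open>C > 0\<close> M2 R])
    also have "\<dots> \<le> ?N * C\<^sup>2 * exp (2 * (R + m))"
      using x by (intro mult_left_mono) auto
    also have "\<dots> = ?N * C\<^sup>2 * exp (2 * m) * exp (2 * R)" by (simp add: distrib_left exp_add)
    finally have A: "R ^ CARD('n) * A \<le> ?N * C\<^sup>2 * exp (2 * m) * exp (2 * R)" .
    have "R ^ CARD('n) * (R ^ J * foldr partial_deriv L h x)\<^sup>2 \<le> R ^ CARD('n) * (ladder_prod ?N J * A)"
      using foldr_partial_le[OF N h, of R L x] R by (intro mult_left_mono) (auto simp: J_def A_def)
    also have "\<dots> = ladder_prod ?N J * (R ^ CARD('n) * A)" by simp
    also have "\<dots> \<le> ladder_prod ?N J * (?N * C\<^sup>2 * exp (2 * m) * exp (2 * R))"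
      using ladder_prod_pos[OF N2, of J] by (intro mult_left_mono A) auto
    also have "\<dots> = (?N * C\<^sup>2 * exp (2 * m)) * (ladder_prod ?N J * exp (2 * R))" by simp
    also have "\<dots> \<le> (?N * C\<^sup>2 * exp (2 * m)) * (c3 * (R ^ (2 * J) * R ^ CARD('n)))"
      by (intro mult_left_mono q) (auto simp: R_def)
    also have "\<dots> = (R ^ (2 * J) * R ^ CARD('n)) * K" by (simp add: K_def)
    finally have "(R ^ (2 * J) * R ^ CARD('n)) * (foldr partial_deriv L h x)\<^sup>2 \<le> (R ^ (2 * J) * R ^ CARD('n)) * K"
      by (simp add: power_mult_distrib power_mult[symmetric] mult_ac)
    then have "(foldr partial_deriv L h x)\<^sup>2 \<le> K"
      using R by (simp add: mult_le_cancel_left_pos)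
    then show ?thesis by (intro real_le_rsqrt) simp
  qed
  then show ?thesis by blast
qed

lemma multi_deriv_eq_foldr:
  "multi_deriv \<alpha> f =
    foldr partial_deriv (concat (map (\<lambda>i. replicate (\<alpha> $ i) i) (sorted_list_of_set UNIV))) f"
proof -
  have "foldr (\<lambda>i. partial_deriv i ^^ (\<alpha> $ i)) xs f =
      foldr partial_deriv (concat (map (\<lambda>i. replicate (\<alpha> $ i) i) xs)) f" for xs f
    by (induction xs) simp_all
  then show ?thesis by (simp add: multi_deriv_def)
qed

text \<open>The bound of \<open>foldr_partial_bounded\<close> is uniform over all words in the
  partial derivatives, so it is enough that each iterate is such a word.\<close>

lemma multi_deriv_power_eq_foldr: "\<exists>L. (multi_deriv \<alpha> ^^ n) f = foldr partial_deriv L f"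
proof (induction n)
  case 0
  have "(multi_deriv \<alpha> ^^ 0) f = foldr partial_deriv [] f" by simp
  then show ?case ..
next
  case (Suc n)
  then obtain L where "(multi_deriv \<alpha> ^^ n) f = foldr partial_deriv L f" ..
  then have "(multi_deriv \<alpha> ^^ Suc n) f =
      foldr partial_deriv (concat (map (\<lambda>i. replicate (\<alpha> $ i) i) (sorted_list_of_set UNIV)) @ L) f"
    by (simp add: multi_deriv_eq_foldr)
  then show ?case ..
qed

lemma sphere_nonempty: "sphere (0 :: real ^ 'n::finite) (real m) \<noteq> {}"
proof -
  have "real m *\<^sub>R axis undefined 1 \<in> sphere (0 :: real ^ 'n) (real m)" by simp
  then show ?thesis by blast
qed

lemma not_irregular_multi_deriv:
  fixes h :: "real ^ ('n::{finite,linorder}) \<Rightarrow> real"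
  assumes N: "CARD('n) \<ge> 2" and "C > 0"
    and M2: "\<And>r. r > 0 \<Longrightarrow> M2 h r \<le> C * (exp r / r powr ((real CARD('n) - 1) / 2))"
  shows "\<not> irregular_vector harmonic_space sup_seminorm (multi_deriv \<alpha>) h"
proof
  assume "irregular_vector harmonic_space sup_seminorm (multi_deriv \<alpha>) h"
  then obtain m and n :: "nat \<Rightarrow> nat" where h: "h \<in> harmonic_space"
    and lim: "filterlim (\<lambda>k. sup_seminorm m ((multi_deriv \<alpha> ^^ n k) h)) at_top sequentially"
    by (auto simp: irregular_vector_def)
  obtain K where K: "\<And>L x. norm x \<le> real m \<Longrightarrow> \<bar>foldr partial_deriv L h x\<bar> \<le> K"
    using foldr_partial_bounded[OF N h \<open>C > 0\<close> M2, of "real m"] by blast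
  have le: "sup_seminorm m ((multi_deriv \<alpha> ^^ n k) h) \<le> K" for k
  proof -
    obtain L where "(multi_deriv \<alpha> ^^ n k) h = foldr partial_deriv L h"
      using multi_deriv_power_eq_foldr by blast
    then show ?thesis unfolding sup_seminorm_def
      by (intro cSUP_least sphere_nonempty) (auto intro!: K)
  qed
  have "\<forall>\<^sub>F k in sequentially. sup_seminorm m ((multi_deriv \<alpha> ^^ n k) h) > K"
    using lim by (simp add: filterlim_at_top_dense)
  then have "\<forall>\<^sub>F k::nat in sequentially. False"
    by (rule eventually_mono) (use le leD in blast)
  then show False by simp
qed

subsection \<open>Zonal harmonics and lacunary series\<close>

text \<open>The analogue of \<open>x^j / fact j\<close>: raising starts from 1 and is divided by the
  eigenvalue in each step, so that the derivative in direction \<open>k\<close> becomes a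
  shift.\<close>

primrec zonal :: "'n::finite \<Rightarrow> nat \<Rightarrow> real ^ 'n \<Rightarrow> real" where
  "zonal k 0 = (\<lambda>x. 1)"
| "zonal k (Suc j) = (\<lambda>x. (1 / ladder_factor (real CARD('n)) j) * raise k j (zonal k j) x)"

lemma hom_harmonic_cmult: "G \<in> hom_harmonic d \<Longrightarrow> (\<lambda>x. c * G x) \<in> hom_harmonic d"
  by (auto simp: hom_harmonic_def intro: harmonic_cmult)

lemma zonal_hom_harmonic: "zonal k j \<in> hom_harmonic j"
  by (induction j) (auto simp: hom_harmonic_one intro!: hom_harmonic_cmult raise_hom_harmonic simp del: times_divide_eq_left)

lemma zonal_harmonic: "zonal k j \<in> harmonic_space"
  by (rule hom_harmonicD(1)[OF zonal_hom_harmonic])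

lemma zonal_continuous: "continuous_on UNIV (zonal k j)"
  by (rule harmonic_spaceD(2)[OF zonal_harmonic])

lemma partial_zonal_0: "partial_deriv i (zonal k 0) = (\<lambda>x. 0)"
  by (simp add: has_pd_imp(1)[OF has_pd_const])

text \<open>Commutation rule and induction hypothesis make \<open>zonal k (Suc j)\<close> an
  eigenvector of lowering after raising; its eigenvalue is the next \<open>ladder_factor\<close>, by
  the recursion.\<close>

lemma partial_zonal_Suc:
  fixes k :: "'n::finite"
  assumes N: "CARD('n) \<ge> 2"
  shows "partial_deriv k (zonal k (Suc j)) = zonal k j"
proof (induction j)
  let ?N = "real CARD('n)"
  have pc: "partial_deriv k (\<lambda>x. c * G x) = (\<lambda>x. c * partial_deriv k G x)" if "G \<in> harmonic_space" for c and G :: "real ^ 'n \<Rightarrow> real"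
    by (rule has_pd_imp(1)[OF has_pd_cmult[OF harmonic_spaceD(5)[OF that]]])
  have rh: "raise k j (zonal k j) \<in> harmonic_space" for j
    by (rule hom_harmonicD(1)[OF raise_hom_harmonic[OF zonal_hom_harmonic]])
  {
    case 0
    have "partial_deriv k (raise k 0 (zonal k 0)) = zonal k 0"
      by (rule partial_raise_0[OF zonal_hom_harmonic])
    then show ?case using pc[OF rh, of 1 0] by simp
  next
    case (Suc j)
    have b: "ladder_factor ?N (Suc j) \<noteq> 0" "ladder_factor ?N j \<noteq> 0" using ladder_factor_ge_1[of ?N "Suc j"] ladder_factor_ge_1[of ?N j] N by (auto simp del: ladder_factor.simps)
    let ?c = "(2 * real j + ?N - 2) / (2 * real j + ?N)"
    have e: "raise k j (zonal k j) x = ladder_factor ?N j * zonal k (Suc j) x" for x using b(2) by simp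
    have "partial_deriv k (raise k (Suc j) (zonal k (Suc j))) x = ladder_factor ?N (Suc j) * zonal k (Suc j) x" for x
    proof -
      have "partial_deriv k (raise k (Suc j) (zonal k (Suc j))) x = zonal k (Suc j) x + ?c * raise k j (zonal k j) x"
        unfolding partial_raise_Suc[OF zonal_hom_harmonic] Suc ..
      then show ?thesis unfolding e ladder_factor.simps by (simp only: distrib_right mult_1 mult.assoc)
    qed
    then have "partial_deriv k (raise k (Suc j) (zonal k (Suc j))) = (\<lambda>x. ladder_factor ?N (Suc j) * zonal k (Suc j) x)" by auto
    then show ?case unfolding zonal.simps(2)[of k "Suc j"] pc[OF rh] using b(1) by (simp del: ladder_factor.simps zonal.simps)
  }
qed

text \<open>Pairing neighbours by adjointness gives an identity where \<open>raise_norm_le\<close>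
  has an inequality; so the constant of \<open>foldr_partial_le\<close> is attained at the
  origin.\<close>

lemma zonal_norm:
  fixes k :: "'n::finite"
  assumes N: "CARD('n) \<ge> 2"
  shows "unit_avg (\<lambda>x. (zonal k j x)\<^sup>2) = 1 / ladder_prod (real CARD('n)) j"
proof (induction j)
  case (Suc j)
  let ?N = "real CARD('n)"
  have b: "ladder_factor ?N j > 0" using ladder_factor_ge_1[of ?N j] N by auto
  have e: "raise k j (zonal k j) x = ladder_factor ?N j * zonal k (Suc j) x" for x using b by simp
  have "unit_avg (\<lambda>x. partial_deriv k (zonal k (Suc j)) x * zonal k j x) =
      (2 * real j + 2 + ?N) * unit_avg (\<lambda>x. zonal k (Suc j) x * raise k j (zonal k j) x)"
    by (rule unit_avg_partial[OF zonal_harmonic zonal_hom_harmonic])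
  then have "1 / ladder_prod ?N j = ((2 * real j + 2 + ?N) * ladder_factor ?N j) * unit_avg (\<lambda>x. (zonal k (Suc j) x)\<^sup>2)"
    unfolding e partial_zonal_Suc[OF N] using unit_avg_cmult[of "ladder_factor ?N j" "\<lambda>x. (zonal k (Suc j) x)\<^sup>2"] Suc
    by (simp add: power2_eq_square mult_ac del: zonal.simps)
  then have "unit_avg (\<lambda>x. (zonal k (Suc j) x)\<^sup>2) = 1 / ladder_prod ?N j / ((2 * real j + 2 + ?N) * ladder_factor ?N j)"
    using b by simp
  then show ?case by simp
qed simp

text \<open>The square at \<open>x\<close> is at most its mean over the unit ball about
  \<open>x\<close>, the case of the empty list in \<open>foldr_partial_le\<close>; enlarging to a
  ball about 0 makes the exact norm available.\<close>

lemma zonal_bound: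
  fixes k :: "'n::finite"
  assumes N: "CARD('n) \<ge> 2" and x: "norm x \<le> r"
  shows "\<bar>zonal k j x\<bar> \<le> sqrt ((r + 1) ^ CARD('n)) * (r + 1) ^ j / fact j"
proof -
  let ?N = "real CARD('n)"
  have r: "r \<ge> 0" using x norm_ge_zero[of x] by linarith
  have c: "continuous_on UNIV (\<lambda>x. (zonal k j x)\<^sup>2)" by (intro continuous_intros zonal_continuous)
  have "(zonal k j x)\<^sup>2 \<le> unit_avg (\<lambda>y. (zonal k j (x + 1 *\<^sub>R y))\<^sup>2)"
    using foldr_partial_le[OF N zonal_harmonic, of 1 "[]" k j x] by simp
  also have "\<dots> \<le> (r + 1) ^ CARD('n) * unit_avg (\<lambda>y. (zonal k j (0 + (r + 1) *\<^sub>R y))\<^sup>2)"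
    using unit_avg_ball_mono[OF c zero_le_power2 zero_less_one, of x 0 "r + 1"] x by simp
  also have "(\<lambda>y. (zonal k j (0 + (r + 1) *\<^sub>R y))\<^sup>2) = (\<lambda>y. (r + 1) ^ (2 * j) * (zonal k j y)\<^sup>2)"
    using hom_harmonicD(2)[OF zonal_hom_harmonic[of k j], of "r + 1"] r
    by (simp add: power_mult_distrib power_mult[symmetric] mult.commute)
  also have "(r + 1) ^ CARD('n) * unit_avg \<dots> = (r + 1) ^ CARD('n) * (r + 1) ^ (2 * j) / ladder_prod ?N j"
    unfolding unit_avg_cmult zonal_norm[OF N] by simp
  also have "\<dots> \<le> (r + 1) ^ CARD('n) * (r + 1) ^ (2 * j) / (fact j)\<^sup>2"
    using ladder_prod_ge_fact[of ?N j] N r by (intro frac_le) auto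
  also have "\<dots> = (sqrt ((r + 1) ^ CARD('n)) * (r + 1) ^ j / fact j)\<^sup>2"
    using r by (simp add: power_mult_distrib power_divide power_mult[symmetric] mult.commute)
  finally show ?thesis using r by (subst (asm) power2_le_iff_abs_le) auto
qed

section \<open>Series of zonal harmonics\<close>

definition zonal_series :: "'n::finite \<Rightarrow> (nat \<Rightarrow> real) \<Rightarrow> real ^ 'n \<Rightarrow> real"
  where "zonal_series k a x = (\<Sum>j. a j * zonal k j x)"

text \<open>Coefficients up to \<open>K * 2 ^ j\<close> form a class that is stable under shifts,
  with a new \<open>K\<close>, and still leave factorial decay.\<close>

lemma zonal_series_term_bound:
  fixes k :: "'n::finite"
  assumes N: "CARD('n) \<ge> 2" and x: "norm x \<le> r" and a: "\<bar>a j\<bar> \<le> K * 2 ^ j"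
  shows "\<bar>a j * zonal k j x\<bar> \<le> K * sqrt ((r + 1) ^ CARD('n)) * ((2 * (r + 1)) ^ j / fact j)"
proof -
  have "\<bar>a j * zonal k j x\<bar> \<le> (K * 2 ^ j) * (sqrt ((r + 1) ^ CARD('n)) * (r + 1) ^ j / fact j)"
    unfolding abs_mult using a by (intro mult_mono zonal_bound[OF N x]) (auto intro: order_trans[OF abs_ge_zero])
  also have "\<dots> = K * sqrt ((r + 1) ^ CARD('n)) * ((2 * (r + 1)) ^ j / fact j)"
    unfolding power_mult_distrib by simp
  finally show ?thesis .
qed

lemma summable_exp_divide: "summable (\<lambda>j. (x::real) ^ j / fact j)"
  using summable_exp[of x] by (simp add: field_simps)

lemma zonal_series_uniform_limit:
  fixes k :: "'n::finite"
  assumes N: "CARD('n) \<ge> 2" and a: "\<And>j. \<bar>a j\<bar> \<le> K * 2 ^ j"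
  shows "uniform_limit (cball 0 r) (\<lambda>n x. \<Sum>j<n. a j * zonal k j x) (zonal_series k a) sequentially"
  unfolding zonal_series_def
proof (rule Weierstrass_m_test)
  show "norm (a j * zonal k j x) \<le> K * sqrt ((r + 1) ^ CARD('n)) * ((2 * (r + 1)) ^ j / fact j)"
    if "x \<in> cball 0 r" for j x
    using zonal_series_term_bound[where a = a and K = K and r = r, OF N _ a] that by simp
  show "summable (\<lambda>j. K * sqrt ((r + 1) ^ CARD('n)) * ((2 * (r + 1)) ^ j / fact j))"
    by (intro summable_mult summable_exp_divide)
qed

lemma zonal_partial_sum_harmonic: "(\<lambda>x. \<Sum>j<n. a j * zonal k j x) \<in> harmonic_space"
  by (induction n) (auto intro!: harmonic_const harmonic_add harmonic_cmult zonal_harmonic)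

lemma zonal_series_harmonic:
  fixes k :: "'n::finite"
  assumes N: "CARD('n) \<ge> 2" and a: "\<And>j. \<bar>a j\<bar> \<le> K * 2 ^ j"
  shows "zonal_series k a \<in> harmonic_space"
  by (rule harmonic_limit(1)[OF zonal_partial_sum_harmonic zonal_series_uniform_limit[OF N a]])

lemma partial_zonal_series:
  fixes k :: "'n::finite"
  assumes N: "CARD('n) \<ge> 2" and a: "\<And>j. \<bar>a j\<bar> \<le> K * 2 ^ j"
  shows "partial_deriv k (zonal_series k a) = zonal_series k (\<lambda>j. a (Suc j))"
proof
  fix x :: "real ^ 'n"
  have x: "x \<in> cball 0 (norm x)" by simp
  have b: "\<bar>a (Suc j)\<bar> \<le> (2 * K) * 2 ^ j" for j using a[of "Suc j"] by simp
  have "(\<lambda>n. partial_deriv k (\<lambda>x. \<Sum>j<n. a j * zonal k j x) x) \<longlonglongrightarrow> partial_deriv k (zonal_series k a) x"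
    by (rule tendsto_uniform_limitI[OF harmonic_limit(2)[OF zonal_partial_sum_harmonic zonal_series_uniform_limit[OF N a]] x])
  \<comment> \<open>One index is skipped, because the term of degree 0 has derivative 0 and the
    others move down by one.\<close>
  then have 1: "(\<lambda>n. partial_deriv k (\<lambda>x. \<Sum>j<Suc n. a j * zonal k j x) x) \<longlonglongrightarrow> partial_deriv k (zonal_series k a) x"
    by (rule LIMSEQ_Suc)
  have "partial_deriv k (\<lambda>x. \<Sum>j<Suc n. a j * zonal k j x) x = (\<Sum>j<n. a (Suc j) * zonal k j x)" for n
  proof -
    have "has_pd k (\<lambda>x. \<Sum>j<Suc n. a j * zonal k j x) (\<lambda>x. \<Sum>j<Suc n. a j * partial_deriv k (zonal k j) x)"
      by (intro has_pd_sum has_pd_cmult harmonic_spaceD(5)[OF zonal_harmonic])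
    from has_pd_imp(1)[OF this]
    show ?thesis unfolding sum.lessThan_Suc_shift partial_zonal_0 partial_zonal_Suc[OF N] by simp
  qed
  with 1 have "(\<lambda>n. \<Sum>j<n. a (Suc j) * zonal k j x) \<longlonglongrightarrow> partial_deriv k (zonal_series k a) x" by simp
  moreover have "(\<lambda>n. \<Sum>j<n. a (Suc j) * zonal k j x) \<longlonglongrightarrow> zonal_series k (\<lambda>j. a (Suc j)) x"
    by (rule tendsto_uniform_limitI[OF zonal_series_uniform_limit[where a = "\<lambda>j. a (Suc j)", OF N b] x])
  ultimately show "partial_deriv k (zonal_series k a) x = zonal_series k (\<lambda>j. a (Suc j)) x"
    by (rule LIMSEQ_unique)
qed

lemma partial_zonal_series_power:
  fixes k :: "'n::finite"
  assumes N: "CARD('n) \<ge> 2" and a: "\<And>j. \<bar>a j\<bar> \<le> K * 2 ^ j"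
  shows "(partial_deriv k ^^ n) (zonal_series k a) = zonal_series k (\<lambda>j. a (j + n))"
proof (induction n)
  case (Suc n)
  have "\<bar>a (j + n)\<bar> \<le> (2 ^ n * K) * 2 ^ j" for j using a[of "j + n"] by (simp add: power_add mult_ac)
  then have "partial_deriv k (zonal_series k (\<lambda>j. a (j + n))) = zonal_series k (\<lambda>j. a (Suc j + n))"
    by (rule partial_zonal_series[OF N])
  then show ?case by (simp add: Suc)
qed simp

text \<open>Factorial decay would allow coefficients \<open>4 ^ j\<close>; the spare factor
  \<open>2 ^ j\<close> is at least \<open>2 ^ D\<close> on the surviving terms, which makes the
  remainder small.\<close>

lemma zonal_series_tail:
  fixes k :: "'n::finite"
  assumes N: "CARD('n) \<ge> 2" and b: "\<And>j. j \<ge> 1 \<Longrightarrow> \<bar>b j\<bar> \<le> 2 ^ j" and z: "\<And>j. 1 \<le> j \<Longrightarrow> j < D \<Longrightarrow> b j = 0"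
    and x: "norm x \<le> r"
  shows "\<bar>zonal_series k b x - b 0\<bar> \<le> sqrt ((r + 1) ^ CARD('n)) * exp (4 * (r + 1)) / 2 ^ D"
proof -
  have r: "r \<ge> 0" using x norm_ge_zero[of x] by linarith
  define c where "c = sqrt ((r + 1) ^ CARD('n))"
  have c: "c \<ge> 0" using r by (simp add: c_def)
  define t where "t j = (if j = 0 then 0 else b j * zonal k j x)" for j
  have tb: "norm (t j) \<le> c / 2 ^ D * ((4 * (r + 1)) ^ j / fact j)" for j
  proof (cases "j = 0 \<or> j < D")
    case True
    then have "t j = 0" using z[of j] by (auto simp: t_def)
    then show ?thesis using c r by simp
  next
    case False
    then have "\<bar>b j * zonal k j x\<bar> \<le> 1 * c * ((2 * (r + 1)) ^ j / fact j)"
      unfolding c_def using b[of j] by (intro zonal_series_term_bound[OF N x]) auto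
    also have "\<dots> = c / 2 ^ j * ((4 * (r + 1)) ^ j / fact j)"
    proof -
      have "(4 * (r + 1)) ^ j = 2 ^ j * (2 * (r + 1)) ^ j" unfolding power_mult_distrib[symmetric] by simp
      then show ?thesis by simp
    qed
    also have "\<dots> \<le> c / 2 ^ D * ((4 * (r + 1)) ^ j / fact j)"
      using False c r by (intro mult_right_mono divide_left_mono power_increasing) auto
    finally show ?thesis using False by (simp add: t_def)
  qed
  have sm: "summable (\<lambda>j. c / 2 ^ D * ((4 * (r + 1)) ^ j / fact j))"
    by (intro summable_mult summable_exp_divide)
  have "(\<lambda>j. (4 * (r + 1)) ^ j / fact j) sums exp (4 * (r + 1))"
    using exp_converges[of "4 * (r + 1)"] by (simp add: field_simps)
  then have se: "(\<Sum>j. c / 2 ^ D * ((4 * (r + 1)) ^ j / fact j)) = c / 2 ^ D * exp (4 * (r + 1))"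
    by (intro sums_unique[symmetric] sums_mult)
  have st: "summable t" by (rule summable_comparison_test'[OF sm tb])
  have "(\<lambda>j. t j + (if j = 0 then b 0 else 0)) sums ((\<Sum>j. t j) + b 0)"
    by (intro sums_add summable_sums st sums_single)
  moreover have "(\<lambda>j. t j + (if j = 0 then b 0 else 0)) = (\<lambda>j. b j * zonal k j x)"
    by (auto simp: t_def)
  ultimately have "zonal_series k b x = (\<Sum>j. t j) + b 0"
    unfolding zonal_series_def by (simp add: sums_iff)
  moreover have "norm (\<Sum>j. t j) \<le> (\<Sum>j. c / 2 ^ D * ((4 * (r + 1)) ^ j / fact j))"
    by (rule norm_suminf_le[OF tb sm])
  ultimately show ?thesis unfolding se by (simp add: c_def)
qed

lemma sup_seminorm_bdd:
  fixes f :: "real ^ 'n::finite \<Rightarrow> real"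
  assumes f: "continuous_on UNIV f"
  shows "bdd_above ((\<lambda>x. \<bar>f x\<bar>) ` sphere 0 r)"
  by (intro bounded_imp_bdd_above compact_imp_bounded compact_continuous_image compact_sphere
      continuous_intros continuous_on_subset[OF f]) auto

lemma le_sup_seminorm:
  fixes f :: "real ^ 'n::finite \<Rightarrow> real"
  assumes "continuous_on UNIV f" "norm x = real m"
  shows "\<bar>f x\<bar> \<le> sup_seminorm m f"
  unfolding sup_seminorm_def by (rule cSUP_upper[OF _ sup_seminorm_bdd[OF assms(1)]]) (simp add: assms)

text \<open>The coefficient \<open>l\<close> sits at the position \<open>n l\<close>: applying \<open>\<partial>/\<partial>x\<^sub>k\<close> exactly \<open>n l\<close> times makes it the
  constant term, and one further time removes it.\<close>

definition lacunary :: "(nat \<Rightarrow> nat) \<Rightarrow> nat \<Rightarrow> real"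
  where "lacunary n j = (if j \<in> range n then real (inv n j) else 0)"

text \<open>The gap grows with \<open>l\<close> so that, after \<open>n l\<close> or
  \<open>n l + 1\<close> derivatives, the next nonzero coefficient beyond the constant term lies
  more than \<open>l\<close> places away; the remainder is then of order \<open>1 / 2 ^ l\<close> on
  each ball. The distance also exceeds that coefficient itself, which yields the bound
  \<open>2 ^ j\<close> of \<open>zonal_series_tail\<close>.\<close>

lemma zonal_series_irregular:
  fixes k :: "'n::finite" and n :: "nat \<Rightarrow> nat"
  assumes N: "CARD('n) \<ge> 2" and n0: "n 0 \<ge> 1" and gap: "\<And>l. n (Suc l) \<ge> n l + l + 3"
  shows "irregular_vector harmonic_space sup_seminorm (partial_deriv k) (zonal_series k (lacunary n))"
proof -
  let ?a = "lacunary n"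
  have mono: "strict_mono n"
  proof (rule strict_monoI_Suc)
    show "n l < n (Suc l)" for l using gap[of l] by linarith
  qed
  have inj: "inj n" using mono strict_mono_imp_inj_on by blast
  have at: "?a (n l) = real l" for l using inj by (simp add: lacunary_def)
  have le: "l \<le> n l" for l using mono by (rule strict_mono_imp_increasing)
  have gap': "n l' \<ge> n l + l' + 2" if "l < l'" for l l'
  proof -
    have "l' \<noteq> 0" using that by simp
    then obtain p where p: "l' = Suc p" by (cases l') auto
    then have "n l \<le> n p" using \<open>l < l'\<close> mono by (simp add: strict_mono_less_eq)
    then show ?thesis using gap[of p] p by simp
  qed
  have pos: "n l \<ge> 1" for l using n0 mono by (metis le0 le_trans strict_mono_less_eq)
  have later: "(\<exists>l'>l. n l + i = n l' \<and> ?a (n l + i) = real l' \<and> l' + 2 \<le> i) \<or> ?a (n l + i) = 0" if "i \<ge> 1" for l i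
  proof (cases "n l + i \<in> range n")
    case True
    then obtain l' where l': "n l + i = n l'" by auto
    then have "l < l'" using that mono by (metis add_lessD1 leD le_add1 le_less_linear less_add_eq_less less_le_trans not_less_eq_eq One_nat_def add_le_same_cancel1 strict_mono_less)
    with gap'[OF this] l' at show ?thesis by auto
  qed (simp add: lacunary_def)
  have two: "real m \<le> 2 ^ m" for m by (simp add: of_nat_less_two_power less_imp_le)
  have a: "\<bar>?a j\<bar> \<le> 1 * 2 ^ j" for j
  proof (cases "j \<in> range n")
    case True
    then obtain l where l: "j = n l" by auto
    have "real l \<le> real j" using le[of l] l by simp
    also have "\<dots> \<le> 2 ^ j" by (rule two)
    finally show ?thesis using at[of l] l by simp
  qed (simp add: lacunary_def)
  have harm: "zonal_series k (\<lambda>j. ?a (j + m)) \<in> harmonic_space" for m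
  proof (rule zonal_series_harmonic[OF N])
    show "\<bar>?a (j + m)\<bar> \<le> 2 ^ m * 2 ^ j" for j using a[of "j + m"] by (simp add: power_add mult.commute)
  qed
  note cont = harmonic_spaceD(2)[OF harm]
  define M where "M r = sqrt ((r + 1) ^ CARD('n)) * exp (4 * (r + 1))" for r :: real
  have M0: "M (real r) \<ge> 0" for r by (simp add: M_def)
  have big: "\<bar>zonal_series k (\<lambda>j. ?a (j + n l)) x - real l\<bar> \<le> M r / 2 ^ (l + 1)" if "norm x \<le> r" for l x r
  proof -
    have "\<bar>zonal_series k (\<lambda>j. ?a (j + n l)) x - ?a (0 + n l)\<bar> \<le> sqrt ((r + 1) ^ CARD('n)) * exp (4 * (r + 1)) / 2 ^ (l + 1)"
    proof (rule zonal_series_tail[OF N _ _ that])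
      fix i :: nat assume i: "1 \<le> i"
      have "?a (n l + i) \<le> real i \<and> ?a (n l + i) \<ge> 0" using later[OF i, of l] by auto
      then have "?a (n l + i) \<le> 2 ^ i \<and> ?a (n l + i) \<ge> 0" using order_trans[OF _ two[of i]] by blast
      then show "\<bar>?a (i + n l)\<bar> \<le> 2 ^ i" by (simp add: add.commute)
      assume "i < l + 1"
      then show "?a (i + n l) = 0" using later[OF i, of l] by (auto simp: add.commute)
    qed
    then show ?thesis by (simp add: at M_def)
  qed
  have small: "\<bar>zonal_series k (\<lambda>j. ?a (j + (n l + 1))) x\<bar> \<le> M r / 2 ^ (l + 1)" if "norm x \<le> r" for l x r
  proof -
    have z: "?a (0 + (n l + 1)) = 0" using later[of 1 l] by auto
    have "\<bar>zonal_series k (\<lambda>j. ?a (j + (n l + 1))) x - ?a (0 + (n l + 1))\<bar> \<le> sqrt ((r + 1) ^ CARD('n)) * exp (4 * (r + 1)) / 2 ^ (l + 1)"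
    proof (rule zonal_series_tail[OF N _ _ that])
      fix i :: nat assume i: "1 \<le> i"
      have "?a (n l + (i + 1)) \<le> real i \<and> ?a (n l + (i + 1)) \<ge> 0" using later[of "i + 1" l] by auto
      then have "?a (n l + (i + 1)) \<le> 2 ^ i \<and> ?a (n l + (i + 1)) \<ge> 0" using order_trans[OF _ two[of i]] by blast
      then show "\<bar>?a (i + (n l + 1))\<bar> \<le> 2 ^ i" by (simp add: add_ac)
      assume "i < l + 1"
      then show "?a (i + (n l + 1)) = 0" using later[of "i + 1" l] by (auto simp: add_ac)
    qed
    then show ?thesis unfolding z by (simp add: M_def)
  qed
  have pow: "(partial_deriv k ^^ m) (zonal_series k ?a) = zonal_series k (\<lambda>j. ?a (j + m))" for m
    by (rule partial_zonal_series_power[OF N a])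
  have null: "(\<lambda>l. sup_seminorm i ((partial_deriv k ^^ (n l + 1)) (zonal_series k ?a))) \<longlonglongrightarrow> 0" for i
  proof (rule tendsto_sandwich[of "\<lambda>_. 0" _ _ "\<lambda>l. M (real i) / 2 ^ (l + 1)"])
    obtain x0 :: "real ^ 'n" where x0: "norm x0 = real i" using sphere_nonempty[of i, where 'n = 'n] unfolding ex_in_conv[symmetric] mem_sphere_0 by blast
    show "\<forall>\<^sub>F l in sequentially. 0 \<le> sup_seminorm i ((partial_deriv k ^^ (n l + 1)) (zonal_series k ?a))"
      unfolding pow using le_sup_seminorm[OF cont x0] by (intro always_eventually allI) (meson abs_ge_zero order_trans)
    show "\<forall>\<^sub>F l in sequentially. sup_seminorm i ((partial_deriv k ^^ (n l + 1)) (zonal_series k ?a)) \<le> M (real i) / 2 ^ (l + 1)"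
      unfolding pow sup_seminorm_def by (intro always_eventually allI cSUP_least sphere_nonempty small) simp
    show "(\<lambda>l. M (real i) / 2 ^ (l + 1)) \<longlonglongrightarrow> 0" by real_asymp
  qed auto
  obtain x1 :: "real ^ 'n" where x1: "norm x1 = real 1" using sphere_nonempty[of 1, where 'n = 'n] unfolding ex_in_conv[symmetric] mem_sphere_0 by blast
  \<comment> \<open>A single point of the unit sphere is enough: there the constant term
    \<open>l\<close> outgrows a remainder bounded by \<open>M 1\<close>.\<close>
  have infty: "filterlim (\<lambda>l. sup_seminorm 1 ((partial_deriv k ^^ n l) (zonal_series k ?a))) at_top sequentially"
  proof (rule filterlim_at_top_mono)
    show "filterlim (\<lambda>l. real l - M 1) at_top sequentially" by real_asymp
    have "real l - M 1 \<le> sup_seminorm 1 ((partial_deriv k ^^ n l) (zonal_series k ?a))" for l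
    proof -
      have "M 1 / 2 ^ (l + 1) \<le> M 1 / 1" using M0[of 1] by (intro divide_left_mono one_le_power) auto
      then have "real l - M 1 \<le> \<bar>zonal_series k (\<lambda>j. ?a (j + n l)) x1\<bar>"
        using big[of x1 1 l] x1 by linarith
      also have "\<dots> \<le> sup_seminorm 1 ((partial_deriv k ^^ n l) (zonal_series k ?a))"
        unfolding pow by (rule le_sup_seminorm[OF cont x1])
      finally show ?thesis .
    qed
    then show "\<forall>\<^sub>F l in sequentially. real l - M 1 \<le> sup_seminorm 1 ((partial_deriv k ^^ n l) (zonal_series k ?a))"
      by simp
  qed
  have mono1: "strict_mono (\<lambda>l. n l + 1)" using mono by (simp add: strict_mono_def)
  show ?thesis
    unfolding irregular_vector_def
    using harm[of 0] mono mono1 pos null infty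
    by (intro conjI exI[of _ 1] exI[of _ "\<lambda>l. n l + 1"] exI[of _ n]) (auto simp: Suc_le_eq)
qed

section \<open>Growth of the means over spheres\<close>

text \<open>The inequality \<open>ln u <= u - 1\<close> is applied at \<open>u = t / t0\<close>,
  where \<open>t = t0\<close> marks the maximum of \<open>r powr p * exp (- 2 * r)\<close>, and then
  at \<open>u = t0\<close>. The factor \<open>(2 j + N) / N\<close> contributes the missing power of
  \<open>j\<close>, so the exponent becomes \<open>2 j + N\<close> and matches
  \<open>ladder_prod\<close> exactly.\<close>

lemma ladder_prod_growth_le:
  fixes N :: real
  assumes N: "N \<ge> 2"
  shows "\<exists>K. \<forall>j\<ge>1. \<forall>r>0. r powr (2 * real j + N - 1) * exp (- 2 * r) * ((2 * real j + N) / N) \<le> K * ladder_prod N j"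
proof -
  obtain c1 where c1: "c1 > 0" "\<And>n. n \<ge> 1 \<Longrightarrow> c1 * real n powr (2 * real n + N) * exp (- 2 * real n) \<le> ladder_prod N n"
    using ladder_prod_asymp[OF N] by metis
  define c where "c = N - 1"
  have c: "c \<ge> 1" using N by (simp add: c_def)
  define K where "K = (2 + N) / N * exp (c\<^sup>2) / c1"
  have "r powr (2 * real j + N - 1) * exp (- 2 * r) * ((2 * real j + N) / N) \<le> K * ladder_prod N j" if j: "j \<ge> 1" and r: "r > 0" for j r
  proof -
    define J where "J = real j"
    have J: "J \<ge> 1" using j by (simp add: J_def)
    define p where "p = 2 * J + c"
    have p: "p > 0" using J c by (simp add: p_def)
    define t where "t = r / J"
    have t: "t > 0" using r J by (simp add: t_def)
    define t0 where "t0 = p / (2 * J)"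
    have t0: "t0 > 0" using p J by (simp add: t0_def)
    have "ln (t / t0) \<le> t / t0 - 1" using t t0 by (intro ln_le_minus_one) simp
    then have 1: "ln t \<le> t / t0 - 1 + ln t0" using t t0 by (simp add: ln_div)
    have "ln t0 \<le> t0 - 1" using t0 by (rule ln_le_minus_one)
    then have 2: "ln t0 \<le> c / (2 * J)" using J by (simp add: t0_def p_def field_simps)
    have "p * ln t \<le> p * (t / t0 - 1 + c / (2 * J))" using p 1 2 by (intro mult_left_mono) auto
    also have "\<dots> = 2 * J * t - p + p * (c / (2 * J))" using J p by (simp add: t0_def algebra_simps)
    also have "p * (c / (2 * J)) = c + c\<^sup>2 / (2 * J)" using J by (simp add: p_def power2_eq_square field_simps)
    also have "2 * J * t = 2 * r" using J by (simp add: t_def)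
    also have "c\<^sup>2 / (2 * J) \<le> c\<^sup>2 / 1" using J by (intro divide_left_mono) auto
    finally have "p * ln t - 2 * r + 2 * J \<le> c\<^sup>2" by (simp add: p_def)
    then have e: "exp (p * ln t - 2 * r + 2 * J) \<le> exp (c\<^sup>2)" by simp
    have "ln t = ln r - ln J" using r J by (simp add: t_def ln_div)
    then have "p * ln t = p * ln r - p * ln J" by (simp add: right_diff_distrib)
    then have "exp (p * ln t - 2 * r + 2 * J) * (exp (p * ln J) * exp (- 2 * J)) = exp (p * ln r) * exp (- 2 * r)"
      by (simp flip: exp_add)
    moreover have "exp (p * ln J) = J powr p" "exp (p * ln r) = r powr p" using J r by (auto simp: powr_def)
    ultimately have f: "r powr p * exp (- 2 * r) \<le> exp (c\<^sup>2) * (J powr p * exp (- 2 * J))"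
      using mult_right_mono[OF e, of "J powr p * exp (- 2 * J)"] by simp
    have g: "(2 * J + N) / N \<le> (2 + N) / N * J"
      using J N mult_left_mono[of 1 J N] by (simp add: field_simps)
    have "r powr p * exp (- 2 * r) * ((2 * J + N) / N) \<le> (exp (c\<^sup>2) * (J powr p * exp (- 2 * J))) * ((2 + N) / N * J)"
      using J N by (intro mult_mono f g) auto
    also have "\<dots> = (2 + N) / N * exp (c\<^sup>2) * (J powr (p + 1) * exp (- 2 * J))"
      using J by (simp add: powr_add)
    also have "\<dots> \<le> (2 + N) / N * exp (c\<^sup>2) * (ladder_prod N j / c1)"
    proof (rule mult_left_mono)
      have "p + 1 = 2 * real j + N" by (simp add: p_def c_def J_def)
      then show "J powr (p + 1) * exp (- 2 * J) \<le> ladder_prod N j / c1"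
        using c1(2)[OF j] c1(1) by (simp add: J_def pos_le_divide_eq mult_ac)
    qed (use N in simp)
    also have "\<dots> = K * ladder_prod N j" by (simp add: K_def)
    finally show ?thesis unfolding p_def c_def J_def add_diff_eq .
  qed
  then show ?thesis by blast
qed

lemma M2_zonal:
  fixes k :: "'n::finite"
  assumes N: "CARD('n) \<ge> 2" and r: "r > 0"
  shows "(M2 (zonal k j) r)\<^sup>2 = r ^ (2 * j) * ((2 * real j + real CARD('n)) / real CARD('n)) / ladder_prod (real CARD('n)) j"
  unfolding M2_hom_harmonic[OF zonal_hom_harmonic r] zonal_norm[OF N] by simp

lemma M2_zonal_pos:
  fixes k :: "'n::finite"
  assumes N: "CARD('n) \<ge> 2" and r: "r > 0"
  shows "M2 (zonal k j) r > 0"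
proof -
  have "(M2 (zonal k j) r)\<^sup>2 > 0"
    unfolding M2_zonal[OF N r] using r ladder_prod_pos[of "real CARD('n)" j] N
    by (intro divide_pos_pos mult_pos_pos) (auto simp: add_nonneg_pos)
  then show ?thesis using M2_sq(2)[OF zonal_continuous r, of k j] by (simp add: zero_less_power2)
qed

lemma M2_zonal_le:
  fixes k :: "'n::finite"
  assumes N: "CARD('n) \<ge> 2"
  obtains K where "K > 0" "\<And>j r. j \<ge> 1 \<Longrightarrow> r > 0 \<Longrightarrow>
    M2 (zonal k j) r \<le> K * (exp r / r powr ((real CARD('n) - 1) / 2))"
proof -
  let ?N = "real CARD('n)"
  have N2: "?N \<ge> 2" using N by simp
  obtain K where K: "\<And>j r. j \<ge> 1 \<Longrightarrow> r > 0 \<Longrightarrow>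
      r powr (2 * real j + ?N - 1) * exp (- 2 * r) * ((2 * real j + ?N) / ?N) \<le> K * ladder_prod ?N j"
    using ladder_prod_growth_le[OF N2] by blast
  define K' where "K' = max K 1"
  have "M2 (zonal k j) r \<le> sqrt K' * (exp r / r powr ((?N - 1) / 2))" if j: "j \<ge> 1" and r: "r > 0" for j r
  proof (rule power2_le_imp_le)
    have e: "(exp r / r powr ((?N - 1) / 2))\<^sup>2 = exp (2 * r) / r powr (?N - 1)"
      by (simp add: power_divide exp_double power2_eq_square[of "_ powr _"] flip: powr_add)
    have q: "ladder_prod ?N j > 0" by (rule ladder_prod_pos[OF N2])
    have "r powr (2 * real j + ?N - 1) = r ^ (2 * j) * r powr (?N - 1)"
      using r by (simp add: powr_realpow[symmetric] add_diff_eq flip: powr_add)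
    then have "r ^ (2 * j) * ((2 * real j + ?N) / ?N) * (r powr (?N - 1) * exp (- 2 * r)) \<le> K * ladder_prod ?N j"
      using K[OF j r] by (simp add: mult_ac)
    also have "\<dots> \<le> K' * ladder_prod ?N j" using q by (intro mult_right_mono) (auto simp: K'_def)
    finally have "r ^ (2 * j) * ((2 * real j + ?N) / ?N) * (r powr (?N - 1) * exp (- 2 * r)) / ladder_prod ?N j \<le> K'"
      using q by (simp only: pos_divide_le_eq)
    then have "(M2 (zonal k j) r)\<^sup>2 * (r powr (?N - 1) * exp (- 2 * r)) \<le> K'"
      unfolding M2_zonal[OF N r] by (simp add: mult_ac)
    moreover have "r powr (?N - 1) * exp (- 2 * r) = 1 / (exp (2 * r) / r powr (?N - 1))"
      by (simp add: exp_minus field_simps)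
    ultimately have "(M2 (zonal k j) r)\<^sup>2 / (exp (2 * r) / r powr (?N - 1)) \<le> K'"
      by (simp only: times_divide_eq_right mult_1_right)
    moreover have "exp (2 * r) / r powr (?N - 1) > 0" using r by simp
    ultimately have "(M2 (zonal k j) r)\<^sup>2 \<le> K' * (exp (2 * r) / r powr (?N - 1))"
      by (simp only: pos_divide_le_eq)
    then show "(M2 (zonal k j) r)\<^sup>2 \<le> (sqrt K' * (exp r / r powr ((?N - 1) / 2)))\<^sup>2"
      unfolding power_mult_distrib e by (simp add: K'_def)
  qed (simp add: K'_def)
  moreover have "sqrt K' > 0" by (simp add: K'_def)
  ultimately show ?thesis using that by blast
qed

text \<open>Factorial decay on a bounded range of radii allows a term of high degree to be
  negligible up to a prescribed radius. The base 2 absorbs the factor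
  \<open>(2 j + N) / N\<close>.\<close>

lemma M2_zonal_small:
  fixes k :: "'n::finite"
  assumes N: "CARD('n) \<ge> 2" and r: "0 < r" "r \<le> R"
  shows "M2 (zonal k j) r \<le> (2 * R) ^ j / fact j"
proof (rule power2_le_imp_le)
  let ?N = "real CARD('n)"
  have N2: "?N \<ge> 2" using N by simp
  have "(2 * real j + ?N) / ?N \<le> 2 ^ (2 * j)"
  proof -
    have "(2 * real j + ?N) / ?N = 1 + (2 * real j) / ?N" using N2 by (simp add: add_divide_distrib)
    also have "(2 * real j) / ?N \<le> (2 * real j) / 2" using N2 by (intro divide_left_mono) auto
    also have "1 + (2 * real j) / 2 = real (Suc j)" by simp
    also have "\<dots> \<le> 2 ^ j" using Suc_leI[OF less_exp[of j]] by (metis of_nat_le_iff of_nat_numeral of_nat_power)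
    also have "\<dots> \<le> 2 ^ (2 * j)" by (intro power_increasing) auto
    finally show ?thesis by simp
  qed
  then have "(M2 (zonal k j) r)\<^sup>2 \<le> R ^ (2 * j) * 2 ^ (2 * j) / (fact j)\<^sup>2"
    unfolding M2_zonal[OF N r(1)] using r N2 ladder_prod_ge_fact[OF N2, of j]
    by (intro frac_le mult_mono power_mono) auto
  also have "\<dots> = ((2 * R) ^ j / fact j)\<^sup>2"
    by (simp add: power_mult_distrib power_divide power_mult[symmetric] mult.commute)
  finally show "(M2 (zonal k j) r)\<^sup>2 \<le> ((2 * R) ^ j / fact j)\<^sup>2" .
qed (use r in simp)

text \<open>Minkowski's inequality for series, from the Cauchy--Schwarz inequality with weights \<open>M2 (zonal k j) r\<close>.\<close>

lemma M2_zonal_series_le: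
  fixes k :: "'n::finite"
  assumes N: "CARD('n) \<ge> 2" and a: "\<And>j. \<bar>a j\<bar> \<le> K * 2 ^ j" and a0: "\<And>j. a j \<ge> 0" and r: "r > 0"
    and S: "\<And>J. (\<Sum>j<J. a j * M2 (zonal k j) r) \<le> S"
  shows "M2 (zonal_series k a) r \<le> S"
proof -
  let ?B = "emeasure lborel (ball (0 :: real ^ 'n) 1)"
  define m where "m j = M2 (zonal k j) r" for j
  have m: "m j > 0" for j unfolding m_def by (rule M2_zonal_pos[OF N r])
  have S0: "S \<ge> 0" using S[of 0] by simp
  have [measurable]: "zonal k j \<in> borel_measurable borel" for j
    by (rule borel_measurable_continuous_onI[OF zonal_continuous])
  have c: "continuous_on UNIV (zonal_series k a)"
    by (rule harmonic_spaceD(2)[OF zonal_series_harmonic[OF N a]])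
  let ?p = "\<lambda>y :: real ^ 'n. (r / norm y) *\<^sub>R y"
  \<comment> \<open>The weight \<open>m j\<close> makes the spherical mean of \<open>q j\<close>
    equal to \<open>a j * m j\<close>, so that after integration both factors of Cauchy-Schwarz are
    bounded by \<open>S\<close>.\<close>
  define q where "q j z = a j * (zonal k j z)\<^sup>2 / m j" for j z
  have q0: "q j z \<ge> 0" for j z using a0[of j] m[of j] by (simp add: q_def)
  have [measurable]: "q j \<in> borel_measurable borel" for j unfolding q_def by measurable
  have pt: "ennreal ((zonal_series k a z)\<^sup>2) \<le> ennreal S * (\<Sum>j. ennreal (q j z))" for z
  proof (rule LIMSEQ_le_const2)
    have "(\<lambda>J. \<Sum>j<J. a j * zonal k j z) \<longlonglongrightarrow> zonal_series k a z"
      by (rule tendsto_uniform_limitI[OF zonal_series_uniform_limit[where r = "norm z", OF N a]]) simp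
    then show "(\<lambda>J. ennreal ((\<Sum>j<J. a j * zonal k j z)\<^sup>2)) \<longlonglongrightarrow> ennreal ((zonal_series k a z)\<^sup>2)"
      by (intro tendsto_ennrealI tendsto_power)
    have "ennreal ((\<Sum>j<J. a j * zonal k j z)\<^sup>2) \<le> ennreal S * (\<Sum>j. ennreal (q j z))" for J
    proof -
      have "(\<Sum>j<J. a j * zonal k j z) = (\<Sum>j<J. sqrt (a j * m j) * (sqrt (a j / m j) * zonal k j z))"
      proof (rule sum.cong)
        fix j
        have "sqrt (a j * m j) * sqrt (a j / m j) = a j"
          using a0[of j] m[of j] by (simp add: real_sqrt_mult[symmetric])
        then show "a j * zonal k j z = sqrt (a j * m j) * (sqrt (a j / m j) * zonal k j z)"
          by (simp only: mult.assoc[symmetric])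
      qed simp
      then have "(\<Sum>j<J. a j * zonal k j z)\<^sup>2 \<le> (\<Sum>j<J. (sqrt (a j * m j))\<^sup>2) * (\<Sum>j<J. (sqrt (a j / m j) * zonal k j z)\<^sup>2)"
        by (simp only: Cauchy_Schwarz_ineq_sum)
      also have "(\<Sum>j<J. (sqrt (a j * m j))\<^sup>2) = (\<Sum>j<J. a j * m j)"
        using a0 m by (intro sum.cong) (auto simp: less_imp_le)
      also have "(\<Sum>j<J. (sqrt (a j / m j) * zonal k j z)\<^sup>2) = (\<Sum>j<J. q j z)"
        using a0 m by (intro sum.cong) (auto simp: q_def power_mult_distrib less_imp_le)
      also have "(\<Sum>j<J. a j * m j) * (\<Sum>j<J. q j z) \<le> S * (\<Sum>j<J. q j z)"
        using S by (intro mult_right_mono sum_nonneg q0) (auto simp: m_def)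
      finally have "ennreal ((\<Sum>j<J. a j * zonal k j z)\<^sup>2) \<le> ennreal (S * (\<Sum>j<J. q j z))" by (rule ennreal_leI)
      also have "\<dots> = ennreal S * (\<Sum>j<J. ennreal (q j z))"
        using S0 by (simp add: ennreal_mult' sum_ennreal q0)
      also have "\<dots> \<le> ennreal S * (\<Sum>j. ennreal (q j z))"
        by (intro mult_left_mono sum_le_suminf) auto
      finally show ?thesis .
    qed
    then show "\<exists>J0. \<forall>J\<ge>J0. ennreal ((\<Sum>j<J. a j * zonal k j z)\<^sup>2) \<le> ennreal S * (\<Sum>j. ennreal (q j z))" by blast
  qed
  have qi: "(\<integral>\<^sup>+y. ennreal (q j (?p y)) * indicator (ball 0 1) y \<partial>lborel) / ?B = ennreal (a j * m j)" for j
  proof -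
    have "(\<integral>\<^sup>+y. ennreal (q j (?p y)) * indicator (ball 0 1) y \<partial>lborel)
        = (\<integral>\<^sup>+y. ennreal (a j / m j) * (ennreal ((zonal k j (?p y))\<^sup>2) * indicator (ball 0 1) y) \<partial>lborel)"
      using a0[of j] m[of j] by (intro nn_integral_cong) (simp add: q_def mult.assoc[symmetric] flip: ennreal_mult'')
    also have "\<dots> = ennreal (a j / m j) * (\<integral>\<^sup>+y. ennreal ((zonal k j (?p y))\<^sup>2) * indicator (ball 0 1) y \<partial>lborel)"
      by (rule nn_integral_cmult) measurable
    finally have "(\<integral>\<^sup>+y. ennreal (q j (?p y)) * indicator (ball 0 1) y \<partial>lborel) / ?B = ennreal (a j / m j) * ennreal ((m j)\<^sup>2)"
      unfolding m_def M2_sq(1)[OF zonal_continuous r] by (simp add: ennreal_times_divide)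
    also have "\<dots> = ennreal (a j * m j)"
      using a0[of j] m[of j] by (simp add: power2_eq_square flip: ennreal_mult'')
    finally show ?thesis .
  qed
  have "ennreal ((M2 (zonal_series k a) r)\<^sup>2)
      \<le> (\<integral>\<^sup>+y. ennreal S * (\<Sum>j. ennreal (q j (?p y)) * indicator (ball 0 1) y) \<partial>lborel) / ?B"
    unfolding M2_sq(1)[OF c r]
  proof (intro divide_right_mono_ennreal nn_integral_mono)
    fix y :: "real ^ 'n"
    show "ennreal ((zonal_series k a (?p y))\<^sup>2) * indicator (ball 0 1) y \<le> ennreal S * (\<Sum>j. ennreal (q j (?p y)) * indicator (ball 0 1) y)"
      using pt[of "?p y"] by (auto simp: indicator_def)
  qed
  also have "(\<integral>\<^sup>+y. ennreal S * (\<Sum>j. ennreal (q j (?p y)) * indicator (ball 0 1) y) \<partial>lborel)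
      = ennreal S * (\<integral>\<^sup>+y. (\<Sum>j. ennreal (q j (?p y)) * indicator (ball 0 1) y) \<partial>lborel)"
    by (rule nn_integral_cmult) measurable
  also have "(\<integral>\<^sup>+y. (\<Sum>j. ennreal (q j (?p y)) * indicator (ball 0 1) y) \<partial>lborel)
      = (\<Sum>j. \<integral>\<^sup>+y. ennreal (q j (?p y)) * indicator (ball 0 1) y \<partial>lborel)"
    by (rule nn_integral_suminf) measurable
  also have "ennreal S * (\<Sum>j. \<integral>\<^sup>+y. ennreal (q j (?p y)) * indicator (ball 0 1) y \<partial>lborel) / ?B
      = ennreal S * (\<Sum>j. (\<integral>\<^sup>+y. ennreal (q j (?p y)) * indicator (ball 0 1) y \<partial>lborel) / ?B)"
    by (simp add: divide_ennreal_def mult.assoc)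
  also have "\<dots> = ennreal S * (\<Sum>j. ennreal (a j * m j))" by (simp only: qi)
  also have "\<dots> \<le> ennreal S * ennreal S"
  proof (intro mult_left_mono suminf_le_const)
    show "(\<Sum>j<J. ennreal (a j * m j)) \<le> ennreal S" for J
      using S[of J] a0 m by (subst sum_ennreal) (auto simp: m_def less_imp_le intro!: ennreal_leI)
  qed auto
  also have "\<dots> = ennreal (S\<^sup>2)" using S0 by (simp add: power2_eq_square flip: ennreal_mult'')
  finally have "(M2 (zonal_series k a) r)\<^sup>2 \<le> S\<^sup>2" by (subst (asm) ennreal_le_iff) auto
  then show ?thesis using S0 by (rule power2_le_imp_le)
qed

text \<open>\<open>R l\<close> is the radius from which term \<open>l\<close> may count fully,
  \<open>T l\<close> the degree from which it is negligible up to \<open>R l\<close>. At radius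
  \<open>r\<close>, with \<open>L\<close> the last index such that \<open>R L <= r\<close>, the full
  terms contribute at most \<open>K * L * (L + 1)\<close> and the others a geometric series, in
  units of \<open>?g r\<close>.\<close>

lemma irregular_growth:
  fixes k :: "'n::finite" and \<phi> :: "real \<Rightarrow> real"
  assumes N: "CARD('n) \<ge> 2" and lim: "filterlim \<phi> at_top at_top"
  obtains h :: "real ^ 'n \<Rightarrow> real" where "irregular_vector harmonic_space sup_seminorm (partial_deriv k) h"
    "\<forall>\<^sub>F r in at_top. M2 h r \<le> \<phi> r * (exp r / r powr ((real CARD('n) - 1) / 2))"
proof -
  let ?N = "real CARD('n)"
  let ?g = "\<lambda>r. exp r / r powr ((?N - 1) / 2)"
  obtain K where K: "K > 0" "\<And>j r. j \<ge> 1 \<Longrightarrow> r > 0 \<Longrightarrow> M2 (zonal k j) r \<le> K * ?g r"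
    using M2_zonal_le[OF N, of k] by blast
  \<comment> \<open>The threshold allows for \<open>l + 1\<close> terms of size at most
    \<open>K * l\<close>, plus 2 for the geometric series; \<open>real l \<le> R\<close> leaves only
    finitely many thresholds below any radius.\<close>
  have "\<exists>R. R > 0 \<and> real l \<le> R \<and> (\<forall>r\<ge>R. \<phi> r \<ge> K * (real l * (real l + 1)) + 2)" for l
  proof -
    have "\<forall>\<^sub>F r in at_top. \<phi> r \<ge> K * (real l * (real l + 1)) + 2"
      using lim by (simp add: filterlim_at_top)
    then obtain R0 where "\<And>r. r \<ge> R0 \<Longrightarrow> \<phi> r \<ge> K * (real l * (real l + 1)) + 2"
      unfolding eventually_at_top_linorder by blast
    then show ?thesis by (intro exI[of _ "max R0 (real l + 1)"]) auto
  qed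
  then obtain R where R: "\<And>l. R l > 0" "\<And>l. real l \<le> R l"
      "\<And>l r. r \<ge> R l \<Longrightarrow> \<phi> r \<ge> K * (real l * (real l + 1)) + 2"
    by metis
  have gpos: "?g r > 0" if "r > 0" for r using that by simp
  have "\<exists>T. \<forall>j\<ge>T. \<forall>r. 0 < r \<and> r \<le> R l \<longrightarrow> real l * M2 (zonal k j) r \<le> (1 / 2) ^ l * ?g r" for l
  proof -
    \<comment> \<open>\<open>real l + 1\<close> avoids division by 0 at \<open>l = 0\<close>; the
      power of \<open>R l\<close> enters because \<open>?g r\<close> is at least
      \<open>1 / R l powr ((?N - 1) / 2)\<close> for \<open>r\<close> up to
      \<open>R l\<close>.\<close>
    let ?c = "(1 / 2) ^ l / ((real l + 1) * R l powr ((?N - 1) / 2))"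
    have c: "?c > 0" using R(1)[of l] by simp
    have "(\<lambda>j. (2 * R l) ^ j / fact j) \<longlonglongrightarrow> 0"
      by (rule summable_LIMSEQ_zero[OF summable_exp_divide])
    then have "\<forall>\<^sub>F j in sequentially. (2 * R l) ^ j / fact j < ?c" using c by (rule order_tendstoD)
    then obtain T where T: "\<And>j. j \<ge> T \<Longrightarrow> (2 * R l) ^ j / fact j < ?c"
      unfolding eventually_sequentially by blast
    have "real l * M2 (zonal k j) r \<le> (1 / 2) ^ l * ?g r" if j: "j \<ge> T" and r: "0 < r" "r \<le> R l" for j r
    proof -
      have "real l * M2 (zonal k j) r \<le> (real l + 1) * ?c"
        using M2_zonal_small[OF N r, of k j] T[OF j] M2_zonal_pos[OF N r(1), of k j] by (intro mult_mono) auto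
      also have "\<dots> = (1 / 2) ^ l * (1 / R l powr ((?N - 1) / 2))"
      proof -
        have "x * (y / (x * z)) = y * (1 / z)" if "x \<noteq> 0" for x y z :: real using that by simp
        from this[of "real l + 1"] show ?thesis by simp
      qed
      also have "\<dots> \<le> (1 / 2) ^ l * ?g r"
        using r N by (intro mult_left_mono frac_le powr_mono2) auto
      finally show ?thesis .
    qed
    then show ?thesis by blast
  qed
  then obtain T where T: "\<And>l j r. j \<ge> T l \<Longrightarrow> 0 < r \<Longrightarrow> r \<le> R l \<Longrightarrow> real l * M2 (zonal k j) r \<le> (1 / 2) ^ l * ?g r"
    by metis
  \<comment> \<open>Both demands at once: degree at least \<open>T l\<close>, and the gap required
    by \<open>zonal_series_irregular\<close>.\<close>
  define n where "n = rec_nat (max 1 (T 0)) (\<lambda>l m. max (T (Suc l)) (m + l + 3))"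
  have n0: "n 0 \<ge> 1" by (simp add: n_def)
  have gap: "n (Suc l) \<ge> n l + l + 3" for l by (simp add: n_def)
  have nT: "n l \<ge> T l" for l by (cases l) (simp_all add: n_def)
  have mono: "strict_mono n"
  proof (rule strict_monoI_Suc)
    show "n l < n (Suc l)" for l using gap[of l] by linarith
  qed
  have inj: "inj n" using mono strict_mono_imp_inj_on by blast
  have le: "l \<le> n l" for l using mono by (rule strict_mono_imp_increasing)
  have pos: "n l \<ge> 1" for l using n0 gap by (cases l) (auto intro: order_trans[OF _ gap])
  let ?a = "lacunary n"
  have at: "?a (n l) = real l" for l using inj by (simp add: lacunary_def)
  have a0: "?a j \<ge> 0" for j by (simp add: lacunary_def)
  have a: "\<bar>?a j\<bar> \<le> 1 * 2 ^ j" for j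
  proof (cases "j \<in> range n")
    case True
    then obtain l where l: "j = n l" by auto
    have "real l \<le> real j" using le[of l] l by simp
    also have "\<dots> \<le> 2 ^ j" by (simp add: of_nat_less_two_power less_imp_le)
    finally show ?thesis using at[of l] l by simp
  qed (simp add: lacunary_def)
  have "M2 (zonal_series k ?a) r \<le> \<phi> r * ?g r" if r: "r \<ge> R 0" for r
  proof -
    have r0: "r > 0" using r R(1)[of 0] by linarith
    define A where "A = {l. R l \<le> r}"
    have "l \<le> nat \<lceil>r\<rceil>" if "R l \<le> r" for l
      using R(2)[of l] that real_nat_ceiling_ge[of r] by linarith
    then have "A \<subseteq> {..nat \<lceil>r\<rceil>}" by (auto simp: A_def)
    then have finA: "finite A" by (rule finite_subset) simp
    have neA: "A \<noteq> {}" using r by (auto simp: A_def)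
    define L where "L = Max A"
    have LA: "R L \<le> r" using Max_in[OF finA neA] by (simp add: L_def A_def)
    \<comment> \<open>\<open>R\<close> need not be monotone, so an index below \<open>L\<close> may
      have its threshold above \<open>r\<close>; all indices up to \<open>L\<close> are charged the
      full bound.\<close>
    have Lge: "l \<le> L" if "R l \<le> r" for l using Max_ge[OF finA, of l] that by (simp add: L_def A_def)
    have trm: "real l * M2 (zonal k (n l)) r \<le> ((if l \<le> L then K * real L else 0) + (1 / 2) ^ l) * ?g r" for l
    proof (cases "R l \<le> r")
      case True
      have "real l * M2 (zonal k (n l)) r \<le> real L * (K * ?g r)"
        using Lge[OF True] K(2)[OF pos r0, of l] M2_zonal_pos[OF N r0, of k "n l"] by (intro mult_mono) auto
      also have "\<dots> \<le> ((if l \<le> L then K * real L else 0) + (1 / 2) ^ l) * ?g r"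
      proof -
        have "real L * (K * g) \<le> (K * real L + (1 / 2) ^ l) * g" if "g > 0" for g :: real
          using that by (simp add: distrib_right mult_ac)
        from this[OF gpos[OF r0]] show ?thesis using Lge[OF True] by simp
      qed
      finally show ?thesis .
    next
      case False
      have "real l * M2 (zonal k (n l)) r \<le> (1 / 2) ^ l * ?g r"
        using T[OF nT r0, of l] False by simp
      also have "\<dots> \<le> ((if l \<le> L then K * real L else 0) + (1 / 2) ^ l) * ?g r"
        using gpos[OF r0] K(1) by (intro mult_right_mono) auto
      finally show ?thesis .
    qed
    show ?thesis
    proof (rule M2_zonal_series_le[OF N a a0 r0])
      fix J
      \<comment> \<open>Since \<open>l \<le> n l\<close>, a nonzero coefficient before position
        \<open>J\<close> has index \<open>l < J\<close>.\<close>
      have "(\<Sum>j<J. ?a j * M2 (zonal k j) r) = (\<Sum>j\<in>{..<J} \<inter> n ` {..<J}. ?a j * M2 (zonal k j) r)"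
      proof (rule sum.mono_neutral_right)
        have "?a j = 0" if "j < J" "j \<notin> n ` {..<J}" for j
        proof (cases "j \<in> range n")
          case True
          then obtain l where "j = n l" by auto
          then show ?thesis using that le[of l] by auto
        qed (simp add: lacunary_def)
        then show "\<forall>j\<in>{..<J} - {..<J} \<inter> n ` {..<J}. ?a j * M2 (zonal k j) r = 0" by auto
      qed auto
      also have "\<dots> \<le> (\<Sum>j\<in>n ` {..<J}. ?a j * M2 (zonal k j) r)"
        by (rule sum_mono2) (auto intro!: mult_nonneg_nonneg a0 M2_sq(2) zonal_continuous r0)
      also have "\<dots> = (\<Sum>l<J. real l * M2 (zonal k (n l)) r)"
        using inj by (subst sum.reindex) (auto simp: at intro: inj_on_subset[OF inj])
      also have "\<dots> \<le> (\<Sum>l<J. ((if l \<le> L then K * real L else 0) + (1 / 2) ^ l) * ?g r)"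
        by (intro sum_mono trm)
      also have "\<dots> = ((\<Sum>l<J. if l \<le> L then K * real L else 0) + (\<Sum>l<J. (1 / 2) ^ l)) * ?g r"
        by (simp only: sum_distrib_right[symmetric] sum.distrib)
      also have "\<dots> \<le> (K * (real L * (real L + 1)) + 2) * ?g r"
      proof (intro mult_right_mono add_mono)
        have "(\<Sum>l<J. if l \<le> L then K * real L else 0) = (\<Sum>l\<in>{..<J} \<inter> {..L}. K * real L)"
          by (subst sum.inter_restrict) auto
        also have "\<dots> \<le> (\<Sum>l\<in>{..L}. K * real L)" using K(1) by (intro sum_mono2) auto
        finally show "(\<Sum>l<J. if l \<le> L then K * real L else 0) \<le> K * (real L * (real L + 1))"
          by (simp add: mult_ac add.commute)
        have "(\<Sum>l<J. (1 / 2 :: real) ^ l) \<le> (\<Sum>l. (1 / 2) ^ l)"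
          by (intro sum_le_suminf summable_geometric) auto
        then show "(\<Sum>l<J. (1 / 2 :: real) ^ l) \<le> 2" by (simp add: suminf_geometric)
      qed (use gpos[OF r0] in simp)
      also have "\<dots> \<le> \<phi> r * ?g r"
        using R(3)[OF LA] gpos[OF r0] by (intro mult_right_mono) auto
      finally show "(\<Sum>j<J. ?a j * M2 (zonal k j) r) \<le> \<phi> r * ?g r" .
    qed
  qed
  then have "\<forall>\<^sub>F r in at_top. M2 (zonal_series k ?a) r \<le> \<phi> r * ?g r"
    unfolding eventually_at_top_linorder by blast
  with zonal_series_irregular[OF N n0 gap, of k] show ?thesis by (rule that)
qed

theorem theorem4p3:
  fixes k :: "'n::{finite,linorder}"
  assumes "CARD('n) \<ge> 2"
  shows "(\<forall>\<phi> :: real \<Rightarrow> real.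
      (\<forall>r\<ge>0. \<phi> r \<ge> 0) \<and> filterlim \<phi> at_top at_top \<longrightarrow>
      (\<exists>h :: real ^ ('n::{finite,linorder}) \<Rightarrow> real.
        irregular_vector harmonic_space sup_seminorm (partial_deriv k) h \<and>
        (\<forall>\<^sub>F r in at_top.
          M2 h r \<le> \<phi> r * (exp r / r powr ((real CARD('n) - 1) / 2)))))
    \<and> (\<forall>\<alpha> :: nat ^ ('n::{finite,linorder}).
      \<not> (\<exists>h :: real ^ ('n::{finite,linorder}) \<Rightarrow> real.
        irregular_vector harmonic_space sup_seminorm (multi_deriv \<alpha>) h \<and>
        (\<exists>C>0. \<forall>r>0.
          M2 h r \<le> C * (exp r / r powr ((real CARD('n) - 1) / 2)))))"
proof (intro conjI allI impI notI)
  fix \<phi> :: "real \<Rightarrow> real"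
  assume "(\<forall>r\<ge>0. \<phi> r \<ge> 0) \<and> filterlim \<phi> at_top at_top"
  then obtain h :: "real ^ ('n::{finite,linorder}) \<Rightarrow> real" where "irregular_vector harmonic_space sup_seminorm (partial_deriv k) h"
    "\<forall>\<^sub>F r in at_top. M2 h r \<le> \<phi> r * (exp r / r powr ((real CARD('n) - 1) / 2))"
    using irregular_growth[OF assms, of \<phi> k] by blast
  then show "\<exists>h :: real ^ ('n::{finite,linorder}) \<Rightarrow> real. irregular_vector harmonic_space sup_seminorm (partial_deriv k) h \<and>
      (\<forall>\<^sub>F r in at_top. M2 h r \<le> \<phi> r * (exp r / r powr ((real CARD('n) - 1) / 2)))"
    by blast
next
  fix \<alpha> :: "nat ^ ('n::{finite,linorder})"
  assume "\<exists>h :: real ^ ('n::{finite,linorder}) \<Rightarrow> real. irregular_vector harmonic_space sup_seminorm (multi_deriv \<alpha>) h \<and>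
      (\<exists>C>0. \<forall>r>0. M2 h r \<le> C * (exp r / r powr ((real CARD('n) - 1) / 2)))"
  then obtain h :: "real ^ ('n::{finite,linorder}) \<Rightarrow> real" and C where
    h: "irregular_vector harmonic_space sup_seminorm (multi_deriv \<alpha>) h" and C: "C > 0"
      "\<And>r. r > 0 \<Longrightarrow> M2 h r \<le> C * (exp r / r powr ((real CARD('n) - 1) / 2))"
    by blast
  show False using not_irregular_multi_deriv[OF assms C] h by blast
qed

end
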